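(* The equivalence of categories $M:\mathcal{SG}\to\mathcal{SMF}$ induces a functor $k^{mult}_*:\mathcal{SG}\to\mathrm{Igr}$, given on objects by $k^{mult}_*(G):=k^{mult}_*(M(G))$ and on morphisms $f:G\to H$ by $k^{mult}_*(f):=k^{mult}_*(M(f))$. Moreover, for every special group $G$ there is an isomorphism of inductive graded rings $$k^{mult}_*(M(G))\cong k^{dm}_*(G).$$
   Context: **Special groups.** A special group is $(G,-1,\equiv)$ with $G$ a multiplicative group of exponent 2, $-1\in G$, and $\equiv$ a relation on $G^2$ such that: $\equiv$ is an equivalence relation; $\langle a,b\rangle\equiv\langle b,a\rangle$; $\langle a,-a\rangle\equiv\langle1,-1\rangle$; $\langle a,b\rangle\equiv\langle c,d\rangle\Rightarrow ab=cd$; $\langle a,b\rangle\equiv\langle c,d\rangle\Rightarrow\langle a,-c\rangle\equiv\langle -b,d\rangle$; $\langle a,b\rangle\equiv\langle c,d\rangle\Rightarrow\langle ga,gb\rangle\equiv\langle gc,gd\rangle$ for all $g$; and the relation on $G^3$ given by $\langle a_1,a_2,a_3\rangle\equiv\langle b_1,b_2,b_3\rangle$ iff there are $x,y,z\in G$ with $\langle a_1,x\rangle\equiv\langle b_1,y\rangle$, $\langle a_2,a_3\rangle\equiv\langle x,z\rangle$, $\langle b_2,b_3\rangle\equiv\langle y,z\rangle$, is transitive. $D_G(a,b)=\{c:\exists d,\ \langle c,d\rangle\equiv\langle a,b\rangle\}$. Morphisms of special groups are group homomorphisms with $f(-1)=-1$ preserving $\equiv$. $\mathcal{SG}$ is the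 category of special groups. **Hyperfields.** A commutative multigroup is $(G,+,-,0)$ with $+:G\times G\to\mathcal P(G)\setminus\{\emptyset\}$, $-:G\to G$, such that: $z\in x+y$ implies $x\in z+(-y)$ and $y\in(-x)+z$; $y\in 0+x$ iff $x=y$; $+$ is associative (extended to sets by unions) and commutative. A multiring is $(R,+,\cdot,-,0,1)$ with $(R,+,-,0)$ a commutative multigroup, $(R,\cdot,1)$ a commutative monoid, $a\cdot 0=0$, $(a+b)d\subseteq ad+bd$. A hyperfield is a multiring in which every non-zero element is invertible; $\dot F=F\setminus\{0\}$. Morphisms $f$ satisfy $c\in a+b\Rightarrow f(c)\in f(a)+f(b)$, $f(-a)=-f(a)$, $f(0)=0$, $f(ab)=f(a)f(b)$, $f(1)=1$. **$M(G)$.** For a special group $G$, $M(G)=G\cup\{0\}$ is the hyperfield with product extending that of $G$ by $a\cdot0=0$, $-a=(-1)a$, $a+0=0+a=\{a\}$, $a+(-a)=M(G)$ for $a\neq0$, and $a+b=D_G(a,b)$ otherwise; $M(f)$ extends $f$ by $0\mapsto0$. $\mathcal{SMF}$ (special multifields) is the category of hyperfields of the form $M(G)$, $G$ a special group. **K-theories.** $k^{dm}_*(G)$: the tensor algebra over $\mathbb F_2$ of $k_1G$ ($=G$ written additively via $\lambda:G\to k_1G$, $\lambda(ab)=\lambda(a)+\lambda(b)$) modulo the ideal generated by $\lambda(a)\otimes\lambda(ab)$ with $a,b\in G$, $a\in D_G(1,b)$. $k^{mult}_*(F)$ for a hyperfield $F$: $k_n=K_n/2K_n$ ($n\ge0$)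 where $K_0=\mathbb Z$ and $K_*$ is the tensor algebra over $\mathbb Z$ of $\dot F$ (written additively via $\rho$) modulo the ideal generated by $\rho(a)\otimes\rho(b)$, $a\neq0,1$, $b\in1-a$; a morphism $\varphi$ induces $\rho(a_1)\cdots\rho(a_n)\mapsto\rho(\varphi(a_1))\cdots\rho(\varphi(a_n))$. **Inductive graded rings.** $\mathrm{Igr}$: objects consist of groups $R_n$ ($n\ge0$) of exponent 2 with distinguished elements $\top_n$, $R_0\cong\mathbb F_2$, products $\ast_{nm}:R_n\times R_m\to R_{n+m}$ making $\bigoplus R_n$ a commutative graded ring, and homomorphisms $h_n=\top_1\ast(\_):R_n\to R_{n+1}$ with $h_n(\top_n)=\top_{n+1}$ and compatible with products (if $h_n^p:R_n\to R_p$ are the iterated maps, $h^p_n(x)\ast h^q_m(y)=h^{p+q}_{n+m}(x\ast y)$). Morphisms are graded unital ring homomorphisms preserving all $\top_n$. The K-theories are objects of $\mathrm{Igr}$ with $\top_0=1$ and $\top_n=\lambda(-1)^n$, resp. $\rho(-1)^n$. *)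

theory Defs
  imports "HOL-Algebra.QuotRing" "HOL-Algebra.Module" "HOL-Library.Z2"
begin

section \<open>Categories, functors and equivalences\<close>

text \<open>Hom-sets of distinct pairs of objects need not be disjoint, so composition (and the action
  of a functor on morphisms) takes the objects involved as arguments: \<open>Cmp C X Y Z g f\<close> is the
  composite of \<open>f : X \<rightarrow> Y\<close> and \<open>g : Y \<rightarrow> Z\<close>.\<close>

record ('o, 'm) category =
  Obj :: "'o set"
  Hom :: "'o \<Rightarrow> 'o \<Rightarrow> 'm set"
  Idn :: "'o \<Rightarrow> 'm"
  Cmp :: "'o \<Rightarrow> 'o \<Rightarrow> 'o \<Rightarrow> 'm \<Rightarrow> 'm \<Rightarrow> 'm"

definition is_category :: "('o, 'm) category \<Rightarrow> bool" where
  "is_category C \<longleftrightarrow>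
     (\<forall>X\<in>Obj C. Idn C X \<in> Hom C X X) \<and>
     (\<forall>X\<in>Obj C. \<forall>Y\<in>Obj C. \<forall>Z\<in>Obj C. \<forall>f\<in>Hom C X Y. \<forall>g\<in>Hom C Y Z.
        Cmp C X Y Z g f \<in> Hom C X Z) \<and>
     (\<forall>X\<in>Obj C. \<forall>Y\<in>Obj C. \<forall>f\<in>Hom C X Y.
        Cmp C X X Y f (Idn C X) = f \<and> Cmp C X Y Y (Idn C Y) f = f) \<and>
     (\<forall>W\<in>Obj C. \<forall>X\<in>Obj C. \<forall>Y\<in>Obj C. \<forall>Z\<in>Obj C.
        \<forall>f\<in>Hom C W X. \<forall>g\<in>Hom C X Y. \<forall>h\<in>Hom C Y Z.
        Cmp C W Y Z h (Cmp C W X Y g f) = Cmp C W X Z (Cmp C X Y Z h g) f)"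

definition is_iso :: "('o, 'm) category \<Rightarrow> 'o \<Rightarrow> 'o \<Rightarrow> 'm \<Rightarrow> bool" where
  "is_iso C X Y f \<longleftrightarrow> f \<in> Hom C X Y \<and>
     (\<exists>g\<in>Hom C Y X. Cmp C X Y X g f = Idn C X \<and> Cmp C Y X Y f g = Idn C Y)"

record ('o, 'm, 'p, 'n) cat_functor =
  fobj :: "'o \<Rightarrow> 'p"
  fmor :: "'o \<Rightarrow> 'o \<Rightarrow> 'm \<Rightarrow> 'n"

definition is_functor ::
  "('o, 'm) category \<Rightarrow> ('p, 'n) category \<Rightarrow> ('o, 'm, 'p, 'n) cat_functor \<Rightarrow> bool" where
  "is_functor C D F \<longleftrightarrow> is_category C \<and> is_category D \<and>
     (\<forall>X\<in>Obj C. fobj F X \<in> Obj D) \<and>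
     (\<forall>X\<in>Obj C. \<forall>Y\<in>Obj C. \<forall>f\<in>Hom C X Y. fmor F X Y f \<in> Hom D (fobj F X) (fobj F Y)) \<and>
     (\<forall>X\<in>Obj C. fmor F X X (Idn C X) = Idn D (fobj F X)) \<and>
     (\<forall>X\<in>Obj C. \<forall>Y\<in>Obj C. \<forall>Z\<in>Obj C. \<forall>f\<in>Hom C X Y. \<forall>g\<in>Hom C Y Z.
        fmor F X Z (Cmp C X Y Z g f) =
          Cmp D (fobj F X) (fobj F Y) (fobj F Z) (fmor F Y Z g) (fmor F X Y f))"

definition id_functor :: "('o, 'm, 'o, 'm) cat_functor" where
  "id_functor = \<lparr>fobj = (\<lambda>X. X), fmor = (\<lambda>X Y f. f)\<rparr>"

definition comp_functor ::
  "('p, 'n, 'q, 'l) cat_functor \<Rightarrow> ('o, 'm, 'p, 'n) cat_functor \<Rightarrow> ('o, 'm, 'q, 'l) cat_functor" where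
  "comp_functor G F =
     \<lparr>fobj = (\<lambda>X. fobj G (fobj F X)),
      fmor = (\<lambda>X Y f. fmor G (fobj F X) (fobj F Y) (fmor F X Y f))\<rparr>"

definition naturally_isomorphic ::
  "('o, 'm) category \<Rightarrow> ('p, 'n) category \<Rightarrow> ('o, 'm, 'p, 'n) cat_functor \<Rightarrow>
     ('o, 'm, 'p, 'n) cat_functor \<Rightarrow> bool" where
  "naturally_isomorphic C D F G \<longleftrightarrow>
     (\<exists>\<eta>. (\<forall>X\<in>Obj C. is_iso D (fobj F X) (fobj G X) (\<eta> X)) \<and>
          (\<forall>X\<in>Obj C. \<forall>Y\<in>Obj C. \<forall>f\<in>Hom C X Y.
             Cmp D (fobj F X) (fobj F Y) (fobj G Y) (\<eta> Y) (fmor F X Y f) =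
             Cmp D (fobj F X) (fobj G X) (fobj G Y) (fmor G X Y f) (\<eta> X)))"

definition is_equivalence ::
  "('o, 'm) category \<Rightarrow> ('p, 'n) category \<Rightarrow> ('o, 'm, 'p, 'n) cat_functor \<Rightarrow> bool" where
  "is_equivalence C D F \<longleftrightarrow> is_functor C D F \<and>
     (\<exists>K. is_functor D C K \<and>
          naturally_isomorphic C C (comp_functor K F) id_functor \<and>
          naturally_isomorphic D D (comp_functor F K) id_functor)"


section \<open>Special groups\<close>

record 'a special_group = "'a monoid" +
  sneg :: 'a
  seq :: "(('a \<times> 'a) \<times> ('a \<times> 'a)) set"

definition sminus :: "'a special_group \<Rightarrow> 'a \<Rightarrow> 'a" where
  "sminus G a = sneg G \<otimes>\<^bsub>G\<^esub> a"

definition seq3 :: "'a special_group \<Rightarrow> (('a \<times> 'a \<times> 'a) \<times> ('a \<times> 'a \<times> 'a)) set" where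
  "seq3 G = {((a1, a2, a3), (b1, b2, b3)) | a1 a2 a3 b1 b2 b3.
     {a1, a2, a3, b1, b2, b3} \<subseteq> carrier G \<and>
     (\<exists>x\<in>carrier G. \<exists>y\<in>carrier G. \<exists>z\<in>carrier G.
        ((a1, x), (b1, y)) \<in> seq G \<and> ((a2, a3), (x, z)) \<in> seq G \<and> ((b2, b3), (y, z)) \<in> seq G)}"

definition special_group :: "'a special_group \<Rightarrow> bool" where
  "special_group G \<longleftrightarrow>
     group G \<and> (\<forall>a\<in>carrier G. a \<otimes>\<^bsub>G\<^esub> a = \<one>\<^bsub>G\<^esub>) \<and> sneg G \<in> carrier G \<and>
     equiv (carrier G \<times> carrier G) (seq G) \<and>
     (\<forall>a\<in>carrier G. \<forall>b\<in>carrier G. ((a, b), (b, a)) \<in> seq G) \<and>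
     (\<forall>a\<in>carrier G. ((a, sminus G a), (\<one>\<^bsub>G\<^esub>, sneg G)) \<in> seq G) \<and>
     (\<forall>a b c d. ((a, b), (c, d)) \<in> seq G \<longrightarrow> a \<otimes>\<^bsub>G\<^esub> b = c \<otimes>\<^bsub>G\<^esub> d) \<and>
     (\<forall>a b c d. ((a, b), (c, d)) \<in> seq G \<longrightarrow> ((a, sminus G c), (sminus G b, d)) \<in> seq G) \<and>
     (\<forall>a b c d. \<forall>g\<in>carrier G. ((a, b), (c, d)) \<in> seq G \<longrightarrow>
        ((g \<otimes>\<^bsub>G\<^esub> a, g \<otimes>\<^bsub>G\<^esub> b), (g \<otimes>\<^bsub>G\<^esub> c, g \<otimes>\<^bsub>G\<^esub> d)) \<in> seq G) \<and>
     trans (seq3 G)"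

definition srep :: "'a special_group \<Rightarrow> 'a \<Rightarrow> 'a \<Rightarrow> 'a set" where
  "srep G a b = {c \<in> carrier G. \<exists>d\<in>carrier G. ((c, d), (a, b)) \<in> seq G}"

text \<open>Morphisms are functions on the carrier; they are taken \<^const>\<open>extensional\<close> so that equality
  of morphisms is equality in HOL. The same convention is used for all categories below.\<close>

definition sg_hom :: "'a special_group \<Rightarrow> 'b special_group \<Rightarrow> ('a \<Rightarrow> 'b) set" where
  "sg_hom G H = {f \<in> hom G H \<inter> extensional (carrier G). f (sneg G) = sneg H \<and>
     (\<forall>a b c d. ((a, b), (c, d)) \<in> seq G \<longrightarrow> ((f a, f b), (f c, f d)) \<in> seq H)}"

definition SG :: "('a special_group, 'a \<Rightarrow> 'a) category" where
  "SG = \<lparr>Obj = {G. special_group G}, Hom = sg_hom,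
         Idn = (\<lambda>G. restrict id (carrier G)),
         Cmp = (\<lambda>G H L g f. compose (carrier G) g f)\<rparr>"


section \<open>Multirings and hyperfields\<close>

record 'a multiring = "'a monoid" +
  hadd :: "'a \<Rightarrow> 'a \<Rightarrow> 'a set"
  hneg :: "'a \<Rightarrow> 'a"
  hzero :: 'a

definition commutative_multigroup :: "'a multiring \<Rightarrow> bool" where
  "commutative_multigroup F \<longleftrightarrow>
     hzero F \<in> carrier F \<and>
     (\<forall>x\<in>carrier F. hneg F x \<in> carrier F) \<and>
     (\<forall>x\<in>carrier F. \<forall>y\<in>carrier F. hadd F x y \<subseteq> carrier F \<and> hadd F x y \<noteq> {}) \<and>
     (\<forall>x\<in>carrier F. \<forall>y\<in>carrier F. \<forall>z\<in>hadd F x y.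
        x \<in> hadd F z (hneg F y) \<and> y \<in> hadd F (hneg F x) z) \<and>
     (\<forall>x\<in>carrier F. \<forall>y\<in>carrier F. y \<in> hadd F (hzero F) x \<longleftrightarrow> x = y) \<and>
     (\<forall>x\<in>carrier F. \<forall>y\<in>carrier F. \<forall>z\<in>carrier F.
        (\<Union>u\<in>hadd F x y. hadd F u z) = (\<Union>v\<in>hadd F y z. hadd F x v)) \<and>
     (\<forall>x\<in>carrier F. \<forall>y\<in>carrier F. hadd F x y = hadd F y x)"

definition multiring :: "'a multiring \<Rightarrow> bool" where
  "multiring F \<longleftrightarrow> commutative_multigroup F \<and> comm_monoid F \<and>
     (\<forall>a\<in>carrier F. a \<otimes>\<^bsub>F\<^esub> hzero F = hzero F) \<and>
     (\<forall>a\<in>carrier F. \<forall>b\<in>carrier F. \<forall>d\<in>carrier F.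
        (\<lambda>x. x \<otimes>\<^bsub>F\<^esub> d) ` hadd F a b \<subseteq> hadd F (a \<otimes>\<^bsub>F\<^esub> d) (b \<otimes>\<^bsub>F\<^esub> d))"

definition hyperfield :: "'a multiring \<Rightarrow> bool" where
  "hyperfield F \<longleftrightarrow> multiring F \<and> carrier F - {hzero F} \<subseteq> Units F"

definition hyperfield_hom :: "'a multiring \<Rightarrow> 'b multiring \<Rightarrow> ('a \<Rightarrow> 'b) set" where
  "hyperfield_hom F F' = {f \<in> (carrier F \<rightarrow> carrier F') \<inter> extensional (carrier F).
     (\<forall>a\<in>carrier F. \<forall>b\<in>carrier F. \<forall>c\<in>hadd F a b. f c \<in> hadd F' (f a) (f b)) \<and>
     (\<forall>a\<in>carrier F. f (hneg F a) = hneg F' (f a)) \<and>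
     f (hzero F) = hzero F' \<and>
     (\<forall>a\<in>carrier F. \<forall>b\<in>carrier F. f (a \<otimes>\<^bsub>F\<^esub> b) = f a \<otimes>\<^bsub>F'\<^esub> f b) \<and>
     f \<one>\<^bsub>F\<^esub> = \<one>\<^bsub>F'\<^esub>}"

definition nonzero :: "'a multiring \<Rightarrow> 'a monoid" where
  "nonzero F = \<lparr>carrier = carrier F - {hzero F}, mult = mult F, one = one F\<rparr>"


section \<open>The functor M\<close>

text \<open>\<^const>\<open>None\<close> is the adjoined zero.\<close>

fun M_mult :: "'a special_group \<Rightarrow> 'a option \<Rightarrow> 'a option \<Rightarrow> 'a option" where
  "M_mult G (Some a) (Some b) = Some (a \<otimes>\<^bsub>G\<^esub> b)"
| "M_mult G None y = None"
| "M_mult G x None = None"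

fun M_add :: "'a special_group \<Rightarrow> 'a option \<Rightarrow> 'a option \<Rightarrow> 'a option set" where
  "M_add G (Some a) (Some b) =
     (if b = sminus G a then insert None (Some ` carrier G) else Some ` srep G a b)"
| "M_add G None y = {y}"
| "M_add G x None = {x}"

definition M :: "'a special_group \<Rightarrow> 'a option multiring" where
  "M G = \<lparr>carrier = insert None (Some ` carrier G), mult = M_mult G, one = Some \<one>\<^bsub>G\<^esub>,
          hadd = M_add G, hneg = map_option (sminus G), hzero = None\<rparr>"

definition M_map :: "'a special_group \<Rightarrow> ('a \<Rightarrow> 'b) \<Rightarrow> 'a option \<Rightarrow> 'b option" where
  "M_map G f = restrict (map_option f) (carrier (M G))"

definition SMF :: "('a option multiring, 'a option \<Rightarrow> 'a option) category" where
  "SMF = \<lparr>Obj = {F. hyperfield F \<and> (\<exists>G. special_group G \<and> F = M G)}, Hom = hyperfield_hom,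
          Idn = (\<lambda>F. restrict id (carrier F)),
          Cmp = (\<lambda>E F K g f. compose (carrier E) g f)\<rparr>"

definition M_functor ::
  "('a special_group, 'a \<Rightarrow> 'a, 'a option multiring, 'a option \<Rightarrow> 'a option) cat_functor" where
  "M_functor = \<lparr>fobj = M, fmor = (\<lambda>G H f. M_map G f)\<rparr>"


section \<open>Inductive graded rings\<close>

text \<open>The operation of the group \<open>gcomp R n\<close> is the addition of the \<open>n\<close>-th component, so its
  \<open>\<one>\<close> is the zero element of that component; \<open>gunit R\<close> is the multiplicative unit of the graded
  ring, which lies in degree 0.\<close>

record 'a igr =
  gcomp :: "nat \<Rightarrow> 'a monoid"
  gtop :: "nat \<Rightarrow> 'a"
  gunit :: 'a
  gprod :: "nat \<Rightarrow> nat \<Rightarrow> 'a \<Rightarrow> 'a \<Rightarrow> 'a"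

abbreviation gcar :: "'a igr \<Rightarrow> nat \<Rightarrow> 'a set" where
  "gcar R n \<equiv> carrier (gcomp R n)"

definition gh :: "'a igr \<Rightarrow> nat \<Rightarrow> 'a \<Rightarrow> 'a" where
  "gh R n x = gprod R 1 n (gtop R 1) x"

text \<open>\<open>gh_iter R n k\<close> is the \<open>k\<close>-fold iterate \<open>R_n \<rightarrow> R_(n + k)\<close>; thus \<open>h_n^p\<close> is
  \<open>gh_iter R n (p - n)\<close>.\<close>

fun gh_iter :: "'a igr \<Rightarrow> nat \<Rightarrow> nat \<Rightarrow> 'a \<Rightarrow> 'a" where
  "gh_iter R n 0 x = x"
| "gh_iter R n (Suc k) x = gh R (n + k) (gh_iter R n k x)"

text \<open>The conditions that the direct sum of the \<open>R_n\<close> be a commutative graded ring are stated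
  on homogeneous elements.\<close>

definition commutative_graded_ring :: "'a igr \<Rightarrow> bool" where
  "commutative_graded_ring R \<longleftrightarrow>
     (\<forall>n. comm_group (gcomp R n)) \<and>
     (\<forall>n m. \<forall>x\<in>gcar R n. \<forall>y\<in>gcar R m. gprod R n m x y \<in> gcar R (n + m)) \<and>
     (\<forall>n m. \<forall>x\<in>gcar R n. \<forall>x'\<in>gcar R n. \<forall>y\<in>gcar R m.
        gprod R n m (x \<otimes>\<^bsub>gcomp R n\<^esub> x') y = gprod R n m x y \<otimes>\<^bsub>gcomp R (n + m)\<^esub> gprod R n m x' y) \<and>
     (\<forall>n m. \<forall>x\<in>gcar R n. \<forall>y\<in>gcar R m. \<forall>y'\<in>gcar R m.
        gprod R n m x (y \<otimes>\<^bsub>gcomp R m\<^esub> y') = gprod R n m x y \<otimes>\<^bsub>gcomp R (n + m)\<^esub> gprod R n m x y') \<and>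
     (\<forall>n m k. \<forall>x\<in>gcar R n. \<forall>y\<in>gcar R m. \<forall>z\<in>gcar R k.
        gprod R (n + m) k (gprod R n m x y) z = gprod R n (m + k) x (gprod R m k y z)) \<and>
     (\<forall>n m. \<forall>x\<in>gcar R n. \<forall>y\<in>gcar R m. gprod R n m x y = gprod R m n y x) \<and>
     gunit R \<in> gcar R 0 \<and>
     (\<forall>n. \<forall>x\<in>gcar R n. gprod R 0 n (gunit R) x = x \<and> gprod R n 0 x (gunit R) = x)"

definition inductive_graded_ring :: "'a igr \<Rightarrow> bool" where
  "inductive_graded_ring R \<longleftrightarrow>
     commutative_graded_ring R \<and>
     (\<forall>n. \<forall>x\<in>gcar R n. x \<otimes>\<^bsub>gcomp R n\<^esub> x = \<one>\<^bsub>gcomp R n\<^esub>) \<and>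
     (\<forall>n. gtop R n \<in> gcar R n) \<and>
     (\<exists>\<phi> :: 'a \<Rightarrow> bit. bij_betw \<phi> (gcar R 0) UNIV \<and> \<phi> (gunit R) = 1 \<and>
        (\<forall>x\<in>gcar R 0. \<forall>y\<in>gcar R 0.
           \<phi> (x \<otimes>\<^bsub>gcomp R 0\<^esub> y) = \<phi> x + \<phi> y \<and> \<phi> (gprod R 0 0 x y) = \<phi> x * \<phi> y)) \<and>
     (\<forall>n. gh R n \<in> hom (gcomp R n) (gcomp R (Suc n))) \<and>
     (\<forall>n. gh R n (gtop R n) = gtop R (Suc n)) \<and>
     (\<forall>n m p q. n \<le> p \<longrightarrow> m \<le> q \<longrightarrow> (\<forall>x\<in>gcar R n. \<forall>y\<in>gcar R m.
        gprod R p q (gh_iter R n (p - n) x) (gh_iter R m (q - m) y) =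
        gh_iter R (n + m) ((p + q) - (n + m)) (gprod R n m x y)))"

definition igr_hom :: "'a igr \<Rightarrow> 'b igr \<Rightarrow> (nat \<Rightarrow> 'a \<Rightarrow> 'b) set" where
  "igr_hom R S = {f.
     (\<forall>n. f n \<in> hom (gcomp R n) (gcomp S n) \<inter> extensional (gcar R n)) \<and>
     (\<forall>n m. \<forall>x\<in>gcar R n. \<forall>y\<in>gcar R m.
        f (n + m) (gprod R n m x y) = gprod S n m (f n x) (f m y)) \<and>
     f 0 (gunit R) = gunit S \<and>
     (\<forall>n. f n (gtop R n) = gtop S n)}"

definition igr_id :: "'a igr \<Rightarrow> nat \<Rightarrow> 'a \<Rightarrow> 'a" where
  "igr_id R = (\<lambda>n. restrict id (gcar R n))"

definition igr_comp :: "'a igr \<Rightarrow> (nat \<Rightarrow> 'b \<Rightarrow> 'c) \<Rightarrow> (nat \<Rightarrow> 'a \<Rightarrow> 'b) \<Rightarrow> nat \<Rightarrow> 'a \<Rightarrow> 'c" where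
  "igr_comp R g f = (\<lambda>n. compose (gcar R n) (g n) (f n))"

definition Igr :: "('a igr, nat \<Rightarrow> 'a \<Rightarrow> 'a) category" where
  "Igr = \<lparr>Obj = {R. inductive_graded_ring R}, Hom = igr_hom, Idn = igr_id,
          Cmp = (\<lambda>R S T g f. igr_comp R g f)\<rparr>"

text \<open>Stated separately from \<^const>\<open>is_iso\<close> because the two rings may live over different types.\<close>

definition igr_isomorphic :: "'a igr \<Rightarrow> 'b igr \<Rightarrow> bool" where
  "igr_isomorphic R S \<longleftrightarrow> inductive_graded_ring R \<and> inductive_graded_ring S \<and>
     (\<exists>f\<in>igr_hom R S. \<exists>g\<in>igr_hom S R. igr_comp R g f = igr_id R \<and> igr_comp S f g = igr_id S)"


section \<open>Tensor algebras\<close>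

text \<open>The free associative algebra on \<open>X\<close>: finitely supported functions on words over \<open>X\<close>, with
  concatenation product.\<close>

definition free_algebra :: "'a set \<Rightarrow> ('a list \<Rightarrow> 'r::comm_ring_1) ring" where
  "free_algebra X =
     \<lparr>carrier = {f. finite {w. f w \<noteq> 0} \<and> {w. f w \<noteq> 0} \<subseteq> lists X},
      mult = (\<lambda>f g w. \<Sum>k\<le>length w. f (take k w) * g (drop k w)),
      one = (\<lambda>w. if w = [] then 1 else 0),
      zero = (\<lambda>w. 0),
      add = (\<lambda>f g w. f w + g w)\<rparr>"

definition word :: "'a list \<Rightarrow> 'a list \<Rightarrow> 'r::comm_ring_1" where
  "word v = (\<lambda>w. if w = v then 1 else 0)"

text \<open>The tensor algebra of a module \<open>M\<close> over the ring \<open>'r\<close>. The words of length \<open>n\<close> span the free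
  module on the \<open>n\<close>-tuples of elements of \<open>M\<close>, and the degree \<open>n\<close> part of the ideal below is spanned
  by the relations making the class of a word \<open>[x1, ..., xn]\<close> linear in each entry; so the degree
  \<open>n\<close> part of the quotient is the \<open>n\<close>-th tensor power of \<open>M\<close>.\<close>

definition linearity_relations :: "('r::comm_ring_1, 'a) module \<Rightarrow> ('a list \<Rightarrow> 'r) set" where
  "linearity_relations V =
     {(\<lambda>w. word [x \<oplus>\<^bsub>V\<^esub> y] w - (word [x] w + word [y] w)) | x y. x \<in> carrier V \<and> y \<in> carrier V} \<union>
     {(\<lambda>w. word [c \<odot>\<^bsub>V\<^esub> x] w - c * word [x] w) | c x. x \<in> carrier V}"

definition tensor_ideal :: "('r::comm_ring_1, 'a) module \<Rightarrow> ('a list \<Rightarrow> 'r) set" where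
  "tensor_ideal V = Idl\<^bsub>free_algebra (carrier V)\<^esub> (linearity_relations V)"

definition tensor_algebra :: "('r::comm_ring_1, 'a) module \<Rightarrow> ('a list \<Rightarrow> 'r) set ring" where
  "tensor_algebra V = free_algebra (carrier V) Quot tensor_ideal V"

definition tensor_class ::
  "('r::comm_ring_1, 'a) module \<Rightarrow> ('a list \<Rightarrow> 'r) \<Rightarrow> ('a list \<Rightarrow> 'r) set" where
  "tensor_class V f = tensor_ideal V +>\<^bsub>free_algebra (carrier V)\<^esub> f"

definition tensor_degree :: "('r::comm_ring_1, 'a) module \<Rightarrow> nat \<Rightarrow> ('a list \<Rightarrow> 'r) set set" where
  "tensor_degree V n =
     tensor_class V ` {f \<in> carrier (free_algebra (carrier V)). \<forall>w. f w \<noteq> 0 \<longrightarrow> length w = n}"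

text \<open>The quotient of the tensor algebra of \<open>V\<close> by the ideal generated by a set \<open>S\<close>, with its
  degree \<open>n\<close> part and the class of \<open>x \<in> V\<close> in degree 1.\<close>

definition tq_ideal ::
  "('r::comm_ring_1, 'a) module \<Rightarrow> ('a list \<Rightarrow> 'r) set set \<Rightarrow> ('a list \<Rightarrow> 'r) set set" where
  "tq_ideal V S = Idl\<^bsub>tensor_algebra V\<^esub> S"

definition tq_ring ::
  "('r::comm_ring_1, 'a) module \<Rightarrow> ('a list \<Rightarrow> 'r) set set \<Rightarrow> ('a list \<Rightarrow> 'r) set set ring" where
  "tq_ring V S = tensor_algebra V Quot tq_ideal V S"

definition tq_class ::
  "('r::comm_ring_1, 'a) module \<Rightarrow> ('a list \<Rightarrow> 'r) set set \<Rightarrow>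
     ('a list \<Rightarrow> 'r) set \<Rightarrow> ('a list \<Rightarrow> 'r) set set" where
  "tq_class V S t = tq_ideal V S +>\<^bsub>tensor_algebra V\<^esub> t"

definition tq_comp ::
  "('r::comm_ring_1, 'a) module \<Rightarrow> ('a list \<Rightarrow> 'r) set set \<Rightarrow> nat \<Rightarrow>
     ('a list \<Rightarrow> 'r) set set monoid" where
  "tq_comp V S n =
     \<lparr>carrier = tq_class V S ` tensor_degree V n, mult = add (tq_ring V S), one = \<zero>\<^bsub>tq_ring V S\<^esub>\<rparr>"

definition tq_gen ::
  "('r::comm_ring_1, 'a) module \<Rightarrow> ('a list \<Rightarrow> 'r) set set \<Rightarrow> 'a \<Rightarrow> ('a list \<Rightarrow> 'r) set set" where
  "tq_gen V S x = tq_class V S (tensor_class V (word [x]))"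

text \<open>A multiplicatively written group as an additive module; the fields \<open>mult\<close> and \<open>one\<close> of the
  record type are not part of the module structure.\<close>

definition additive_module :: "('r \<Rightarrow> 'a \<Rightarrow> 'a) \<Rightarrow> ('a, 'b) monoid_scheme \<Rightarrow> ('r, 'a) module" where
  "additive_module s A = \<lparr>carrier = carrier A, mult = undefined, one = undefined,
     zero = \<one>\<^bsub>A\<^esub>, add = mult A, smult = s\<rparr>"


section \<open>The K-theory of a special group\<close>

definition k1 :: "'a special_group \<Rightarrow> (bit, 'a) module" where
  "k1 G = additive_module (\<lambda>c a. if c = 0 then \<one>\<^bsub>G\<^esub> else a) G"

definition kdm_relations :: "'a special_group \<Rightarrow> ('a list \<Rightarrow> bit) set set" where
  "kdm_relations G =
     {tensor_class (k1 G) (word [a]) \<otimes>\<^bsub>tensor_algebra (k1 G)\<^esub> tensor_class (k1 G) (word [a \<otimes>\<^bsub>G\<^esub> b])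
       | a b. a \<in> carrier G \<and> b \<in> carrier G \<and> a \<in> srep G \<one>\<^bsub>G\<^esub> b}"

definition kdm_ring :: "'a special_group \<Rightarrow> ('a list \<Rightarrow> bit) set set ring" where
  "kdm_ring G = tq_ring (k1 G) (kdm_relations G)"

definition lam :: "'a special_group \<Rightarrow> 'a \<Rightarrow> ('a list \<Rightarrow> bit) set set" where
  "lam G = tq_gen (k1 G) (kdm_relations G)"

definition kdm :: "'a special_group \<Rightarrow> ('a list \<Rightarrow> bit) set set igr" where
  "kdm G =
     \<lparr>gcomp = tq_comp (k1 G) (kdm_relations G),
      gtop = (\<lambda>n. lam G (sneg G) [^]\<^bsub>kdm_ring G\<^esub> n),
      gunit = \<one>\<^bsub>kdm_ring G\<^esub>,
      gprod = (\<lambda>n m x y. x \<otimes>\<^bsub>kdm_ring G\<^esub> y)\<rparr>"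


section \<open>The reduced K-theory of a hyperfield\<close>

definition K1 :: "'a multiring \<Rightarrow> (int, 'a) module" where
  "K1 F = additive_module (\<lambda>(k::int) a. a [^]\<^bsub>nonzero F\<^esub> k) (nonzero F)"

definition K_relations :: "'a multiring \<Rightarrow> ('a list \<Rightarrow> int) set set" where
  "K_relations F =
     {tensor_class (K1 F) (word [a]) \<otimes>\<^bsub>tensor_algebra (K1 F)\<^esub> tensor_class (K1 F) (word [b])
       | a b. a \<in> carrier F \<and> a \<noteq> hzero F \<and> a \<noteq> \<one>\<^bsub>F\<^esub> \<and> b \<in> hadd F \<one>\<^bsub>F\<^esub> (hneg F a)}"

definition K_ring :: "'a multiring \<Rightarrow> ('a list \<Rightarrow> int) set set ring" where
  "K_ring F = tq_ring (K1 F) (K_relations F)"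

definition K_comp :: "'a multiring \<Rightarrow> nat \<Rightarrow> ('a list \<Rightarrow> int) set set monoid" where
  "K_comp F = tq_comp (K1 F) (K_relations F)"

definition rho :: "'a multiring \<Rightarrow> 'a \<Rightarrow> ('a list \<Rightarrow> int) set set" where
  "rho F = tq_gen (K1 F) (K_relations F)"

definition twice_K :: "'a multiring \<Rightarrow> nat \<Rightarrow> ('a list \<Rightarrow> int) set set set" where
  "twice_K F n = (\<lambda>x. x \<otimes>\<^bsub>K_comp F n\<^esub> x) ` carrier (K_comp F n)"

definition kmult_class ::
  "'a multiring \<Rightarrow> nat \<Rightarrow> ('a list \<Rightarrow> int) set set \<Rightarrow> ('a list \<Rightarrow> int) set set set" where
  "kmult_class F n x = twice_K F n #>\<^bsub>K_comp F n\<^esub> x"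

text \<open>The product of two classes modulo 2 is the class of the product of any representatives
  (as in \<^const>\<open>rcoset_mult\<close>, written as a union of equal cosets).\<close>

definition kmult :: "'a multiring \<Rightarrow> ('a list \<Rightarrow> int) set set set igr" where
  "kmult F =
     \<lparr>gcomp = (\<lambda>n. K_comp F n Mod twice_K F n),
      gtop = (\<lambda>n. kmult_class F n (rho F (hneg F \<one>\<^bsub>F\<^esub>) [^]\<^bsub>K_ring F\<^esub> n)),
      gunit = kmult_class F 0 \<one>\<^bsub>K_ring F\<^esub>,
      gprod = (\<lambda>n m X Y. \<Union>x\<in>X. \<Union>y\<in>Y. kmult_class F (n + m) (x \<otimes>\<^bsub>K_ring F\<^esub> y))\<rparr>"

text \<open>\<open>rho_prod F [a1, ..., an]\<close> is the class of \<open>\<rho>(a1) \<cdots> \<rho>(an)\<close> modulo 2.\<close>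

definition rho_prod :: "'a multiring \<Rightarrow> 'a list \<Rightarrow> ('a list \<Rightarrow> int) set set set" where
  "rho_prod F as =
     kmult_class F (length as) (foldr (\<lambda>a x. rho F a \<otimes>\<^bsub>K_ring F\<^esub> x) as \<one>\<^bsub>K_ring F\<^esub>)"

text \<open>In each degree the homomorphism is determined by its values on the products
  \<open>\<rho>(a1) \<cdots> \<rho>(an)\<close>, which generate the group.\<close>

definition kmult_map ::
  "'a multiring \<Rightarrow> 'b multiring \<Rightarrow> ('a \<Rightarrow> 'b) \<Rightarrow> nat \<Rightarrow>
     ('a list \<Rightarrow> int) set set set \<Rightarrow> ('b list \<Rightarrow> int) set set set" where
  "kmult_map F F' \<phi> n =
     (THE g. g \<in> hom (gcomp (kmult F) n) (gcomp (kmult F') n) \<inter> extensional (gcar (kmult F) n) \<and>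
        (\<forall>as\<in>lists (carrier (nonzero F)). length as = n \<longrightarrow>
           g (rho_prod F as) = rho_prod F' (map \<phi> as)))"

end

theory Submission
  imports Defs
begin

text \<open>Both K-theories are spanned in degree \<open>n\<close> by words of length \<open>n\<close> over \<open>G\<close>, and both have the
  same kind of universal property: a morphism to an inductive graded ring \<open>S\<close> amounts to an additive
  map \<open>\<gamma> : G \<rightarrow> S\<^sub>1\<close> that sends \<open>-1\<close> to \<open>\<top>\<^sub>1\<close> and kills the quadratic relations. Functoriality and
  the isomorphism therefore come down to comparing relations in degree 2. Each K-theory has
  \<open>x \<cdot> (-x) = 0\<close> for all generators \<open>x\<close>, which makes generators anticommute, hence commute modulo 2.
  If \<open>b \<in> D(1, -a)\<close>, then \<open>\<lambda>(b)\<lambda>(-ab) = 0 = \<lambda>(b)\<lambda>(-b)\<close> gives \<open>\<lambda>(a)\<lambda>(b) = 0\<close>; conversely, if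
  \<open>a \<in> D(1, b)\<close>, then \<open>\<rho>(a)\<rho>(-b) = 0 = \<rho>(a)\<rho>(-a)\<close> gives \<open>\<rho>(a)\<rho>(ab) = 0\<close>.
  The functor \<open>M\<close> is full, faithful and injective on objects, so it is even an isomorphism onto
  \<open>SMF\<close>; that \<open>M(G)\<close> has an associative addition is the transitivity of \<open>\<equiv>\<close> on \<open>G\<^sup>3\<close>.\<close>

section \<open>Special groups and the functor M\<close>

text \<open>The obstacle is that both K-theories are iterated quotients: cosets of ideals generated
  in ungraded rings, cut into degrees afterwards, and for \<open>kmult\<close> divided by doubles
  once more, while a target in \<open>Igr\<close> is given only degree by degree. Everything is
  therefore pulled back to the free algebra on words. From an equality of classes one concludes that
  the difference of the representatives lies in every ideal of the free algebra that contains the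
  relations (\<open>cls_eq_imp_ideal\<close>). For the kernel of an extended map this gives the
  universal property; for the ideal of elements with vanishing constant term it shows that degree 0
  does not collapse below F_2. The coefficients \<open>bit\<close> and \<open>int\<close> are
  treated together through a ring homomorphism \<open>c\<close> to \<open>bit\<close>, and
  identification modulo doubles is built into the notion of presentation, so that the axioms of
  \<open>Igr\<close> are verified once. One asymmetry remains: the relations of \<open>kmult\<close>
  exclude \<open>a = 1\<close>, so whenever a generator may become 1 the product has to vanish by
  additivity instead.\<close>

locale special = fixes G :: "'a special_group" (structure)
  assumes special_G: "special_group G"
begin

lemma square [simp]: "a \<in> carrier G \<Longrightarrow> a \<otimes> a = \<one>"
  and sneg_closed [simp]: "sneg G \<in> carrier G"
  and equiv_seq: "equiv (carrier G \<times> carrier G) (seq G)"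
  and seq_swap: "a \<in> carrier G \<Longrightarrow> b \<in> carrier G \<Longrightarrow> ((a, b), (b, a)) \<in> seq G"
  and seq_hyperbolic: "a \<in> carrier G \<Longrightarrow> ((a, sminus G a), (\<one>, sneg G)) \<in> seq G"
  and seq_prod: "((a, b), (c, d)) \<in> seq G \<Longrightarrow> a \<otimes> b = c \<otimes> d"
  and seq_switch: "((a, b), (c, d)) \<in> seq G \<Longrightarrow> ((a, sminus G c), (sminus G b, d)) \<in> seq G"
  and seq_scale: "g \<in> carrier G \<Longrightarrow> ((a, b), (c, d)) \<in> seq G \<Longrightarrow>
      ((g \<otimes> a, g \<otimes> b), (g \<otimes> c, g \<otimes> d)) \<in> seq G"
  and trans_seq3: "trans (seq3 G)"
proof -
  note ax = special_G[unfolded special_group_def]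
  have ax1: "\<forall>a\<in>carrier G. a \<otimes> a = \<one>"
    and ax2: "\<forall>a\<in>carrier G. \<forall>b\<in>carrier G. ((a, b), (b, a)) \<in> seq G"
    and ax3: "\<forall>a\<in>carrier G. ((a, sminus G a), (\<one>, sneg G)) \<in> seq G"
    and ax4: "\<forall>a b c d. ((a, b), (c, d)) \<in> seq G \<longrightarrow> a \<otimes> b = c \<otimes> d"
    and ax5: "\<forall>a b c d. ((a, b), (c, d)) \<in> seq G \<longrightarrow> ((a, sminus G c), (sminus G b, d)) \<in> seq G"
    and ax6: "\<forall>a b c d. \<forall>g\<in>carrier G. ((a, b), (c, d)) \<in> seq G \<longrightarrow>
        ((g \<otimes> a, g \<otimes> b), (g \<otimes> c, g \<otimes> d)) \<in> seq G"
    by (insert ax, elim conjE, assumption)+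
  show "sneg G \<in> carrier G" "equiv (carrier G \<times> carrier G) (seq G)" "trans (seq3 G)"
    by (insert ax, elim conjE, assumption)+
  show "a \<in> carrier G \<Longrightarrow> a \<otimes> a = \<one>"
    using ax1 by blast
  show "a \<in> carrier G \<Longrightarrow> b \<in> carrier G \<Longrightarrow> ((a, b), (b, a)) \<in> seq G"
    using ax2 by blast
  show "a \<in> carrier G \<Longrightarrow> ((a, sminus G a), (\<one>, sneg G)) \<in> seq G"
    using ax3 by blast
  show "((a, b), (c, d)) \<in> seq G \<Longrightarrow> a \<otimes> b = c \<otimes> d"
    using ax4 by blast
  show "((a, b), (c, d)) \<in> seq G \<Longrightarrow> ((a, sminus G c), (sminus G b, d)) \<in> seq G"
    using ax5 by blast
  show "g \<in> carrier G \<Longrightarrow> ((a, b), (c, d)) \<in> seq G \<Longrightarrow>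
      ((g \<otimes> a, g \<otimes> b), (g \<otimes> c, g \<otimes> d)) \<in> seq G"
    using ax6 by blast
qed

text \<open>Exponent 2 makes every element its own inverse, so the rule for the inverse of a product
  becomes commutativity.\<close>

sublocale comm_group G
proof -
  interpret group G using special_G unfolding special_group_def by (elim conjE)
  have i: "inv x = x" if "x \<in> carrier G" for x
    using inv_equality[OF square[OF that] that that] .
  have "x \<otimes> y = y \<otimes> x" if "x \<in> carrier G" "y \<in> carrier G" for x y
    using inv_mult_group[OF that] i[OF that(1)] i[OF that(2)] i[OF m_closed[OF that]] by simp
  then show "comm_group G" by (rule group_comm_groupI)
qed

lemma sminus_closed [simp]: "a \<in> carrier G \<Longrightarrow> sminus G a \<in> carrier G"
  by (simp add: sminus_def)

lemma mult_cancel [simp]: "a \<in> carrier G \<Longrightarrow> b \<in> carrier G \<Longrightarrow> a \<otimes> (a \<otimes> b) = b"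
  by (simp flip: m_assoc)

lemma sminus_sminus [simp]: "a \<in> carrier G \<Longrightarrow> sminus G (sminus G a) = a"
  by (simp add: sminus_def)

lemma sminus_mult: "a \<in> carrier G \<Longrightarrow> b \<in> carrier G \<Longrightarrow> sminus G a \<otimes> b = sminus G (a \<otimes> b)"
  by (simp add: sminus_def m_assoc)

lemma mult_sminus: "a \<in> carrier G \<Longrightarrow> b \<in> carrier G \<Longrightarrow> a \<otimes> sminus G b = sminus G (a \<otimes> b)"
  by (simp add: sminus_def m_lcomm)

section \<open>Isometry of binary forms and represented elements\<close>

lemma seq_closed:
  assumes "((a, b), (c, d)) \<in> seq G"
  shows "a \<in> carrier G" "b \<in> carrier G" "c \<in> carrier G" "d \<in> carrier G"
  using equiv_type[OF equiv_seq] assms by auto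

lemma seq_refl [simp]: "a \<in> carrier G \<Longrightarrow> b \<in> carrier G \<Longrightarrow> ((a, b), (a, b)) \<in> seq G"
  using equiv_seq by (auto simp: equiv_def refl_on_def)

lemma seq_sym: "(p, q) \<in> seq G \<Longrightarrow> (q, p) \<in> seq G"
  using equiv_seq by (auto simp: equiv_def sym_def)

lemma seq_trans: "(p, q) \<in> seq G \<Longrightarrow> (q, r) \<in> seq G \<Longrightarrow> (p, r) \<in> seq G"
  using equiv_seq by (meson equiv_def transD)

lemma srepI: "((c, d), (a, b)) \<in> seq G \<Longrightarrow> c \<in> srep G a b"
  using seq_closed by (auto simp: srep_def)

text \<open>Isometric forms have equal products, and in exponent 2 this determines the second entry
  from \<open>c\<close>; the existential in \<open>srep\<close> can thus be replaced by an explicit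
  element.\<close>

lemma srepD:
  assumes "c \<in> srep G a b" "a \<in> carrier G" "b \<in> carrier G"
  shows "c \<in> carrier G" "((c, c \<otimes> (a \<otimes> b)), (a, b)) \<in> seq G"
proof -
  from assms obtain d where d: "c \<in> carrier G" "d \<in> carrier G" "((c, d), (a, b)) \<in> seq G"
    by (auto simp: srep_def)
  then have "c \<otimes> d = a \<otimes> b" by (blast dest: seq_prod)
  then have "d = c \<otimes> (a \<otimes> b)" using d mult_cancel by metis
  then show "c \<in> carrier G" "((c, c \<otimes> (a \<otimes> b)), (a, b)) \<in> seq G" using d by auto
qed

lemma srep_commute: "a \<in> carrier G \<Longrightarrow> b \<in> carrier G \<Longrightarrow> srep G a b = srep G b a"
  by (auto intro: srepI seq_trans[OF _ seq_swap] dest: srepD(2))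

lemma srep_left: "a \<in> carrier G \<Longrightarrow> b \<in> carrier G \<Longrightarrow> a \<in> srep G a b"
  by (rule srepI[OF seq_refl])

lemma srep_right: "a \<in> carrier G \<Longrightarrow> b \<in> carrier G \<Longrightarrow> b \<in> srep G a b"
  by (rule srepI, rule seq_swap)

lemma srep_hyperbolic: "a \<in> carrier G \<Longrightarrow> srep G a (sminus G a) = carrier G"
  using seq_trans[OF seq_hyperbolic seq_sym[OF seq_hyperbolic]] sminus_closed
  unfolding srep_def by blast

lemma srep_scale:
  assumes "c \<in> srep G a b" "a \<in> carrier G" "b \<in> carrier G" "g \<in> carrier G"
  shows "g \<otimes> c \<in> srep G (g \<otimes> a) (g \<otimes> b)"
  using srepI[OF seq_scale[OF assms(4) srepD(2)[OF assms(1-3)]]] .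

text \<open>The switch axiom, applied to
  \<open>\<langle>c, c a b\<rangle> \<equiv> \<langle>b, a\<rangle>\<close>, gives
  \<open>\<langle>c, -b\<rangle> \<equiv> \<langle>-(c a b), a\<rangle>\<close>. In
  \<open>M G\<close> this becomes reversibility of the addition.\<close>

lemma srep_reverse:
  assumes "c \<in> srep G a b" "a \<in> carrier G" "b \<in> carrier G"
  shows "a \<in> srep G c (sminus G b)"
proof -
  have "((b, a), (c, c \<otimes> (a \<otimes> b))) \<in> seq G"
    using assms srepD by (meson seq_swap seq_sym seq_trans)
  from seq_sym[OF seq_switch[OF seq_sym[OF this]]]
  have "((sminus G (c \<otimes> (a \<otimes> b)), a), (c, sminus G b)) \<in> seq G" .
  then show ?thesis using assms srepD(1)[OF assms]
    by (intro srepI[OF seq_trans[OF seq_swap]]) auto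
qed

text \<open>Product and represented elements together recover isometry. Since \<open>M G\<close>
  records exactly these two, this is what allows going back from \<open>M G\<close> to
  \<open>G\<close>, for objects and for morphisms.\<close>

lemma seq_iff:
  assumes "a \<in> carrier G" "b \<in> carrier G" "c \<in> carrier G" "d \<in> carrier G"
  shows "((a, b), (c, d)) \<in> seq G \<longleftrightarrow> a \<otimes> b = c \<otimes> d \<and> a \<in> srep G c d"
proof
  assume "a \<otimes> b = c \<otimes> d \<and> a \<in> srep G c d"
  then have "((a, a \<otimes> (a \<otimes> b)), (c, d)) \<in> seq G" using srepD(2) assms by metis
  then show "((a, b), (c, d)) \<in> seq G" using assms by simp
qed (auto dest: seq_prod srepI)

lemma seq3I:
  assumes "((a1, x), (b1, y)) \<in> seq G" "((a2, a3), (x, z)) \<in> seq G" "((b2, b3), (y, z)) \<in> seq G"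
  shows "((a1, a2, a3), (b1, b2, b3)) \<in> seq3 G"
proof -
  have "{a1, a2, a3, b1, b2, b3} \<subseteq> carrier G" "x \<in> carrier G" "y \<in> carrier G" "z \<in> carrier G"
    using assms[THEN seq_closed(1)] assms[THEN seq_closed(2)]
      assms[THEN seq_closed(3)] assms[THEN seq_closed(4)] by auto
  with assms show ?thesis unfolding seq3_def by blast
qed

text \<open>The form \<open>(x, y, z)\<close> is isometric to \<open>(w, u', w')\<close>; unfolding this isometry gives \<open>v\<close>.\<close>

lemma srep_assoc:
  assumes "u \<in> srep G x y" "w \<in> srep G u z" "x \<in> carrier G" "y \<in> carrier G" "z \<in> carrier G"
  obtains v where "v \<in> srep G y z" "w \<in> srep G x v"
proof -
  note trans3 = transD[OF trans_seq3]
  define u' w' where "u' = u \<otimes> (x \<otimes> y)" and "w' = w \<otimes> (u \<otimes> z)"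
  have u: "u \<in> carrier G" "((u, u'), (x, y)) \<in> seq G" using srepD assms u'_def by auto
  have w: "w \<in> carrier G" "((w, w'), (u, z)) \<in> seq G" using srepD assms u w'_def by auto
  have c: "u' \<in> carrier G" "w' \<in> carrier G" using seq_closed u w by auto
  have swap12: "((a, b, c), (b, a, c)) \<in> seq3 G" and swap23: "((a, b, c), (a, c, b)) \<in> seq3 G"
    if "a \<in> carrier G" "b \<in> carrier G" "c \<in> carrier G" for a b c
    by (rule seq3I[where x = b and y = a and z = c] seq3I[where x = b and y = b and z = c];
        simp add: that seq_swap)+
  \<comment> \<open>With the first entry fixed, the last two may be replaced by an isometric pair.
    Transpositions therefore bring \<open>x, y\<close> to the end, where they become
    \<open>u, u'\<close>, and then \<open>z, u\<close>, which become \<open>w, w'\<close>.\<close>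
  have "((x, y, z), (x, z, y)) \<in> seq3 G" by (simp add: assms swap23)
  also have "((x, z, y), (z, x, y)) \<in> seq3 G" by (simp add: assms swap12)
  also (trans3) have "((z, x, y), (z, u, u')) \<in> seq3 G"
    by (rule seq3I[where x = u and y = u and z = u']) (use assms u c seq_sym in auto)
  also (trans3) have "((z, u, u'), (z, u', u)) \<in> seq3 G" by (simp add: assms u c swap23)
  also (trans3) have "((z, u', u), (u', z, u)) \<in> seq3 G" by (simp add: assms u c swap12)
  also (trans3) have "((u', z, u), (u', w, w')) \<in> seq3 G"
    by (rule seq3I[where x = z and y = z and z = u])
      (use assms u c w in \<open>auto intro: seq_trans[OF _ seq_swap]\<close>)
  also (trans3) have "((u', w, w'), (w, u', w')) \<in> seq3 G" by (simp add: w c swap12)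
  finally (trans3) have "((x, y, z), (w, u', w')) \<in> seq3 G" .
  then obtain p q r where "((x, p), (w, q)) \<in> seq G" "((y, z), (p, r)) \<in> seq G"
    unfolding seq3_def by blast
  then show ?thesis by (intro that[of p] srepI; blast intro: seq_sym)
qed

section \<open>The hyperaddition of \<open>M G\<close>\<close>

lemma M_simps [simp]: "carrier (M G) = insert None (Some ` carrier G)"
  "mult (M G) = M_mult G" "one (M G) = Some \<one>" "hadd (M G) = M_add G"
  "hneg (M G) = map_option (sminus G)" "hzero (M G) = None"
  by (simp_all add: M_def)

text \<open>The two clauses of \<open>M_add\<close> for non-zero summands agree on non-zero values,
  because a pair \<open>\<langle>a, -a\<rangle>\<close> represents all of \<open>G\<close>. Only
  membership of zero still needs a distinction.\<close>

lemma M_add_Some: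
  assumes "a \<in> carrier G" "b \<in> carrier G"
  shows "Some c \<in> M_add G (Some a) (Some b) \<longleftrightarrow> c \<in> srep G a b"
  using assms srep_hyperbolic by auto

lemma M_add_zero [simp]: "M_add G x None = {x}"
  by (cases x) auto

lemma M_add_commute:
  assumes "x \<in> carrier (M G)" "y \<in> carrier (M G)"
  shows "M_add G x y = M_add G y x"
proof (cases "x = None \<or> y = None")
  case False
  then obtain a b where "x = Some a" "y = Some b" "a \<in> carrier G" "b \<in> carrier G" using assms by auto
  then show ?thesis using srep_commute[of a b] sminus_sminus by auto
qed auto

lemma M_add_reverse:
  assumes "x \<in> carrier (M G)" "y \<in> carrier (M G)" "z \<in> M_add G x y"
  shows "x \<in> M_add G z (map_option (sminus G) y)"
proof (cases "x = None \<or> y = None")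
  case True then show ?thesis using assms by auto
next
  case False
  then obtain a b where ab: "x = Some a" "y = Some b" "a \<in> carrier G" "b \<in> carrier G"
    using assms by auto
  show ?thesis
  proof (cases z)
    case None then show ?thesis using ab assms(3) by (auto split: if_splits)
  next
    case (Some c)
    then have "c \<in> srep G a b" using assms(3) ab M_add_Some by blast
    then have "a \<in> srep G c (sminus G b)" "c \<in> carrier G" using ab srep_reverse srepD(1) by auto
    then show ?thesis using Some ab by (simp add: M_add_Some del: M_add.simps)
  qed
qed

lemma M_add_closed:
  assumes "x \<in> carrier (M G)" "y \<in> carrier (M G)"
  shows "M_add G x y \<subseteq> carrier (M G)" "M_add G x y \<noteq> {}"
proof -
  have "srep G a b \<noteq> {}" if "a \<in> carrier G" "b \<in> carrier G" for a b
    using srep_left[OF that] by blast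
  then show "M_add G x y \<subseteq> carrier (M G)" "M_add G x y \<noteq> {}"
    using assms by (auto simp: srepD split: if_splits)
qed

text \<open>Zero can occur as the intermediate value \<open>u\<close> or as the final value
  \<open>w\<close>; both cases are settled by reversibility. Transitivity of isometry on triples,
  through \<open>srep_assoc\<close>, is used when both are non-zero.\<close>

lemma M_add_assoc_subset:
  assumes c: "x \<in> carrier (M G)" "y \<in> carrier (M G)" "z \<in> carrier (M G)"
    and u: "u \<in> M_add G x y" and w: "w \<in> M_add G u z"
  shows "\<exists>v\<in>M_add G y z. w \<in> M_add G x v"
proof (cases "x = None \<or> y = None \<or> z = None")
  case True then show ?thesis using u w by auto
next
  case False
  then obtain a b d where abd: "x = Some a" "y = Some b" "z = Some d"
    "a \<in> carrier G" "b \<in> carrier G" "d \<in> carrier G" using c by auto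
  have uc: "u \<in> carrier (M G)" using u c M_add_closed by blast
  consider "u = None" | "w = None" "u \<noteq> None" | e f where "u = Some e" "w = Some f" by fastforce
  then show ?thesis
  proof cases
    case 1
    then have e: "w = z" "y = map_option (sminus G) x" using u w abd by (auto split: if_splits)
    \<comment> \<open>Any \<open>v\<close> in \<open>z + y\<close> will do: here
      \<open>y = -x\<close> and \<open>w = z\<close>, and reversibility gives
      \<open>z \<in> v + x\<close>.\<close>
    obtain v where v: "v \<in> M_add G z y" "v \<in> carrier (M G)"
      using M_add_closed[OF c(3,2)] by auto
    from M_add_reverse[OF c(3,2) v(1)] have "z \<in> M_add G v x"
      using e abd by (simp del: M_add.simps)
    then show ?thesis using v e M_add_commute c by blast
  next
    case 2
    then obtain e where e: "u = Some e" "e \<in> carrier G" "d = sminus G e"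
      using w abd uc by (auto split: if_splits)
    \<comment> \<open>As \<open>w\<close> is zero, \<open>z = -u\<close> and the witness has to be
      \<open>-x\<close>. Reversing \<open>u \<in> y + x\<close> and scaling by \<open>-1\<close>
      yields \<open>-x \<in> y - u\<close>.\<close>
    have "u \<in> M_add G y x" using u M_add_commute c by blast
    from M_add_reverse[OF c(2,1) this] have "b \<in> srep G e (sminus G a)"
      using abd e by (simp add: M_add_Some del: M_add.simps)
    then have "e \<in> srep G b a" using srep_reverse[of b e "sminus G a"] abd e by simp
    then have "a \<in> srep G e (sminus G b)"
      using srep_reverse srep_commute abd by blast
    then have "sminus G a \<in> srep G (sminus G e) b"
      using srep_scale[of a e "sminus G b" "sneg G"] abd e by (simp flip: sminus_def)
    then have "sminus G a \<in> srep G b d" using e srep_commute abd by simp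
    then have "Some (sminus G a) \<in> M_add G y z" using abd by (simp add: M_add_Some del: M_add.simps)
    moreover have "w \<in> M_add G x (Some (sminus G a))" using 2 abd by simp
    ultimately show ?thesis by blast
  next
    case 3
    have ec: "e \<in> carrier G" using uc 3 by auto
    have "e \<in> srep G a b" "f \<in> srep G e d"
      using u w 3 abd ec M_add_Some by blast+
    then obtain v where v: "v \<in> srep G b d" "f \<in> srep G a v" using srep_assoc abd by blast
    then have "v \<in> carrier G" using srepD abd by blast
    then have "Some v \<in> M_add G y z" "w \<in> M_add G x (Some v)"
      using v 3 abd M_add_Some by blast+
    then show ?thesis by blast
  qed
qed

text \<open>By commutativity the reverse inclusion is \<open>M_add_assoc_subset\<close> for the
  triple \<open>z, y, x\<close>.\<close>

lemma M_add_assoc: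
  assumes c: "x \<in> carrier (M G)" "y \<in> carrier (M G)" "z \<in> carrier (M G)"
  shows "(\<Union>u\<in>M_add G x y. M_add G u z) = (\<Union>v\<in>M_add G y z. M_add G x v)"
proof -
  have "\<exists>u\<in>M_add G x y. w \<in> M_add G u z" if "v \<in> M_add G y z" "w \<in> M_add G x v" for v w
  proof -
    have "v \<in> carrier (M G)" using that M_add_closed c by blast
    then have "v \<in> M_add G z y" "w \<in> M_add G v x" using that M_add_commute c by blast+
    from M_add_assoc_subset[OF c(3,2,1) this] obtain u where
      u: "u \<in> M_add G y x" "w \<in> M_add G z u" by blast
    then have "u \<in> carrier (M G)" using M_add_closed c by blast
    then show ?thesis using u M_add_commute c by blast
  qed
  then show ?thesis using M_add_assoc_subset[OF c] by blast
qed

lemma M_add_distrib: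
  assumes "x \<in> carrier (M G)" "y \<in> carrier (M G)" "z \<in> carrier (M G)" "w \<in> M_add G x y"
  shows "M_mult G w z \<in> M_add G (M_mult G x z) (M_mult G y z)"
proof (cases "x = None \<or> y = None \<or> z = None")
  case True
  then show ?thesis using assms by (cases w; auto)
next
  case False
  then obtain a b d where abd: "x = Some a" "y = Some b" "z = Some d"
    "a \<in> carrier G" "b \<in> carrier G" "d \<in> carrier G" using assms by auto
  show ?thesis
  proof (cases w)
    case None then show ?thesis using assms(4) abd by (auto simp: sminus_mult split: if_splits)
  next
    case (Some c)
    then have c: "c \<in> srep G a b" using assms(4) abd M_add_Some by blast
    then have "c \<otimes> d \<in> srep G (a \<otimes> d) (b \<otimes> d)"
      using srep_scale[of c a b d] abd srepD(1)[of c a b] by (simp add: m_comm)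
    then show ?thesis using Some abd by (simp add: M_add_Some del: M_add.simps)
  qed
qed

lemma comm_monoid_M: "comm_monoid (M G)"
  by unfold_locales (auto simp: m_assoc intro: m_comm)

lemma hyperfield_M: "hyperfield (M G)"
proof -
  interpret MG: comm_monoid "M G" by (rule comm_monoid_M)
  have "commutative_multigroup (M G)"
    unfolding commutative_multigroup_def
  proof (intro conjI ballI)
    fix x y z assume c: "x \<in> carrier (M G)" "y \<in> carrier (M G)" and z: "z \<in> hadd (M G) x y"
    then have zc: "z \<in> carrier (M G)" using M_add_closed[OF c] by auto
    show "x \<in> hadd (M G) z (hneg (M G) y)" using M_add_reverse c z by simp
    have "z \<in> M_add G y x" using z M_add_commute c by simp
    then have "y \<in> M_add G z (map_option (sminus G) x)" using M_add_reverse c by simp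
    then show "y \<in> hadd (M G) (hneg (M G) x) z"
      using M_add_commute[of z "map_option (sminus G) x"] zc c by auto
  next
    fix x y assume "x \<in> carrier (M G)" "y \<in> carrier (M G)"
    from M_add_closed[OF this] M_add_commute[OF this]
    show "hadd (M G) x y \<subseteq> carrier (M G)" "hadd (M G) x y \<noteq> {}" "hadd (M G) x y = hadd (M G) y x"
      by auto
  next
    fix x y z assume "x \<in> carrier (M G)" "y \<in> carrier (M G)" "z \<in> carrier (M G)"
    from M_add_assoc[OF this]
    show "(\<Union>u\<in>hadd (M G) x y. hadd (M G) u z) = (\<Union>v\<in>hadd (M G) y z. hadd (M G) x v)" by simp
  qed auto
  moreover have "Some a \<in> Units (M G)" if "a \<in> carrier G" for a
    unfolding Units_def using that by (auto intro!: bexI[of _ a])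
  then have "carrier (M G) - {hzero (M G)} \<subseteq> Units (M G)" by auto
  moreover have "a \<otimes>\<^bsub>M G\<^esub> hzero (M G) = hzero (M G)" for a by (cases a) auto
  ultimately show ?thesis unfolding hyperfield_def multiring_def
    using comm_monoid_M M_add_distrib by (simp add: image_subset_iff del: M_simps(1))
qed

lemma M_add_seq:
  assumes "((a, b), (c, d)) \<in> seq G"
  shows "Some a \<in> M_add G (Some c) (Some d)"
  using M_add_Some[OF seq_closed(3,4)[OF assms]] srepI[OF assms] by simp

end

section \<open>Recovering special groups and their morphisms from \<open>M\<close>\<close>

lemma special_iff: "special G \<longleftrightarrow> special_group G"
  by (simp add: special_def)

text \<open>Every field of \<open>G\<close> can be read off \<open>M G\<close>:
  \<open>sneg G\<close> is the negative of one, and \<open>seq G\<close> comes back through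
  \<open>seq_iff\<close>. Equality of records also concerns products outside the carrier; these
  agree because \<open>M_mult\<close> carries the multiplication of the whole type.\<close>

lemma M_inj:
  assumes "special_group G" "special_group H" "M G = M H"
  shows "G = H"
proof -
  interpret G: special G by (simp add: special_def assms)
  interpret H: special H by (simp add: special_def assms)
  have mult: "x \<otimes>\<^bsub>G\<^esub> y = x \<otimes>\<^bsub>H\<^esub> y" for x y
    using arg_cong[OF assms(3), of "\<lambda>F. mult F (Some x) (Some y)"] by simp
  have one: "\<one>\<^bsub>G\<^esub> = \<one>\<^bsub>H\<^esub>"
    using arg_cong[OF assms(3), of one] by simp
  have "insert None (Some ` carrier G) = insert None (Some ` carrier H)"
    using arg_cong[OF assms(3), of carrier] by simp
  then have carrier: "carrier G = carrier H" by auto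
  have neg: "sminus G x = sminus H x" for x
    using arg_cong[OF assms(3), of "\<lambda>F. hneg F (Some x)"] by simp
  have "sneg G = sminus G \<one>\<^bsub>G\<^esub>" "sneg H = sminus H \<one>\<^bsub>H\<^esub>"
    by (simp_all add: sminus_def)
  then have sneg: "sneg G = sneg H" using neg one by simp
  have add: "M_add G = M_add H"
    using arg_cong[OF assms(3), of hadd] by simp
  have "((a, b), (c, d)) \<in> seq G \<longleftrightarrow> ((a, b), (c, d)) \<in> seq H" for a b c d
  proof (cases "a \<in> carrier G \<and> b \<in> carrier G \<and> c \<in> carrier G \<and> d \<in> carrier G")
    case True
    then have "a \<in> srep G c d \<longleftrightarrow> a \<in> srep H c d"
      using G.M_add_Some[of c d a] H.M_add_Some[of c d a] carrier add by simp
    then show ?thesis using True carrier mult G.seq_iff H.seq_iff by auto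
  next
    case False
    then have "((a, b), (c, d)) \<notin> seq G" "((a, b), (c, d)) \<notin> seq H"
      using carrier by (auto dest: G.seq_closed H.seq_closed)
    then show ?thesis by simp
  qed
  then have "seq G = seq H" by auto
  moreover have "mult G = mult H" using mult by blast
  ultimately show ?thesis using one carrier sneg by (intro special_group.equality) auto
qed

lemma carrier_M: "carrier (M G) = insert None (Some ` carrier G)"
  by (simp add: M_def)

lemma M_map_apply: "x \<in> carrier (M G) \<Longrightarrow> M_map G f x = map_option f x"
  by (simp add: M_map_def)

lemma sg_hom_closed: "f \<in> sg_hom G H \<Longrightarrow> a \<in> carrier G \<Longrightarrow> f a \<in> carrier H"
  by (auto simp: sg_hom_def hom_def)

lemma M_map_hom:
  assumes G: "special_group G" and H: "special_group H" and f: "f \<in> sg_hom G H"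
  shows "M_map G f \<in> hyperfield_hom (M G) (M H)"
proof -
  interpret G: special G by (simp add: special_def assms)
  interpret H: special H by (simp add: special_def assms)
  note cl = sg_hom_closed[OF f]
  have mult: "f (a \<otimes>\<^bsub>G\<^esub> b) = f a \<otimes>\<^bsub>H\<^esub> f b" if "a \<in> carrier G" "b \<in> carrier G" for a b
    using f that by (auto simp: sg_hom_def hom_def)
  have neg: "f (sminus G a) = sminus H (f a)" if "a \<in> carrier G" for a
    using f that mult by (auto simp: sg_hom_def sminus_def)
  have one: "f \<one>\<^bsub>G\<^esub> = \<one>\<^bsub>H\<^esub>"
    using f G.group_axioms H.group_axioms by (auto simp: sg_hom_def intro: hom_one)
  have srep: "f c \<in> srep H (f a) (f b)" if "c \<in> srep G a b" for a b c
  proof -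
    from that obtain d where "c \<in> carrier G" "d \<in> carrier G" "((c, d), (a, b)) \<in> seq G"
      unfolding srep_def by blast
    moreover from this have "((f c, f d), (f a, f b)) \<in> seq H"
      using f unfolding sg_hom_def by blast
    ultimately show ?thesis using H.srepI by blast
  qed
  have add: "M_map G f z \<in> M_add H (M_map G f x) (M_map G f y)"
    if c: "x \<in> carrier (M G)" "y \<in> carrier (M G)" and z: "z \<in> M_add G x y" for x y z
  proof (cases "x = None \<or> y = None")
    case True then show ?thesis using c z by (auto simp: M_map_apply)
  next
    case False
    then obtain a b where ab: "x = Some a" "y = Some b" "a \<in> carrier G" "b \<in> carrier G"
      using c by auto
    have zc: "z \<in> carrier (M G)" using z c G.M_add_closed by blast
    show ?thesis
    proof (cases z)
      case None
      then show ?thesis using z ab neg by (auto simp: M_map_apply split: if_splits)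
    next
      case (Some e)
      then have "f e \<in> srep H (f a) (f b)" using z ab G.M_add_Some srep by blast
      then have "Some (f e) \<in> M_add H (Some (f a)) (Some (f b))" using H.M_add_Some cl ab by blast
      then show ?thesis using Some zc c ab by (simp add: M_map_apply)
    qed
  qed
  show ?thesis unfolding hyperfield_hom_def
  proof (intro CollectI conjI ballI)
    fix x y z assume "x \<in> carrier (M G)" "y \<in> carrier (M G)" "z \<in> hadd (M G) x y"
    with add[of x y z] show "M_map G f z \<in> hadd (M H) (M_map G f x) (M_map G f y)"
      unfolding G.M_simps(4) H.M_simps(4) .
  qed (use cl in \<open>auto simp: M_map_def mult neg one\<close>)
qed

text \<open>\<open>the\<close> is harmless here: each \<open>a\<close> has square one, so
  \<open>\<phi> (Some a)\<close> has square one and cannot be zero. Isometries are preserved because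
  \<open>seq_iff\<close> expresses them by sums and products.\<close>

lemma M_full:
  assumes G: "special_group G" and H: "special_group H" and \<phi>: "\<phi> \<in> hyperfield_hom (M G) (M H)"
  defines "f \<equiv> \<lambda>a\<in>carrier G. the (\<phi> (Some a))"
  shows "f \<in> sg_hom G H" "M_map G f = \<phi>"
proof -
  interpret G: special G by (simp add: special_def assms)
  interpret H: special H by (simp add: special_def assms)
  have \<phi>_mult: "\<phi> (M_mult G x y) = M_mult H (\<phi> x) (\<phi> y)"
    if "x \<in> carrier (M G)" "y \<in> carrier (M G)" for x y
    using \<phi> that unfolding hyperfield_hom_def by auto
  have \<phi>_one: "\<phi> (Some \<one>\<^bsub>G\<^esub>) = Some \<one>\<^bsub>H\<^esub>" and \<phi>_zero: "\<phi> None = None"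
    and \<phi>_ext: "\<phi> \<in> extensional (carrier (M G))"
    using \<phi> unfolding hyperfield_hom_def by auto
  have \<phi>_closed: "\<phi> x \<in> carrier (M H)" if "x \<in> carrier (M G)" for x
    using \<phi> that unfolding hyperfield_hom_def by auto
  have f: "\<phi> (Some a) = Some (f a)" "f a \<in> carrier H" if a: "a \<in> carrier G" for a
  proof -
    have "M_mult H (\<phi> (Some a)) (\<phi> (Some a)) = Some \<one>\<^bsub>H\<^esub>"
      using \<phi>_mult[of "Some a" "Some a"] a \<phi>_one by simp
    then obtain b where "\<phi> (Some a) = Some b" by (cases "\<phi> (Some a)") auto
    then show "\<phi> (Some a) = Some (f a)" "f a \<in> carrier H"
      using \<phi>_closed[of "Some a"] a by (auto simp: f_def)
  qed
  have mult: "f (a \<otimes>\<^bsub>G\<^esub> b) = f a \<otimes>\<^bsub>H\<^esub> f b" if "a \<in> carrier G" "b \<in> carrier G" for a b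
    using \<phi>_mult[of "Some a" "Some b"] that f(1) by simp
  have "\<forall>a\<in>carrier (M G). \<phi> (hneg (M G) a) = hneg (M H) (\<phi> a)"
    and \<phi>_add: "\<forall>a\<in>carrier (M G). \<forall>b\<in>carrier (M G). \<forall>c\<in>hadd (M G) a b.
      \<phi> c \<in> hadd (M H) (\<phi> a) (\<phi> b)"
    by (insert \<phi>[unfolded hyperfield_hom_def], elim CollectE conjE, assumption)+
  from this(1)[THEN bspec, of "Some \<one>\<^bsub>G\<^esub>"] have "\<phi> (Some (sneg G)) = map_option (sminus H) (\<phi> (Some \<one>\<^bsub>G\<^esub>))"
    by (simp add: sminus_def)
  then have neg: "f (sneg G) = sneg H"
    using f(1)[of "sneg G"] \<phi>_one by (simp add: sminus_def)
  have "((f a, f b), (f c, f d)) \<in> seq H" if s: "((a, b), (c, d)) \<in> seq G" for a b c d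
  proof -
    note cl = G.seq_closed[OF s]
    have "Some a \<in> M_add G (Some c) (Some d)" by (rule G.M_add_seq[OF s])
    then have "\<phi> (Some a) \<in> M_add H (\<phi> (Some c)) (\<phi> (Some d))"
      using \<phi>_add cl by simp
    then have "f a \<in> srep H (f c) (f d)" using f cl H.M_add_Some by metis
    moreover have "f a \<otimes>\<^bsub>H\<^esub> f b = f c \<otimes>\<^bsub>H\<^esub> f d"
      using G.seq_prod[OF s] mult cl by metis
    ultimately show ?thesis using f(2) cl by (simp add: H.seq_iff)
  qed
  then show "f \<in> sg_hom G H"
    using f(2) mult neg by (auto simp: sg_hom_def hom_def f_def)
  show "M_map G f = \<phi>"
  proof
    fix x
    show "M_map G f x = \<phi> x"
      using f(1) \<phi>_zero extensional_arb[OF \<phi>_ext, of x]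
      by (cases "x \<in> carrier (M G)") (auto simp: M_map_def)
  qed
qed

section \<open>The categories of special groups and of special multifields\<close>

lemma compose_restrict_id:
  "f \<in> extensional A \<Longrightarrow> compose A f (restrict id A) = f"
  "f \<in> A \<rightarrow> B \<Longrightarrow> f \<in> extensional A \<Longrightarrow> compose A (restrict id B) f = f"
  by (auto simp: compose_def fun_eq_iff extensional_def)

lemma SG_simps [simp]: "Obj SG = Collect special_group" "Hom SG = sg_hom"
  "Idn SG = (\<lambda>G. restrict id (carrier G))" "Cmp SG = (\<lambda>G H L g f. compose (carrier G) g f)"
  by (simp_all add: SG_def)

lemma SMF_simps [simp]: "Obj SMF = M ` Collect special_group" "Hom SMF = hyperfield_hom"
  "Idn SMF = (\<lambda>F. restrict id (carrier F))" "Cmp SMF = (\<lambda>E F K g f. compose (carrier E) g f)"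
  using special.hyperfield_M by (auto simp: SMF_def special_iff)

lemma sg_hom_funcset: "f \<in> sg_hom G H \<Longrightarrow> f \<in> carrier G \<rightarrow> carrier H \<and> f \<in> extensional (carrier G)"
  by (auto simp: sg_hom_def hom_def)

lemma hyperfield_homD:
  assumes "f \<in> hyperfield_hom F E"
  shows "a \<in> carrier F \<Longrightarrow> f a \<in> carrier E"
    "\<lbrakk>a \<in> carrier F; b \<in> carrier F; c \<in> hadd F a b\<rbrakk> \<Longrightarrow> f c \<in> hadd E (f a) (f b)"
    "a \<in> carrier F \<Longrightarrow> f (hneg F a) = hneg E (f a)"
    "f (hzero F) = hzero E"
    "\<lbrakk>a \<in> carrier F; b \<in> carrier F\<rbrakk> \<Longrightarrow> f (a \<otimes>\<^bsub>F\<^esub> b) = f a \<otimes>\<^bsub>E\<^esub> f b"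
    "f \<one>\<^bsub>F\<^esub> = \<one>\<^bsub>E\<^esub>"
proof -
  note f = assms[unfolded hyperfield_hom_def]
  have *: "f \<in> (carrier F \<rightarrow> carrier E) \<inter> extensional (carrier F)"
    "\<forall>a\<in>carrier F. \<forall>b\<in>carrier F. \<forall>c\<in>hadd F a b. f c \<in> hadd E (f a) (f b)"
    "\<forall>a\<in>carrier F. f (hneg F a) = hneg E (f a)"
    "\<forall>a\<in>carrier F. \<forall>b\<in>carrier F. f (a \<otimes>\<^bsub>F\<^esub> b) = f a \<otimes>\<^bsub>E\<^esub> f b"
    "f (hzero F) = hzero E" "f \<one>\<^bsub>F\<^esub> = \<one>\<^bsub>E\<^esub>"
    by (insert f, elim CollectE conjE, assumption)+
  show "a \<in> carrier F \<Longrightarrow> f a \<in> carrier E" using *(1) by blast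
  show "\<lbrakk>a \<in> carrier F; b \<in> carrier F; c \<in> hadd F a b\<rbrakk> \<Longrightarrow> f c \<in> hadd E (f a) (f b)"
    using *(2) by blast
  show "a \<in> carrier F \<Longrightarrow> f (hneg F a) = hneg E (f a)" using *(3) by blast
  show "\<lbrakk>a \<in> carrier F; b \<in> carrier F\<rbrakk> \<Longrightarrow> f (a \<otimes>\<^bsub>F\<^esub> b) = f a \<otimes>\<^bsub>E\<^esub> f b"
    using *(4) by blast
qed (insert assms[unfolded hyperfield_hom_def], elim CollectE conjE, assumption)+

lemma hyperfield_hom_funcset:
  "f \<in> hyperfield_hom F E \<Longrightarrow> f \<in> carrier F \<rightarrow> carrier E \<and> f \<in> extensional (carrier F)"
  by (auto simp: hyperfield_hom_def)

lemma category_SG: "is_category (SG :: ('a special_group, 'a \<Rightarrow> 'a) category)"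
  unfolding is_category_def SG_simps
proof (intro conjI ballI)
  fix G :: "'a special_group" assume "G \<in> Collect special_group"
  then interpret special G by (simp add: special_def)
  show "restrict id (carrier G) \<in> sg_hom G G"
    using seq_closed by (auto simp: sg_hom_def hom_def)
next
  fix G H L :: "'a special_group" and f g
  assume "G \<in> Collect special_group" and fg: "f \<in> sg_hom G H" "g \<in> sg_hom H L"
  then interpret special G by (simp add: special_def)
  show "compose (carrier G) g f \<in> sg_hom G L"
    unfolding sg_hom_def
  proof (intro CollectI conjI IntI allI impI)
    show "compose (carrier G) g f \<in> hom G L"
      using fg by (auto simp: sg_hom_def hom_def compose_def Pi_iff)
    show "compose (carrier G) g f (sneg G) = sneg L"
      using fg by (simp add: sg_hom_def compose_def)
    fix a b c d assume s: "((a, b), (c, d)) \<in> seq G"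
    then have "((f a, f b), (f c, f d)) \<in> seq H" using fg(1) unfolding sg_hom_def by blast
    then have "((g (f a), g (f b)), (g (f c), g (f d))) \<in> seq L"
      using fg(2) unfolding sg_hom_def by blast
    then show "((compose (carrier G) g f a, compose (carrier G) g f b),
        (compose (carrier G) g f c, compose (carrier G) g f d)) \<in> seq L"
      using seq_closed[OF s] by (simp add: compose_def)
  qed simp
next
  fix G H L N :: "'a special_group" and f g h
  assume "f \<in> sg_hom G H" "g \<in> sg_hom H L" "h \<in> sg_hom L N"
  then show "compose (carrier G) h (compose (carrier G) g f) =
      compose (carrier G) (compose (carrier H) h g) f"
    using sg_hom_funcset by (metis compose_assoc)
qed (use sg_hom_funcset in \<open>metis compose_restrict_id\<close>)+

lemma category_SMF: "is_category (SMF :: ('a option multiring, 'a option \<Rightarrow> 'a option) category)"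
  unfolding is_category_def SMF_simps
proof (intro conjI ballI)
  fix F :: "'a option multiring" assume "F \<in> M ` Collect special_group"
  then obtain G where F: "F = M G" "special G" by (auto simp: special_iff)
  then interpret special G by simp
  show "restrict id (carrier F) \<in> hyperfield_hom F F"
    unfolding F hyperfield_hom_def by (auto dest: srepD(1))
next
  fix F E K :: "'a option multiring" and f g
  assume "F \<in> M ` Collect special_group" and fg: "f \<in> hyperfield_hom F E" "g \<in> hyperfield_hom E K"
  then obtain G where F: "F = M G" "special G" by (auto simp: special_iff)
  then interpret special G by simp
  have closed: "hadd F x y \<subseteq> carrier F" "x \<otimes>\<^bsub>F\<^esub> y \<in> carrier F" "hneg F x \<in> carrier F"
    if "x \<in> carrier F" "y \<in> carrier F" for x y
    using that M_add_closed unfolding F by auto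
  moreover have "\<one>\<^bsub>F\<^esub> \<in> carrier F" "hzero F \<in> carrier F" using F by auto
  ultimately show "compose (carrier F) g f \<in> hyperfield_hom F K"
    unfolding hyperfield_hom_def
  proof (intro CollectI conjI IntI ballI)
    fix a b c assume a: "a \<in> carrier F" "b \<in> carrier F" "c \<in> hadd F a b"
    then have "c \<in> carrier F" using closed by blast
    moreover have "g (f c) \<in> hadd K (g (f a)) (g (f b))"
      using hyperfield_homD(2)[OF fg(2) hyperfield_homD(1)[OF fg(1) a(1)]
          hyperfield_homD(1)[OF fg(1) a(2)] hyperfield_homD(2)[OF fg(1) a]] .
    ultimately show "compose (carrier F) g f c \<in>
        hadd K (compose (carrier F) g f a) (compose (carrier F) g f b)"
      using a by (simp add: compose_def)
  qed (simp_all add: compose_def hyperfield_homD[OF fg(1)] hyperfield_homD[OF fg(2)])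
next
  fix F E K L :: "'a option multiring" and f g h
  assume "f \<in> hyperfield_hom F E" "g \<in> hyperfield_hom E K" "h \<in> hyperfield_hom K L"
  then show "compose (carrier F) h (compose (carrier F) g f) =
      compose (carrier F) (compose (carrier E) h g) f"
    using hyperfield_hom_funcset by (metis compose_assoc)
qed (use hyperfield_hom_funcset in \<open>metis compose_restrict_id\<close>)+

section \<open>The functor \<open>M\<close> and its inverse\<close>

lemma M_map_id:
  "M_map G (restrict id (carrier G)) = restrict id (carrier (M G))"
  by (auto simp: M_map_def M_def fun_eq_iff)

lemma M_map_compose:
  assumes "f \<in> sg_hom G H"
  shows "M_map G (compose (carrier G) g f) = compose (carrier (M G)) (M_map H g) (M_map G f)"
  using sg_hom_closed[OF assms] by (auto simp: M_map_def M_def compose_def fun_eq_iff)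

lemma functor_M: "is_functor SG SMF M_functor"
  unfolding is_functor_def M_functor_def
  by (auto simp: category_SG category_SMF M_map_hom M_map_id M_map_compose)

text \<open>Identities serve as the components. Agreement is asked only on \<open>Obj\<close> and
  \<open>Hom\<close>: outside of them the underlying HOL functions may differ, so equality of the
  functor records cannot be expected.\<close>

lemma identical_imp_naturally_isomorphic:
  assumes D: "is_category D" and F: "is_functor C D F"
    and obj_eq: "\<And>X. X \<in> Obj C \<Longrightarrow> fobj F X = fobj E X"
    and mor_eq: "\<And>X Y f. X \<in> Obj C \<Longrightarrow> Y \<in> Obj C \<Longrightarrow> f \<in> Hom C X Y \<Longrightarrow> fmor F X Y f = fmor E X Y f"
  shows "naturally_isomorphic C D F E"
proof -
  have id: "\<forall>X\<in>Obj D. Idn D X \<in> Hom D X X"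
    and unit: "\<forall>X\<in>Obj D. \<forall>Y\<in>Obj D. \<forall>f\<in>Hom D X Y.
      Cmp D X X Y f (Idn D X) = f \<and> Cmp D X Y Y (Idn D Y) f = f"
    by (insert D[unfolded is_category_def], elim conjE, assumption)+
  have obj: "\<forall>X\<in>Obj C. fobj F X \<in> Obj D"
    and mor: "\<forall>X\<in>Obj C. \<forall>Y\<in>Obj C. \<forall>f\<in>Hom C X Y. fmor F X Y f \<in> Hom D (fobj F X) (fobj F Y)"
    by (insert F[unfolded is_functor_def], elim conjE, assumption)+
  show ?thesis
    unfolding naturally_isomorphic_def
  proof (intro exI[of _ "\<lambda>X. Idn D (fobj F X)"] conjI ballI)
    fix X assume X: "X \<in> Obj C"
    note [simp] = unit[rule_format] obj[rule_format, OF X] id[rule_format]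
    show "is_iso D (fobj F X) (fobj E X) (Idn D (fobj F X))"
      unfolding is_iso_def obj_eq[OF X, symmetric]
      by (intro conjI bexI[of _ "Idn D (fobj F X)"]) simp_all
    fix Y f assume Y: "Y \<in> Obj C" and f: "f \<in> Hom C X Y"
    have "fmor F X Y f \<in> Hom D (fobj F X) (fobj F Y)" using mor X Y f by blast
    then show "Cmp D (fobj F X) (fobj F Y) (fobj E Y) (Idn D (fobj F Y)) (fmor F X Y f) =
        Cmp D (fobj F X) (fobj E X) (fobj E Y) (fmor E X Y f) (Idn D (fobj F X))"
      unfolding obj_eq[OF X, symmetric] obj_eq[OF Y, symmetric] mor_eq[OF X Y f, symmetric]
      using obj[rule_format, OF Y] by simp
  qed
qed

text \<open>By \<open>M_inj\<close> the preimage picked by \<open>inv_into\<close> is the only one,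
  so both composites with \<open>M_functor\<close> are identities on objects and morphisms, not
  merely isomorphic to them.\<close>

definition M_inverse ::
  "('a option multiring, 'a option \<Rightarrow> 'a option, 'a special_group, 'a \<Rightarrow> 'a) cat_functor" where
  "M_inverse =
     \<lparr>fobj = inv_into (Collect special_group) M,
      fmor = (\<lambda>F E \<phi>. \<lambda>a\<in>carrier (inv_into (Collect special_group) M F). the (\<phi> (Some a)))\<rparr>"

lemma M_inverse_obj: "special_group G \<Longrightarrow> fobj M_inverse (M G) = G"
  by (auto simp: M_inverse_def intro!: inv_into_f_f inj_onI intro: M_inj)

lemma M_inverse_mor:
  "special_group G \<Longrightarrow> fmor M_inverse (M G) E \<phi> = (\<lambda>a\<in>carrier G. the (\<phi> (Some a)))"
  using M_inverse_obj[of G] by (simp add: M_inverse_def)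

lemma M_inverse_M_map:
  assumes "special_group G" "f \<in> sg_hom G H"
  shows "fmor M_inverse (M G) E (M_map G f) = f"
  unfolding M_inverse_mor[OF assms(1)] using sg_hom_funcset[OF assms(2)]
  by (auto simp: M_map_def M_def fun_eq_iff extensional_def)

lemma functor_M_inverse: "is_functor SMF SG M_inverse"
  unfolding is_functor_def SG_simps SMF_simps
proof (intro conjI ballI; (elim imageE CollectE; hypsubst)?)
  fix G H :: "'a special_group" and \<phi>
  assume G: "special_group G" and H: "special_group H" and \<phi>: "\<phi> \<in> hyperfield_hom (M G) (M H)"
  then show "fmor M_inverse (M G) (M H) \<phi> \<in> sg_hom (fobj M_inverse (M G)) (fobj M_inverse (M H))"
    by (simp add: M_inverse_obj M_inverse_mor M_full)
  fix L :: "'a special_group" and \<psi>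
  assume L: "special_group L" and \<psi>: "\<psi> \<in> hyperfield_hom (M H) (M L)"
  \<comment> \<open>By fullness \<open>\<phi>\<close> and \<open>\<psi>\<close> are images of
    morphisms \<open>f\<close> and \<open>g\<close> of special groups, so compatibility with
    composition is inherited from \<open>M_map_compose\<close>.\<close>
  define f g where "f = (\<lambda>a\<in>carrier G. the (\<phi> (Some a)))" and "g = (\<lambda>a\<in>carrier H. the (\<psi> (Some a)))"
  have f: "f \<in> sg_hom G H" "M_map G f = \<phi>" and g: "g \<in> sg_hom H L" "M_map H g = \<psi>"
    unfolding f_def g_def using M_full[OF G H \<phi>] M_full[OF H L \<psi>] by blast+
  have gf: "compose (carrier G) g f \<in> sg_hom G L"
  proof -
    have "\<forall>X\<in>Obj SG. \<forall>Y\<in>Obj SG. \<forall>Z\<in>Obj SG. \<forall>f\<in>Hom SG X Y. \<forall>g\<in>Hom SG Y Z.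
        Cmp SG X Y Z g f \<in> Hom SG X (Z :: 'a special_group)"
      by (insert category_SG[unfolded is_category_def], elim conjE, assumption)
    then show ?thesis using G H L f(1) g(1) by simp
  qed
  show "fmor M_inverse (M G) (M L) (compose (carrier (M G)) \<psi> \<phi>) =
      compose (carrier (fobj M_inverse (M G))) (fmor M_inverse (M H) (M L) \<psi>) (fmor M_inverse (M G) (M H) \<phi>)"
    unfolding f(2)[symmetric] g(2)[symmetric] M_map_compose[OF f(1), symmetric]
    by (simp only: M_inverse_M_map[OF G f(1)] M_inverse_M_map[OF H g(1)] M_inverse_M_map[OF G gf]
        M_inverse_obj[OF G])
qed (auto simp: M_inverse_obj M_inverse_mor category_SG category_SMF carrier_M)

lemma functor_comp:
  assumes F: "is_functor C D F" and E: "is_functor D B E"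
  shows "is_functor C B (comp_functor E F)"
  using assms unfolding is_functor_def comp_functor_def by simp

lemma equivalence_M:
  "is_equivalence (SG :: ('a special_group, 'a \<Rightarrow> 'a) category) SMF M_functor"
  unfolding is_equivalence_def
proof (intro conjI exI functor_M, rule functor_M_inverse)
  show "naturally_isomorphic (SG :: ('a special_group, 'a \<Rightarrow> 'a) category) SG
      (comp_functor M_inverse M_functor) id_functor"
    by (rule identical_imp_naturally_isomorphic[OF category_SG functor_comp[OF functor_M functor_M_inverse]])
      (simp_all add: comp_functor_def id_functor_def M_functor_def M_inverse_obj M_inverse_M_map)
  show "naturally_isomorphic (SMF :: ('a option multiring, 'a option \<Rightarrow> 'a option) category) SMF
      (comp_functor M_functor M_inverse) id_functor"
  proof (rule identical_imp_naturally_isomorphic[OF category_SMF functor_comp[OF functor_M_inverse functor_M]])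
    fix F E :: "'a option multiring" and \<phi>
    assume "F \<in> Obj SMF"
    then obtain G where G: "special_group G" "F = M G" by auto
    then show "fobj (comp_functor M_functor M_inverse) F = fobj id_functor F"
      by (simp add: comp_functor_def id_functor_def M_functor_def M_inverse_obj)
    assume "E \<in> Obj SMF" and \<phi>: "\<phi> \<in> Hom SMF F E"
    then obtain H where H: "special_group H" "E = M H" by auto
    show "fmor (comp_functor M_functor M_inverse) F E \<phi> = fmor id_functor F E \<phi>"
      using M_full(2)[OF G(1) H(1)] \<phi> G H
      by (simp add: comp_functor_def id_functor_def M_functor_def M_inverse_obj M_inverse_mor)
  qed
qed

section \<open>Free algebras\<close>

text \<open>The product of \<open>free_algebra X\<close> does not depend on \<open>X\<close>; under
  its own name it can be computed with on arbitrary functions, apart from carrier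
  conditions.\<close>

definition conv :: "('a list \<Rightarrow> 'r::comm_ring_1) \<Rightarrow> ('a list \<Rightarrow> 'r) \<Rightarrow> 'a list \<Rightarrow> 'r" where
  "conv f g = (\<lambda>w. \<Sum>k\<le>length w. f (take k w) * g (drop k w))"

lemma free_algebra_simps [simp]:
  "carrier (free_algebra X) = {f. finite {w. f w \<noteq> 0} \<and> {w. f w \<noteq> 0} \<subseteq> lists X}"
  "mult (free_algebra X) = conv"
  "one (free_algebra X) = word []"
  "zero (free_algebra X) = (\<lambda>w. 0)"
  "add (free_algebra X) = (\<lambda>f g w. f w + g w)"
  by (simp_all add: free_algebra_def conv_def[abs_def] word_def)

definition homogeneous :: "'a set \<Rightarrow> nat \<Rightarrow> ('a list \<Rightarrow> 'r::comm_ring_1) set" where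
  "homogeneous X n = {f \<in> carrier (free_algebra X). \<forall>w. f w \<noteq> 0 \<longrightarrow> length w = n}"

lemma conv_support:
  assumes "conv f g w \<noteq> 0"
  obtains u v where "w = u @ v" "f u \<noteq> 0" "g v \<noteq> 0"
proof -
  obtain k where "f (take k w) * g (drop k w) \<noteq> 0"
    using assms unfolding conv_def by (meson sum.neutral)
  then show ?thesis by (intro that[of "take k w" "drop k w"]) auto
qed

lemma conv_closed:
  assumes "f \<in> carrier (free_algebra X)" "g \<in> carrier (free_algebra X)"
  shows "conv f g \<in> carrier (free_algebra X)"
proof -
  have "{w. conv f g w \<noteq> 0} \<subseteq> (\<lambda>(u, v). u @ v) ` ({w. f w \<noteq> 0} \<times> {w. g w \<noteq> 0})"
    by (auto elim!: conv_support)
  moreover have "finite ((\<lambda>(u, v). u @ v) ` ({w. f w \<noteq> 0} \<times> {w. g w \<noteq> 0}))"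
    using assms by simp
  ultimately have "finite {w. conv f g w \<noteq> 0}" by (rule finite_subset)
  moreover have "{w. conv f g w \<noteq> 0} \<subseteq> lists X"
  proof
    fix w assume "w \<in> {w. conv f g w \<noteq> 0}"
    then obtain u v where "w = u @ v" "f u \<noteq> 0" "g v \<noteq> 0" by (auto elim: conv_support)
    moreover from this have "u \<in> lists X" "v \<in> lists X" using assms by auto
    ultimately show "w \<in> lists X" by simp
  qed
  ultimately show ?thesis by simp
qed

lemma conv_homogeneous:
  assumes "f \<in> homogeneous X n" "g \<in> homogeneous X m"
  shows "conv f g \<in> homogeneous X (n + m)"
  using assms conv_closed[of f X g] by (auto simp: homogeneous_def elim!: conv_support)

lemma add_closed:
  assumes "f \<in> carrier (free_algebra X)" "g \<in> carrier (free_algebra X)"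
  shows "(\<lambda>w. f w + g w) \<in> carrier (free_algebra X)"
proof -
  have "{w. f w + g w \<noteq> 0} \<subseteq> {w. f w \<noteq> 0} \<union> {w. g w \<noteq> 0}" by auto
  then show ?thesis using assms by (auto intro: finite_subset)
qed

lemma add_homogeneous:
  "f \<in> homogeneous X n \<Longrightarrow> g \<in> homogeneous X n \<Longrightarrow> (\<lambda>w. f w + g w) \<in> homogeneous X n"
  using add_closed[of f X g] by (auto simp: homogeneous_def) (metis add_0)

lemma uminus_closed:
  "f \<in> carrier (free_algebra X) \<Longrightarrow> (\<lambda>w. - f w) \<in> carrier (free_algebra X)"
  by simp

lemma uminus_homogeneous:
  "f \<in> homogeneous X n \<Longrightarrow> (\<lambda>w. - f w) \<in> homogeneous X n"
  by (simp add: homogeneous_def)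

lemma word_closed [simp]: "w \<in> lists X \<Longrightarrow> word w \<in> carrier (free_algebra X)"
  by (auto simp: word_def)

lemma word_homogeneous: "w \<in> lists X \<Longrightarrow> word w \<in> homogeneous X (length w)"
  by (auto simp: homogeneous_def word_def)

lemma zero_homogeneous: "(\<lambda>w. 0) \<in> homogeneous X n"
  by (simp add: homogeneous_def)

text \<open>Both sides sum over all ways to cut \<open>w\<close> into three consecutive factors;
  \<open>F i m\<close> is the term whose first two factors have lengths \<open>i\<close> and
  \<open>m\<close>.\<close>

lemma conv_assoc:
  fixes f g h :: "'a list \<Rightarrow> 'r::comm_ring_1"
  shows "conv (conv f g) h = conv f (conv g h)"
proof
  fix w :: "'a list"
  let ?n = "length w"
  define F where "F i m = f (take i w) * g (take m (drop i w)) * h (drop (i + m) w)" for i m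
  have "conv (conv f g) h w = (\<Sum>k\<le>?n. \<Sum>i\<le>k. F i (k - i))"
    unfolding conv_def F_def
    by (auto simp: sum_distrib_right take_drop min_def intro!: sum.cong)
  also have "\<dots> = (\<Sum>(i, m)\<in>{(i, m). i + m \<le> ?n}. F i m)"
    by (rule sum.triangle_reindex_eq[symmetric])
  also have "{(i, m). i + m \<le> ?n} = (SIGMA i:{..?n}. {..?n - i})"
    by auto
  also have "(\<Sum>(i, m)\<in>\<dots>. F i m) = (\<Sum>i\<le>?n. \<Sum>m\<le>?n - i. F i m)"
    by (rule sum.Sigma[symmetric]) auto
  also have "\<dots> = conv f (conv g h) w"
    unfolding conv_def F_def
    by (auto simp: sum_distrib_left mult.assoc add.commute intro!: sum.cong)
  finally show "conv (conv f g) h w = conv f (conv g h) w" .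
qed

lemma conv_word:
  "conv (word u) f w = (if take (length u) w = u then f (drop (length u) w) else 0)"
proof -
  have le: "length u \<le> length w" if "take (length u) w = u"
    using arg_cong[OF that, of length] by simp
  have "conv (word u) f w =
      (\<Sum>k\<le>length w. if k = length u then (if take (length u) w = u then f (drop (length u) w) else 0) else 0)"
    unfolding conv_def word_def by (rule sum.cong) (auto simp: min_def split: if_splits)
  also have "\<dots> = (if take (length u) w = u then f (drop (length u) w) else 0)"
    by (auto simp: sum.delta dest: le)
  finally show ?thesis .
qed

lemma conv_word_word: "conv (word u) (word v) = word (u @ v)"
proof
  fix w
  have "w = u @ v \<longleftrightarrow> take (length u) w = u \<and> drop (length u) w = v"
    by (metis append_eq_conv_conj)
  then show "conv (word u) (word v) w = word (u @ v) w"
    unfolding conv_word by (simp add: word_def)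
qed

lemma conv_one_left: "conv (word []) f = f"
  by (auto simp: conv_word)

lemma conv_one_right: "conv f (word []) = f"
proof
  fix w
  have "conv f (word []) w = (\<Sum>k\<le>length w. if k = length w then f w else 0)"
    unfolding conv_def word_def by (rule sum.cong) auto
  then show "conv f (word []) w = f w" by simp
qed

lemma conv_add_left: "conv (\<lambda>w. f w + g w) h = (\<lambda>w. conv f h w + conv g h w)"
  by (simp add: conv_def distrib_right sum.distrib)

lemma conv_add_right: "conv h (\<lambda>w. f w + g w) = (\<lambda>w. conv h f w + conv h g w)"
  by (simp add: conv_def distrib_left sum.distrib)

lemma conv_uminus_left: "conv (\<lambda>w. - f w) h = (\<lambda>w. - conv f h w)"
  by (simp add: conv_def sum_negf)

lemma conv_uminus_right: "conv h (\<lambda>w. - f w) = (\<lambda>w. - conv h f w)"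
  by (simp add: conv_def sum_negf)

lemma conv_zero_left: "conv (\<lambda>w. 0) h = (\<lambda>w. 0)"
  and conv_zero_right: "conv h (\<lambda>w. 0) = (\<lambda>w. 0)"
  by (simp_all add: conv_def)

lemma conv_Nil: "conv f g [] = f [] * g []"
  by (simp add: conv_def)

lemma ring_free_algebra: "ring (free_algebra X :: ('a list \<Rightarrow> 'r::comm_ring_1) ring)"
proof (rule ringI)
  show "abelian_group (free_algebra X :: ('a list \<Rightarrow> 'r) ring)"
  proof (rule abelian_groupI)
    fix f :: "'a list \<Rightarrow> 'r" assume "f \<in> carrier (free_algebra X)"
    then show "\<exists>g\<in>carrier (free_algebra X). g \<oplus>\<^bsub>free_algebra X\<^esub> f = \<zero>\<^bsub>free_algebra X\<^esub>"
      by (intro bexI[of _ "\<lambda>w. - f w"]) simp_all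
  next
    fix f g :: "'a list \<Rightarrow> 'r"
    assume "f \<in> carrier (free_algebra X)" "g \<in> carrier (free_algebra X)"
    then show "f \<oplus>\<^bsub>free_algebra X\<^esub> g \<in> carrier (free_algebra X)"
      using add_closed[of f X g] by (simp only: free_algebra_simps(5))
  qed (auto simp: algebra_simps)
  show "monoid (free_algebra X :: ('a list \<Rightarrow> 'r) ring)"
    by (rule monoidI) (use conv_closed word_closed[of "[]" X] in
      \<open>auto simp: conv_assoc conv_one_left conv_one_right simp del: free_algebra_simps(1)\<close>)
qed (simp_all add: conv_add_left conv_add_right)

lemma a_minus_free_algebra:
  assumes "f \<in> carrier (free_algebra X)" "g \<in> carrier (free_algebra X)"
  shows "f \<ominus>\<^bsub>free_algebra X\<^esub> g = (\<lambda>w. f w - g w)"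
proof -
  interpret ring "free_algebra X" by (rule ring_free_algebra)
  have "\<ominus>\<^bsub>free_algebra X\<^esub> g = (\<lambda>w. - g w)"
    by (rule minus_equality) (use assms in auto)
  then show ?thesis by (simp add: a_minus_def)
qed

text \<open>If every coefficient is an integer multiple of 1, the words of length \<open>n\<close>
  generate the homogeneous elements as an abelian group, so sums and negatives suffice and no case
  for scalars arises. Both \<open>int\<close> and \<open>bit\<close> qualify.\<close>

lemma homogeneous_induct [consumes 2, case_names zero word add uminus]:
  fixes f :: "'a list \<Rightarrow> 'r::comm_ring_1"
  assumes f: "f \<in> homogeneous X n" and of_int: "surj (of_int :: int \<Rightarrow> 'r)"
    and zero: "P (\<lambda>w. 0)"
    and word: "\<And>w. w \<in> lists X \<Longrightarrow> length w = n \<Longrightarrow> P (word w)"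
    and add: "\<And>f g. f \<in> homogeneous X n \<Longrightarrow> g \<in> homogeneous X n \<Longrightarrow> P f \<Longrightarrow> P g \<Longrightarrow> P (\<lambda>w. f w + g w)"
    and uminus: "\<And>f. f \<in> homogeneous X n \<Longrightarrow> P f \<Longrightarrow> P (\<lambda>w. - f w)"
  shows "P f"
proof -
  have hom: "(\<lambda>w. c * word v w) \<in> homogeneous X n" if "v \<in> lists X" "length v = n" for c :: 'r and v
    using that by (auto simp: homogeneous_def word_def)
  have nat: "P (\<lambda>w. of_nat k * word v w)" if v: "v \<in> lists X" "length v = n" for v k
  proof (induction k)
    case (Suc k)
    then have "P (\<lambda>w. word v w + of_nat k * word v w)"
      using add[OF _ hom[OF v] word[OF v] Suc] word_homogeneous[OF v(1)] v(2) by blast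
    then show ?case by (simp add: distrib_right)
  qed (simp add: zero)
  have P_word: "P (\<lambda>w. c * word v w)" if v: "v \<in> lists X" "length v = n" for c v
  proof -
    from surjD[OF of_int, of c] obtain k :: int where c: "c = of_int k" by blast
    show ?thesis
    proof (cases k rule: int_cases2)
      case (nonneg m)
      then show ?thesis using nat[OF v, of m] by (simp add: c)
    next
      case (nonpos m)
      then show ?thesis using uminus[OF hom[OF v] nat[OF v, of m]] by (simp add: c)
    qed
  qed
  have "P g" if "finite W" "\<And>w. g w \<noteq> 0 \<Longrightarrow> w \<in> W \<and> w \<in> lists X \<and> length w = n" for g W
    using that
  proof (induction W arbitrary: g)
    case empty
    then have "g = (\<lambda>w. 0)" by auto
    then show ?case by (simp add: zero)
  next
    case (insert v W)
    show ?case
    proof (cases "g v = 0")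
      case True
      then show ?thesis using insert.prems by (intro insert.IH) (metis insert_iff)
    next
      case False
      then have v: "v \<in> lists X" "length v = n" using insert.prems by auto
      define h where "h = (\<lambda>w. if w = v then 0 else g w)"
      have h: "w \<in> W \<and> w \<in> lists X \<and> length w = n" if "h w \<noteq> 0" for w
        using that insert.prems[of w] unfolding h_def by (metis insert_iff)
      then have "{w. h w \<noteq> 0} \<subseteq> W" by blast
      then have "h \<in> homogeneous X n"
        using h finite_subset[OF _ insert.hyps(1)] by (auto simp: homogeneous_def)
      then have "P (\<lambda>w. h w + g v * word v w)"
        using add[OF _ hom[OF v] insert.IH[OF h] P_word[OF v]] by blast
      moreover have "(\<lambda>w. h w + g v * word v w) = g" by (auto simp: h_def word_def)
      ultimately show ?thesis by simp
    qed
  qed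
  from this[of "{w. f w \<noteq> 0}"] show ?thesis using f by (auto simp: homogeneous_def)
qed

section \<open>Reduction of coefficients modulo 2\<close>

lemma surj_of_int_bit: "surj (of_int :: int \<Rightarrow> bit)"
proof
  show "UNIV \<subseteq> range (of_int :: int \<Rightarrow> bit)"
  proof
    fix b :: bit
    show "b \<in> range (of_int :: int \<Rightarrow> bit)"
      by (cases b) (auto intro: range_eqI[of _ _ 0] range_eqI[of _ _ 1])
  qed
qed simp

text \<open>A ring homomorphism to \<open>bit\<close>. It is \<open>id\<close> for
  \<open>kdm\<close>, whose coefficients already are bits, and \<open>of_int\<close> for
  \<open>kmult\<close>; all later constructions are carried out for both at once.\<close>

locale coefficient_map =
  fixes c :: "'r::comm_ring_1 \<Rightarrow> bit"
  assumes c_one: "c 1 = 1" and c_add: "c (x + y) = c x + c y" and c_mult: "c (x * y) = c x * c y"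
begin

lemma c_zero: "c 0 = 0"
  using c_add[of 0 0] by simp

lemma c_uminus: "c (- x) = c x"
  using c_add[of x "- x"] by (cases "c x"; cases "c (- x)") (simp_all add: c_zero)

lemma c_minus: "c (x - y) = c x + c y"
  using c_add[of x "- y"] by (simp add: c_uminus)

lemma c_sum: "c (sum f A) = (\<Sum>x\<in>A. c (f x))"
  by (induction A rule: infinite_finite_induct) (simp_all add: c_zero c_add)

lemma c_conv: "c \<circ> conv f g = conv (c \<circ> f) (c \<circ> g)"
  by (auto simp: conv_def c_sum c_mult)

lemma c_word: "c \<circ> word w = word w"
  by (auto simp: word_def c_zero c_one)

lemma c_closed:
  assumes "f \<in> carrier (free_algebra X)"
  shows "c \<circ> f \<in> carrier (free_algebra X)"
proof -
  have "{w. (c \<circ> f) w \<noteq> 0} \<subseteq> {w. f w \<noteq> 0}" by (auto simp: c_zero)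
  then show ?thesis using assms by (auto intro: finite_subset)
qed

lemma c_homogeneous: "f \<in> homogeneous X n \<Longrightarrow> c \<circ> f \<in> homogeneous X n"
proof -
  assume f: "f \<in> homogeneous X n"
  have "f w \<noteq> 0" if "(c \<circ> f) w \<noteq> 0" for w
    using that by (auto simp: c_zero)
  then show ?thesis
    using f c_closed[of f X] unfolding homogeneous_def by blast
qed

end

section \<open>Graded rings presented by words\<close>

text \<open>\<open>\<kappa> n\<close> maps a linear combination of words of length \<open>n\<close> to its class in \<open>R\<^sub>n\<close>, the letter \<open>t\<close>
  represents \<open>-1\<close>, and \<open>c\<close> is the reduction of coefficients modulo 2.\<close>

locale presentation = coefficient_map c
  for c :: "'r::comm_ring_1 \<Rightarrow> bit" +
  fixes X :: "'a set" and t :: 'a and R :: "'b igr" and \<kappa> :: "nat \<Rightarrow> ('a list \<Rightarrow> 'r) \<Rightarrow> 'b"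
  assumes surj_of_int: "surj (of_int :: int \<Rightarrow> 'r)"
    and t_in: "t \<in> X"
    and gcar_eq: "gcar R n = \<kappa> n ` homogeneous X n"
    and zero_eq: "\<one>\<^bsub>gcomp R n\<^esub> = \<kappa> n (\<lambda>w. 0)"
    and add_eq: "\<lbrakk>f \<in> homogeneous X n; g \<in> homogeneous X n\<rbrakk> \<Longrightarrow>
      \<kappa> n f \<otimes>\<^bsub>gcomp R n\<^esub> \<kappa> n g = \<kappa> n (\<lambda>w. f w + g w)"
    and prod_eq: "\<lbrakk>f \<in> homogeneous X n; g \<in> homogeneous X m\<rbrakk> \<Longrightarrow>
      gprod R n m (\<kappa> n f) (\<kappa> m g) = \<kappa> (n + m) (conv f g)"
    and unit_eq: "gunit R = \<kappa> 0 (word [])"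
    and top_eq: "gtop R n = \<kappa> n (word (replicate n t))"
    and double: "f \<in> homogeneous X n \<Longrightarrow> \<kappa> n (\<lambda>w. f w + f w) = \<kappa> n (\<lambda>w. 0)"
    and generators_commute: "\<lbrakk>x \<in> X; y \<in> X\<rbrakk> \<Longrightarrow> \<kappa> 2 (word [x, y]) = \<kappa> 2 (word [y, x])"
    and degree_zero: "\<lbrakk>f \<in> homogeneous X 0; g \<in> homogeneous X 0\<rbrakk> \<Longrightarrow>
      \<kappa> 0 f = \<kappa> 0 g \<longleftrightarrow> c (f []) = c (g [])"
begin

text \<open>By \<open>prod_eq\<close> the class of a product depends only on the classes of the
  factors, which replaces any description of the kernel of \<open>\<kappa>\<close>.\<close>

lemma prod_cong:
  assumes "\<kappa> n f = \<kappa> n f'" "\<kappa> m g = \<kappa> m g'"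
    and "f \<in> homogeneous X n" "f' \<in> homogeneous X n" "g \<in> homogeneous X m" "g' \<in> homogeneous X m"
  shows "\<kappa> (n + m) (conv f g) = \<kappa> (n + m) (conv f' g')"
proof -
  have "\<kappa> (n + m) (conv f g) = gprod R n m (\<kappa> n f) (\<kappa> m g)" by (rule prod_eq[symmetric]; fact)
  also have "\<dots> = \<kappa> (n + m) (conv f' g')" unfolding assms(1,2) by (rule prod_eq; fact)
  finally show ?thesis .
qed

lemma add_cong:
  assumes "\<kappa> n f = \<kappa> n f'" "\<kappa> n g = \<kappa> n g'"
    and "f \<in> homogeneous X n" "f' \<in> homogeneous X n" "g \<in> homogeneous X n" "g' \<in> homogeneous X n"
  shows "\<kappa> n (\<lambda>w. f w + g w) = \<kappa> n (\<lambda>w. f' w + g' w)"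
  using assms add_eq by metis

lemma kappa_uminus:
  assumes f: "f \<in> homogeneous X n"
  shows "\<kappa> n (\<lambda>w. - f w) = \<kappa> n f"
proof -
  note mf = uminus_homogeneous[OF f]
  have "\<kappa> n (\<lambda>w. 0 + - f w) = \<kappa> n (\<lambda>w. (f w + f w) + - f w)"
    by (rule add_cong[OF double[OF f, symmetric] refl zero_homogeneous add_homogeneous[OF f f] mf mf])
  then show ?thesis by simp
qed

lemma word_cong:
  assumes "\<kappa> (length u) (word u) = \<kappa> (length u') (word u')" "length u = length u'"
    and "\<kappa> (length v) (word v) = \<kappa> (length v') (word v')" "length v = length v'"
    and "u \<in> lists X" "u' \<in> lists X" "v \<in> lists X" "v' \<in> lists X"
  shows "\<kappa> (length u + length v) (word (u @ v)) = \<kappa> (length u + length v) (word (u' @ v'))"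
  unfolding conv_word_word[symmetric]
  by (rule prod_cong) (use assms word_homogeneous in metis)+

text \<open>Commuting adjacent letters carries the first letter to the end. In this way the degree 2
  assumption \<open>generators_commute\<close> reaches words of every length.\<close>

lemma word_move:
  assumes "x \<in> X" "u \<in> lists X"
  shows "\<kappa> (Suc (length u)) (word (x # u)) = \<kappa> (Suc (length u)) (word (u @ [x]))"
  using assms(2)
proof (induction u rule: list.induct)
  case Nil then show ?case by simp
next
  case (Cons y u)
  then have y: "y \<in> X" "u \<in> lists X" by auto
  have "\<kappa> (length [x, y] + length u) (word ([x, y] @ u)) = \<kappa> (length [x, y] + length u) (word ([y, x] @ u))"
    (is "?l = ?r") by (rule word_cong) (use y assms(1) generators_commute[of x y] in \<open>simp_all add: numeral_2_eq_2\<close>)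
  also have "?r = \<kappa> (length [y] + length (x # u)) (word ([y] @ (x # u)))" by simp
  also have "\<dots> =
      \<kappa> (length [y] + length (x # u)) (word ([y] @ (u @ [x])))"
    by (rule word_cong) (use y assms(1) Cons.IH[OF y(2)] in simp_all)
  finally show ?case by simp
qed

lemma word_commute:
  assumes "u \<in> lists X" "v \<in> lists X"
  shows "\<kappa> (length u + length v) (word (u @ v)) = \<kappa> (length u + length v) (word (v @ u))"
  using assms
proof (induction u arbitrary: v rule: list.induct)
  case Nil then show ?case by simp
next
  case (Cons x u)
  then have x: "x \<in> X" "u \<in> lists X" "v @ [x] \<in> lists X" "u @ v \<in> lists X" by auto
  show ?case
    using word_move[OF x(1,4)] Cons.IH[OF x(2,3)] by simp
qed

text \<open>Both sides are biadditive, so one induction for \<open>f\<close> with another one for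
  \<open>g\<close> inside reduces the claim to words.\<close>

lemma conv_commute:
  assumes "f \<in> homogeneous X n" "g \<in> homogeneous X m"
  shows "\<kappa> (n + m) (conv f g) = \<kappa> (n + m) (conv g f)"
proof -
  note H = conv_homogeneous[OF _ assms(2)] conv_homogeneous[OF assms(2), of _ n, unfolded add.commute[of m]]
  show ?thesis
    using assms(1) surj_of_int
  proof (induction rule: homogeneous_induct)
    case zero then show ?case by (simp add: conv_zero_left conv_zero_right)
  next
    case (add f f')
    then show ?case using add_cong[OF add(3,4) H(1)[OF add(1)] H(2)[OF add(1)] H(1)[OF add(2)] H(2)[OF add(2)]]
      by (simp add: conv_add_left conv_add_right)
  next
    case (uminus f)
    then show ?case using kappa_uminus[OF H(1)] kappa_uminus[OF H(2)]
      by (simp add: conv_uminus_left conv_uminus_right)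
  next
    case (word u)
    have u: "word u \<in> homogeneous X n" using word word_homogeneous[of u X] by simp
    note H' = conv_homogeneous[OF u] conv_homogeneous[OF _ u, of _ m, unfolded add.commute[of m]]
    from assms(2) surj_of_int show ?case
    proof (induction rule: homogeneous_induct)
      case zero then show ?case by (simp add: conv_zero_left conv_zero_right)
    next
      case (add f f')
      then show ?case using add_cong[OF add(3,4) H'(1)[OF add(1)] H'(2)[OF add(1)] H'(1)[OF add(2)] H'(2)[OF add(2)]]
        by (simp add: conv_add_left conv_add_right)
    next
      case (uminus f)
      then show ?case using kappa_uminus[OF H'(1)] kappa_uminus[OF H'(2)]
        by (simp add: conv_uminus_left conv_uminus_right)
    next
      case (word v)
      then show ?case using word_commute[OF \<open>u \<in> lists X\<close>, of v] \<open>length u = n\<close>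
        by (simp add: conv_word_word)
    qed
  qed
qed

section \<open>The axioms of an inductive graded ring\<close>

lemma gcarE:
  assumes "x \<in> gcar R n"
  obtains f where "f \<in> homogeneous X n" "x = \<kappa> n f"
  using assms gcar_eq by auto

lemma kappa_closed: "f \<in> homogeneous X n \<Longrightarrow> \<kappa> n f \<in> gcar R n"
  using gcar_eq by auto

lemma comm_group_gcomp: "comm_group (gcomp R n)"
proof (rule comm_groupI)
  fix x assume "x \<in> gcar R n"
  then obtain f where f: "f \<in> homogeneous X n" "x = \<kappa> n f" by (rule gcarE)
  then show "\<exists>y\<in>gcar R n. y \<otimes>\<^bsub>gcomp R n\<^esub> x = \<one>\<^bsub>gcomp R n\<^esub>"
    using kappa_closed[OF f(1)] by (intro bexI[of _ x]) (simp_all only: f(2) add_eq[OF f(1) f(1)] double[OF f(1)] zero_eq)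
  show "\<one>\<^bsub>gcomp R n\<^esub> \<otimes>\<^bsub>gcomp R n\<^esub> x = x"
    using f by (simp add: zero_eq add_eq zero_homogeneous)
  fix y assume "y \<in> gcar R n"
  then obtain g where g: "g \<in> homogeneous X n" "y = \<kappa> n g" by (rule gcarE)
  show "x \<otimes>\<^bsub>gcomp R n\<^esub> y \<in> gcar R n"
    using f g kappa_closed[OF add_homogeneous[OF f(1) g(1)]] by (simp add: add_eq)
  show "x \<otimes>\<^bsub>gcomp R n\<^esub> y = y \<otimes>\<^bsub>gcomp R n\<^esub> x"
    using f g by (simp add: add_eq add.commute)
  fix z assume "z \<in> gcar R n"
  then obtain h where h: "h \<in> homogeneous X n" "z = \<kappa> n h" by (rule gcarE)
  show "x \<otimes>\<^bsub>gcomp R n\<^esub> y \<otimes>\<^bsub>gcomp R n\<^esub> z = x \<otimes>\<^bsub>gcomp R n\<^esub> (y \<otimes>\<^bsub>gcomp R n\<^esub> z)"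
    using f g h by (simp add: add_eq add_homogeneous add.assoc)
qed (auto simp: zero_eq intro: kappa_closed zero_homogeneous)

lemma commutative_graded_ring: "commutative_graded_ring R"
  unfolding commutative_graded_ring_def
proof (intro conjI allI ballI)
  show "comm_group (gcomp R n)" for n by (rule comm_group_gcomp)
  show "gunit R \<in> gcar R 0"
    using kappa_closed[OF word_homogeneous[of "[]" X]] by (simp add: unit_eq)
next
  fix n m x y assume "x \<in> gcar R n" "y \<in> gcar R m"
  then obtain f g where "f \<in> homogeneous X n" "x = \<kappa> n f" "g \<in> homogeneous X m" "y = \<kappa> m g"
    by (elim gcarE)
  then show "gprod R n m x y \<in> gcar R (n + m)" "gprod R n m x y = gprod R m n y x"
    using conv_commute[of f n g m] by (auto simp: prod_eq conv_homogeneous add.commute intro: kappa_closed)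
next
  fix n m x x' y assume "x \<in> gcar R n" "x' \<in> gcar R n" "y \<in> gcar R m"
  then obtain f f' g where "f \<in> homogeneous X n" "x = \<kappa> n f" "f' \<in> homogeneous X n" "x' = \<kappa> n f'"
    "g \<in> homogeneous X m" "y = \<kappa> m g"
    by (elim gcarE)
  then show "gprod R n m (x \<otimes>\<^bsub>gcomp R n\<^esub> x') y =
      gprod R n m x y \<otimes>\<^bsub>gcomp R (n + m)\<^esub> gprod R n m x' y"
    by (simp add: add_eq prod_eq add_homogeneous conv_homogeneous conv_add_left)
next
  fix n m x y y' assume "x \<in> gcar R n" "y \<in> gcar R m" "y' \<in> gcar R m"
  then obtain f g g' where "f \<in> homogeneous X n" "x = \<kappa> n f" "g \<in> homogeneous X m" "y = \<kappa> m g"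
    "g' \<in> homogeneous X m" "y' = \<kappa> m g'"
    by (elim gcarE)
  then show "gprod R n m x (y \<otimes>\<^bsub>gcomp R m\<^esub> y') =
      gprod R n m x y \<otimes>\<^bsub>gcomp R (n + m)\<^esub> gprod R n m x y'"
    by (simp add: add_eq prod_eq add_homogeneous conv_homogeneous conv_add_right)
next
  fix n m k x y z assume "x \<in> gcar R n" "y \<in> gcar R m" "z \<in> gcar R k"
  then obtain f g h where "f \<in> homogeneous X n" "x = \<kappa> n f" "g \<in> homogeneous X m" "y = \<kappa> m g"
    "h \<in> homogeneous X k" "z = \<kappa> k h"
    by (elim gcarE)
  then show "gprod R (n + m) k (gprod R n m x y) z = gprod R n (m + k) x (gprod R m k y z)"
    by (simp add: prod_eq conv_homogeneous conv_assoc add.assoc)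
next
  fix n x assume "x \<in> gcar R n"
  then obtain f where f: "f \<in> homogeneous X n" "x = \<kappa> n f" by (rule gcarE)
  have "word [] \<in> homogeneous X 0" using word_homogeneous[of "[]" X] by simp
  then show "gprod R 0 n (gunit R) x = x" "gprod R n 0 x (gunit R) = x"
    using f prod_eq[of "word []" 0 f n] prod_eq[of f n "word []" 0]
    by (simp_all add: unit_eq conv_one_left conv_one_right)
qed

lemma replicate_homogeneous: "word (replicate n t) \<in> homogeneous X n"
  using word_homogeneous[of "replicate n t" X] t_in by (simp add: in_lists_conv_set)

lemma gh_iter_kappa:
  assumes "f \<in> homogeneous X n"
  shows "gh_iter R n k (\<kappa> n f) = \<kappa> (n + k) (conv (word (replicate k t)) f)"
proof (induction k)
  case 0 then show ?case by (simp add: conv_one_left)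
next
  case (Suc k)
  have "conv (word (replicate k t)) f \<in> homogeneous X (n + k)"
    using conv_homogeneous[OF replicate_homogeneous assms, of k] by (simp add: add.commute)
  then have "gh R (n + k) (\<kappa> (n + k) (conv (word (replicate k t)) f)) =
      \<kappa> (1 + (n + k)) (conv (word [t]) (conv (word (replicate k t)) f))"
    unfolding gh_def top_eq using prod_eq[OF replicate_homogeneous[of 1]] by simp
  then show ?case
    using Suc by (simp add: conv_assoc[symmetric] conv_word_word)
qed

lemma inductive_graded_ring: "inductive_graded_ring R"
  unfolding inductive_graded_ring_def
proof (intro conjI allI ballI impI)
  show "commutative_graded_ring R" by (rule commutative_graded_ring)
  show "gtop R n \<in> gcar R n" for n unfolding top_eq by (rule kappa_closed[OF replicate_homogeneous])
next
  fix n x assume "x \<in> gcar R n"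
  then obtain f where f: "f \<in> homogeneous X n" "x = \<kappa> n f" by (rule gcarE)
  then show "x \<otimes>\<^bsub>gcomp R n\<^esub> x = \<one>\<^bsub>gcomp R n\<^esub>"
    by (simp only: f(2) add_eq[OF f(1) f(1)] double[OF f(1)] zero_eq)
next
  \<comment> \<open>A homogeneous element of degree 0 is a constant, and \<open>degree_zero\<close>
    says that its class remembers exactly the value of that constant under \<open>c\<close>. The
    choice of representative is therefore immaterial.\<close>
  define rep where "rep x = (SOME f. f \<in> homogeneous X 0 \<and> x = \<kappa> 0 f)" for x
  define \<phi> where "\<phi> x = c (rep x [])" for x
  have \<phi>: "\<phi> (\<kappa> 0 f) = c (f [])" if f: "f \<in> homogeneous X 0" for f
  proof -
    have "rep (\<kappa> 0 f) \<in> homogeneous X 0 \<and> \<kappa> 0 f = \<kappa> 0 (rep (\<kappa> 0 f))"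
      unfolding rep_def by (rule someI[of _ f]) (use f in simp)
    then show ?thesis unfolding \<phi>_def using degree_zero f by metis
  qed
  have one: "word [] \<in> homogeneous X 0" using word_homogeneous[of "[]" X] by simp
  have "\<phi> (gunit R) = 1" using \<phi>[OF one] by (simp add: unit_eq word_def c_one)
  moreover have "\<phi> (x \<otimes>\<^bsub>gcomp R 0\<^esub> y) = \<phi> x + \<phi> y \<and> \<phi> (gprod R 0 0 x y) = \<phi> x * \<phi> y"
    if xy: "x \<in> gcar R 0" "y \<in> gcar R 0" for x y
  proof -
    obtain f g where fg: "f \<in> homogeneous X 0" "x = \<kappa> 0 f" "g \<in> homogeneous X 0" "y = \<kappa> 0 g"
      using xy by (elim gcarE)
    have "conv f g \<in> homogeneous X 0" using conv_homogeneous[OF fg(1,3)] by simp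
    then show ?thesis
      using fg prod_eq[of f 0 g 0] \<phi>[of "conv f g"]
      by (simp add: \<phi> add_eq add_homogeneous c_add c_mult conv_Nil)
  qed
  moreover have "bij_betw \<phi> (gcar R 0) UNIV"
    unfolding bij_betw_def
  proof
    show "inj_on \<phi> (gcar R 0)"
    proof (rule inj_onI)
      fix x y assume xy: "x \<in> gcar R 0" "y \<in> gcar R 0" "\<phi> x = \<phi> y"
      then obtain f g where fg: "f \<in> homogeneous X 0" "x = \<kappa> 0 f" "g \<in> homogeneous X 0" "y = \<kappa> 0 g"
        by (elim gcarE)
      then show "x = y" using xy(3) \<phi> degree_zero by simp
    qed
    have "0 = \<phi> (\<kappa> 0 (\<lambda>w. 0))" "1 = \<phi> (\<kappa> 0 (word []))"
      using \<phi>[OF zero_homogeneous] \<phi>[OF one] by (simp_all add: c_zero c_one word_def)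
    then have "b \<in> \<phi> ` gcar R 0" for b
      using kappa_closed[OF zero_homogeneous[of X 0]] kappa_closed[OF one] by (cases b) auto
    then show "\<phi> ` gcar R 0 = UNIV" by auto
  qed
  ultimately show "\<exists>\<phi> :: 'b \<Rightarrow> bit. bij_betw \<phi> (gcar R 0) UNIV \<and> \<phi> (gunit R) = 1 \<and>
      (\<forall>x\<in>gcar R 0. \<forall>y\<in>gcar R 0.
        \<phi> (x \<otimes>\<^bsub>gcomp R 0\<^esub> y) = \<phi> x + \<phi> y \<and> \<phi> (gprod R 0 0 x y) = \<phi> x * \<phi> y)"
    by blast
next
  have t: "word [t] \<in> homogeneous X 1" using replicate_homogeneous[of 1] by simp
  have gh: "gh R n (\<kappa> n f) = \<kappa> (Suc n) (conv (word [t]) f)" if "f \<in> homogeneous X n" for n f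
    unfolding gh_def top_eq using prod_eq[OF t that] by simp
  fix n
  show "gh R n \<in> hom (gcomp R n) (gcomp R (Suc n))"
  proof (rule homI)
    fix x assume "x \<in> gcar R n"
    then obtain f where f: "f \<in> homogeneous X n" "x = \<kappa> n f" by (rule gcarE)
    note cf = conv_homogeneous[OF t, of _ n, simplified]
    show "gh R n x \<in> gcar R (Suc n)"
      using f kappa_closed[OF cf[OF f(1)]] by (simp add: gh)
    fix y assume "y \<in> gcar R n"
    then obtain g where g: "g \<in> homogeneous X n" "y = \<kappa> n g" by (rule gcarE)
    show "gh R n (x \<otimes>\<^bsub>gcomp R n\<^esub> y) = gh R n x \<otimes>\<^bsub>gcomp R (Suc n)\<^esub> gh R n y"
      using f g by (simp add: gh add_eq add_homogeneous cf conv_add_right)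
  qed
  show "gh R n (gtop R n) = gtop R (Suc n)"
    unfolding top_eq gh[OF replicate_homogeneous] by (simp add: conv_word_word)
next
  fix n m p q :: nat and x y
  assume le: "n \<le> p" "m \<le> q" and "x \<in> gcar R n" "y \<in> gcar R m"
  then obtain f g where f: "f \<in> homogeneous X n" "x = \<kappa> n f" and g: "g \<in> homogeneous X m" "y = \<kappa> m g"
    by (elim gcarE)
  define T where "T k = (word (replicate k t) :: 'a list \<Rightarrow> 'r)" for k
  have T: "T k \<in> homogeneous X k" for k unfolding T_def by (rule replicate_homogeneous)
  have TT: "conv (T i) (T j) = T (i + j)" for i j
    by (simp add: T_def conv_word_word replicate_add)
  obtain i j where ij: "p = n + i" "q = m + j" using le by (auto simp: le_iff_add)
  have Tf: "conv (T i) f \<in> homogeneous X p" and Tg: "conv (T j) g \<in> homogeneous X q"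
    using conv_homogeneous[OF T f(1), of i] conv_homogeneous[OF T g(1), of j] by (simp_all add: ij add.commute)
  have fT: "conv f (T j) \<in> homogeneous X (n + j)" and Tf': "conv (T j) f \<in> homogeneous X (n + j)"
    using conv_homogeneous[OF f(1) T, of j] conv_homogeneous[OF T f(1), of j] by (simp_all add: add.commute)
  have "gprod R p q (gh_iter R n (p - n) x) (gh_iter R m (q - m) y) = \<kappa> (p + q) (conv (conv (T i) f) (conv (T j) g))"
    using gh_iter_kappa[OF f(1), of i] gh_iter_kappa[OF g(1), of j] prod_eq[OF Tf Tg]
    by (simp add: f g ij T_def)
  also have "\<dots> = \<kappa> (i + ((n + j) + m)) (conv (T i) (conv (conv f (T j)) g))"
    by (simp add: conv_assoc ij ac_simps)
  \<comment> \<open>Graded commutativity moves the power \<open>T j\<close> past \<open>f\<close>,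
    so that both powers of \<open>t\<close> meet in front of the product.\<close>
  also have "\<dots> = \<kappa> (i + ((n + j) + m)) (conv (T i) (conv (conv (T j) f) g))"
    using conv_homogeneous[OF fT g(1)] conv_homogeneous[OF Tf' g(1)]
    by (intro prod_cong[OF refl] prod_cong[OF conv_commute[OF f(1) T, of j] refl])
      (simp_all add: T fT Tf' g)
  also have "\<dots> = \<kappa> ((n + m) + (i + j)) (conv (T (i + j)) (conv f g))"
    by (simp add: TT[symmetric] conv_assoc ac_simps)
  also have "\<dots> = gh_iter R (n + m) (i + j) (gprod R n m x y)"
    using gh_iter_kappa[OF conv_homogeneous[OF f(1) g(1)], of "i + j"] prod_eq[OF f(1) g(1)]
    by (simp add: f g T_def)
  finally show "gprod R p q (gh_iter R n (p - n) x) (gh_iter R m (q - m) y) =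
      gh_iter R (n + m) ((p + q) - (n + m)) (gprod R n m x y)"
    by (simp add: ij algebra_simps)
qed

end

section \<open>Universal property\<close>

lemma bit_add_self [simp]: "b + b = (0 :: bit)"
  by (cases b) simp_all

declare add_bit_eq_xor [simp del] mult_bit_eq_and [simp del]

fun word_product :: "'b igr \<Rightarrow> ('a \<Rightarrow> 'b) \<Rightarrow> 'a list \<Rightarrow> 'b" where
  "word_product S \<gamma> [] = gunit S"
| "word_product S \<gamma> (x # w) = gprod S 1 (length w) (\<gamma> x) (word_product S \<gamma> w)"

section \<open>Homogeneous parts\<close>

definition part :: "nat \<Rightarrow> ('a list \<Rightarrow> 'r::comm_ring_1) \<Rightarrow> 'a list \<Rightarrow> 'r" where
  "part n f = (\<lambda>w. if length w = n then f w else 0)"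

lemma part_homogeneous:
  assumes "f \<in> carrier (free_algebra X)"
  shows "part n f \<in> homogeneous X n"
proof -
  have "{w. part n f w \<noteq> 0} \<subseteq> {w. f w \<noteq> 0}" by (auto simp: part_def)
  moreover have "finite {w. f w \<noteq> 0}" using assms by simp
  ultimately have "finite {w. part n f w \<noteq> 0}" by (rule finite_subset)
  then show ?thesis using assms by (auto simp: homogeneous_def part_def split: if_splits)
qed

lemma part_of_homogeneous:
  "f \<in> homogeneous X n \<Longrightarrow> part m f = (if m = n then f else (\<lambda>w. 0))"
  by (auto simp: part_def homogeneous_def fun_eq_iff)

lemma part_add: "part n (\<lambda>w. f w + g w) = (\<lambda>w. part n f w + part n g w)"
  by (auto simp: part_def)

lemma part_uminus: "part n (\<lambda>w. - f w) = (\<lambda>w. - part n f w)"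
  by (auto simp: part_def)

text \<open>A left factor of degree \<open>d\<close> allows only the cut at position
  \<open>d\<close>, so selecting words of length \<open>n\<close> in the product selects words of
  length \<open>n - d\<close> in \<open>f\<close>.\<close>

lemma part_conv_left:
  assumes "a \<in> homogeneous X d"
  shows "part n (conv a f) = (if d \<le> n then conv a (part (n - d) f) else (\<lambda>w. 0))"
proof
  fix w
  have zero: "a (take k w) = 0 \<or> k = d" if "k \<le> length w" for k
    using assms that by (auto simp: homogeneous_def)
  have "a (take k w) * g (drop k w) = (if k = d then a (take d w) * g (drop d w) else 0)"
    if "k \<le> length w" for k g
    using zero[OF that] by auto
  then have "conv a g w = (\<Sum>k\<le>length w. if k = d then a (take d w) * g (drop d w) else 0)" for g
    unfolding conv_def by (intro sum.cong) auto
  then have conv: "conv a g w = (if d \<le> length w then a (take d w) * g (drop d w) else 0)" for g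
    by simp
  show "part n (conv a f) w = (if d \<le> n then conv a (part (n - d) f) else (\<lambda>w. 0)) w"
    by (auto simp: part_def conv)
qed

lemma part_conv_right:
  assumes "a \<in> homogeneous X d"
  shows "part n (conv f a) = (if d \<le> n then conv (part (n - d) f) a else (\<lambda>w. 0))"
proof
  fix w
  \<comment> \<open>For a word shorter than \<open>d\<close> the truncated difference
    \<open>length w - d\<close> is 0 without being a cut of the required kind; the conjunct
    \<open>d \<le> length w\<close> rules this out.\<close>
  have zero: "a (drop k w) = 0 \<or> d \<le> length w \<and> k = length w - d" if "k \<le> length w" for k
    using assms that by (auto simp: homogeneous_def)
  have "g (take k w) * a (drop k w) = (if k = length w - d then
      (if d \<le> length w then g (take k w) * a (drop k w) else 0) else 0)" if "k \<le> length w" for k g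
    using zero[OF that] by auto
  then have "conv g a w = (\<Sum>k\<le>length w. if k = length w - d then
      (if d \<le> length w then g (take k w) * a (drop k w) else 0) else 0)" for g
    unfolding conv_def by (intro sum.cong) auto
  then have conv: "conv g a w =
      (if d \<le> length w then g (take (length w - d) w) * a (drop (length w - d) w) else 0)" for g
    by simp
  show "part n (conv f a) w = (if d \<le> n then conv (part (n - d) f) a else (\<lambda>w. 0)) w"
    by (auto simp: part_def conv)
qed

text \<open>An element of the free algebra is the finite sum of its homogeneous parts;
  \<open>trunc N\<close> collects the degrees below \<open>N\<close>.\<close>

lemma carrier_induct [consumes 1, case_names homogeneous add]:
  fixes f :: "'a list \<Rightarrow> 'r::comm_ring_1"
  assumes f: "f \<in> carrier (free_algebra X)"
    and hom: "\<And>n f. f \<in> homogeneous X n \<Longrightarrow> P f"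
    and add: "\<And>f g. f \<in> carrier (free_algebra X) \<Longrightarrow> g \<in> carrier (free_algebra X) \<Longrightarrow>
      P f \<Longrightarrow> P g \<Longrightarrow> P (\<lambda>w. f w + g w)"
  shows "P f"
proof -
  define trunc where "trunc N = (\<lambda>w. if length w < N then f w else 0)" for N
  have trunc: "trunc N \<in> carrier (free_algebra X)" for N
  proof -
    have "{w. trunc N w \<noteq> 0} \<subseteq> {w. f w \<noteq> 0}" by (auto simp: trunc_def)
    moreover have "finite {w. f w \<noteq> 0}" using f by simp
    ultimately have "finite {w. trunc N w \<noteq> 0}" by (rule finite_subset)
    then show ?thesis using f by (auto simp: trunc_def split: if_splits)
  qed
  have part: "part n f \<in> carrier (free_algebra X)" for n
    using part_homogeneous[OF f] by (simp add: homogeneous_def)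
  have "P (trunc N)" for N
  proof (induction N)
    case 0
    then show ?case using hom[OF zero_homogeneous] by (simp add: trunc_def)
  next
    case (Suc N)
    have "trunc (Suc N) = (\<lambda>w. trunc N w + part N f w)"
      by (auto simp: trunc_def part_def)
    then show ?case using add[OF trunc part Suc hom[OF part_homogeneous[OF f]]] by simp
  qed
  \<comment> \<open>\<open>Suc\<close> is needed because \<open>trunc\<close> uses a strict bound,
    and \<open>insert 0\<close> keeps \<open>Max\<close> meaningful when \<open>f\<close> is
    zero.\<close>
  moreover have "trunc (Suc (Max (insert 0 (length ` {w. f w \<noteq> 0})))) = f"
  proof
    fix w
    have "finite (insert 0 (length ` {w. f w \<noteq> 0}))" using f by simp
    then show "trunc (Suc (Max (insert 0 (length ` {w. f w \<noteq> 0})))) w = f w"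
      by (auto simp: trunc_def less_Suc_eq_le intro!: Max_ge)
  qed
  ultimately show ?thesis by metis
qed

text \<open>The axioms of \<open>inductive_graded_ring\<close> do not tie \<open>gtop S 0\<close> to
  the unit, yet the empty word, being the zeroth power of the letter for \<open>-1\<close>, has to
  go to both. Hence \<open>top_zero\<close> is assumed.\<close>

locale igr_target =
  fixes S :: "'b igr" and X :: "'a set" and \<gamma> :: "'a \<Rightarrow> 'b"
  assumes igr: "inductive_graded_ring S" and top_zero: "gtop S 0 = gunit S"
    and gamma: "x \<in> X \<Longrightarrow> \<gamma> x \<in> gcar S 1"
begin

lemma graded: "commutative_graded_ring S"
  and exponent_two: "x \<in> gcar S n \<Longrightarrow> x \<otimes>\<^bsub>gcomp S n\<^esub> x = \<one>\<^bsub>gcomp S n\<^esub>"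
  and gh_top: "gh S n (gtop S n) = gtop S (Suc n)"
  using igr unfolding inductive_graded_ring_def by simp_all

lemma group: "comm_group (gcomp S n)"
  and prod_closed: "x \<in> gcar S n \<Longrightarrow> y \<in> gcar S m \<Longrightarrow> gprod S n m x y \<in> gcar S (n + m)"
  and prod_add_left: "x \<in> gcar S n \<Longrightarrow> x' \<in> gcar S n \<Longrightarrow> y \<in> gcar S m \<Longrightarrow>
    gprod S n m (x \<otimes>\<^bsub>gcomp S n\<^esub> x') y = gprod S n m x y \<otimes>\<^bsub>gcomp S (n + m)\<^esub> gprod S n m x' y"
  and prod_add_right: "x \<in> gcar S n \<Longrightarrow> y \<in> gcar S m \<Longrightarrow> y' \<in> gcar S m \<Longrightarrow>
    gprod S n m x (y \<otimes>\<^bsub>gcomp S m\<^esub> y') = gprod S n m x y \<otimes>\<^bsub>gcomp S (n + m)\<^esub> gprod S n m x y'"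
  and prod_assoc: "x \<in> gcar S n \<Longrightarrow> y \<in> gcar S m \<Longrightarrow> z \<in> gcar S k \<Longrightarrow>
    gprod S (n + m) k (gprod S n m x y) z = gprod S n (m + k) x (gprod S m k y z)"
  and unit_closed: "gunit S \<in> gcar S 0"
  and prod_unit_left: "x \<in> gcar S n \<Longrightarrow> gprod S 0 n (gunit S) x = x"
  and prod_unit_right: "x \<in> gcar S n \<Longrightarrow> gprod S n 0 x (gunit S) = x"
proof -
  note g = graded[unfolded commutative_graded_ring_def]
  have "\<forall>n. comm_group (gcomp S n)"
    by (insert g, elim conjE, assumption)
  then show "comm_group (gcomp S n)" ..
  have "\<forall>n m. \<forall>x\<in>gcar S n. \<forall>y\<in>gcar S m. gprod S n m x y \<in> gcar S (n + m)"
    by (insert g, elim conjE, assumption)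
  then show "x \<in> gcar S n \<Longrightarrow> y \<in> gcar S m \<Longrightarrow> gprod S n m x y \<in> gcar S (n + m)" by blast
  have "\<forall>n m. \<forall>x\<in>gcar S n. \<forall>x'\<in>gcar S n. \<forall>y\<in>gcar S m.
      gprod S n m (x \<otimes>\<^bsub>gcomp S n\<^esub> x') y = gprod S n m x y \<otimes>\<^bsub>gcomp S (n + m)\<^esub> gprod S n m x' y"
    by (insert g, elim conjE, assumption)
  then show "x \<in> gcar S n \<Longrightarrow> x' \<in> gcar S n \<Longrightarrow> y \<in> gcar S m \<Longrightarrow>
      gprod S n m (x \<otimes>\<^bsub>gcomp S n\<^esub> x') y = gprod S n m x y \<otimes>\<^bsub>gcomp S (n + m)\<^esub> gprod S n m x' y"
    by blast
  have "\<forall>n m. \<forall>x\<in>gcar S n. \<forall>y\<in>gcar S m. \<forall>y'\<in>gcar S m.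
      gprod S n m x (y \<otimes>\<^bsub>gcomp S m\<^esub> y') = gprod S n m x y \<otimes>\<^bsub>gcomp S (n + m)\<^esub> gprod S n m x y'"
    by (insert g, elim conjE, assumption)
  then show "x \<in> gcar S n \<Longrightarrow> y \<in> gcar S m \<Longrightarrow> y' \<in> gcar S m \<Longrightarrow>
      gprod S n m x (y \<otimes>\<^bsub>gcomp S m\<^esub> y') = gprod S n m x y \<otimes>\<^bsub>gcomp S (n + m)\<^esub> gprod S n m x y'"
    by blast
  have "\<forall>n m k. \<forall>x\<in>gcar S n. \<forall>y\<in>gcar S m. \<forall>z\<in>gcar S k.
      gprod S (n + m) k (gprod S n m x y) z = gprod S n (m + k) x (gprod S m k y z)"
    by (insert g, elim conjE, assumption)
  then show "x \<in> gcar S n \<Longrightarrow> y \<in> gcar S m \<Longrightarrow> z \<in> gcar S k \<Longrightarrow>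
      gprod S (n + m) k (gprod S n m x y) z = gprod S n (m + k) x (gprod S m k y z)" by blast
  show "gunit S \<in> gcar S 0"
    by (insert g, elim conjE, assumption)
  have "\<forall>n. \<forall>x\<in>gcar S n. gprod S 0 n (gunit S) x = x \<and> gprod S n 0 x (gunit S) = x"
    by (insert g, elim conjE, assumption)
  then show "x \<in> gcar S n \<Longrightarrow> gprod S 0 n (gunit S) x = x"
    "x \<in> gcar S n \<Longrightarrow> gprod S n 0 x (gunit S) = x" by blast+
qed

lemma one_one: "\<one>\<^bsub>gcomp S n\<^esub> \<otimes>\<^bsub>gcomp S n\<^esub> \<one>\<^bsub>gcomp S n\<^esub> = \<one>\<^bsub>gcomp S n\<^esub>"
proof -
  interpret n: comm_group "gcomp S n" by (rule group)
  show ?thesis by simp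
qed

lemma word_product_closed: "w \<in> lists X \<Longrightarrow> word_product S \<gamma> w \<in> gcar S (length w)"
proof (induction w rule: list.induct)
  case (Cons x w)
  then show ?case using prod_closed[of "\<gamma> x" 1 "word_product S \<gamma> w" "length w"] gamma by simp
qed (simp add: unit_closed)

lemma word_product_append:
  assumes "v \<in> lists X"
  shows "u \<in> lists X \<Longrightarrow> word_product S \<gamma> (u @ v) =
    gprod S (length u) (length v) (word_product S \<gamma> u) (word_product S \<gamma> v)"
proof (induction u rule: list.induct)
  case Nil
  then show ?case using prod_unit_left word_product_closed[OF assms] by simp
next
  case (Cons x u)
  then show ?case
    using prod_assoc[of "\<gamma> x" 1 "word_product S \<gamma> u" "length u" "word_product S \<gamma> v" "length v"]
      gamma word_product_closed assms by simp
qed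

lemma word_product_singleton: "x \<in> X \<Longrightarrow> word_product S \<gamma> [x] = \<gamma> x"
  using prod_unit_right gamma by simp

lemma word_product_pair: "x \<in> X \<Longrightarrow> y \<in> X \<Longrightarrow> word_product S \<gamma> [x, y] = gprod S 1 1 (\<gamma> x) (\<gamma> y)"
  using prod_unit_right gamma by simp

lemma word_product_replicate:
  assumes "\<gamma> t = gtop S 1"
  shows "word_product S \<gamma> (replicate n t) = gtop S n"
proof (induction n)
  case (Suc n)
  then show ?case using gh_top[of n] assms by (simp add: gh_def)
qed (simp add: top_zero)

text \<open>The \<open>\<one>\<close> of a component is its zero, so these are absorption laws;
  biadditivity applied to \<open>0 + 0 = 0\<close> and cancellation give them.\<close>

lemma prod_one_left: "y \<in> gcar S m \<Longrightarrow> gprod S n m \<one>\<^bsub>gcomp S n\<^esub> y = \<one>\<^bsub>gcomp S (n + m)\<^esub>"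
  and prod_one_right: "y \<in> gcar S m \<Longrightarrow> gprod S m n y \<one>\<^bsub>gcomp S n\<^esub> = \<one>\<^bsub>gcomp S (m + n)\<^esub>"
proof -
  interpret n: comm_group "gcomp S n" by (rule group)
  assume y: "y \<in> gcar S m"
  interpret nm: comm_group "gcomp S (n + m)" by (rule group)
  interpret mn: comm_group "gcomp S (m + n)" by (rule group)
  show "gprod S n m \<one>\<^bsub>gcomp S n\<^esub> y = \<one>\<^bsub>gcomp S (n + m)\<^esub>"
    using prod_add_left[OF n.one_closed n.one_closed y] prod_closed[OF n.one_closed y]
    by (simp add: nm.l_cancel_one')
  show "gprod S m n y \<one>\<^bsub>gcomp S n\<^esub> = \<one>\<^bsub>gcomp S (m + n)\<^esub>"
    using prod_add_right[OF y n.one_closed n.one_closed] prod_closed[OF y n.one_closed]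
    by (simp add: mn.l_cancel_one')
qed

text \<open>Over \<open>bit\<close> a linear combination is just the set of words in its support, so
  the linear extension of \<open>word_product\<close> is an unweighted sum over that set. It is a
  \<open>finprod\<close> because components are written multiplicatively.\<close>

definition extend :: "nat \<Rightarrow> ('a list \<Rightarrow> bit) \<Rightarrow> 'b" where
  "extend n f = finprod (gcomp S n) (word_product S \<gamma>) {w. f w \<noteq> 0}"

text \<open>Different elements have different supports; padding with \<open>\<one>\<close> lets
  their extensions be compared over one common index set.\<close>

lemma extend_superset:
  assumes "finite W" "{w. f w \<noteq> 0} \<subseteq> W" "\<And>w. w \<in> W \<Longrightarrow> w \<in> lists X \<and> length w = n"
  shows "extend n f =
    finprod (gcomp S n) (\<lambda>w. if f w = 0 then \<one>\<^bsub>gcomp S n\<^esub> else word_product S \<gamma> w) W"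
proof -
  interpret n: comm_group "gcomp S n" by (rule group)
  have "word_product S \<gamma> w \<in> gcar S n" if "w \<in> W" for w
    using word_product_closed[of w] assms(3)[OF that] by auto
  then show ?thesis unfolding extend_def
    by (intro n.finprod_mono_neutral_cong_left) (use assms(1,2) in auto)
qed

lemma homogeneousD: "f \<in> homogeneous X n \<Longrightarrow> f w \<noteq> 0 \<Longrightarrow> w \<in> lists X \<and> length w = n"
  "f \<in> homogeneous X n \<Longrightarrow> finite {w. f w \<noteq> 0}"
  by (auto simp: homogeneous_def)

lemma word_product_homogeneous:
  assumes "f \<in> homogeneous X n" "f w \<noteq> 0"
  shows "word_product S \<gamma> w \<in> gcar S n"
  using word_product_closed[of w] homogeneousD(1)[OF assms] by auto

lemma extend_closed:
  assumes "f \<in> homogeneous X n" shows "extend n f \<in> gcar S n"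
proof -
  interpret n: comm_group "gcomp S n" by (rule group)
  have "word_product S \<gamma> \<in> {w. f w \<noteq> 0} \<rightarrow> gcar S n"
    using word_product_homogeneous[OF assms] by blast
  then show ?thesis unfolding extend_def by (rule n.finprod_closed)
qed

lemma extend_add:
  assumes f: "f \<in> homogeneous X n" and g: "g \<in> homogeneous X n"
  shows "extend n (\<lambda>w. f w + g w) = extend n f \<otimes>\<^bsub>gcomp S n\<^esub> extend n g"
proof -
  interpret n: comm_group "gcomp S n" by (rule group)
  define W where "W = {w. f w \<noteq> 0} \<union> {w. g w \<noteq> 0}"
  have W: "w \<in> lists X \<and> length w = n" "word_product S \<gamma> w \<in> gcar S n" if "w \<in> W" for w
    using that homogeneousD(1)[OF f] homogeneousD(1)[OF g]
      word_product_homogeneous[OF f] word_product_homogeneous[OF g]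
    unfolding W_def by blast+
  have fin: "finite W" using homogeneousD(2)[OF f] homogeneousD(2)[OF g] unfolding W_def by blast
  define F where "F h w = (if h w = (0 :: bit) then \<one>\<^bsub>gcomp S n\<^esub> else word_product S \<gamma> w)" for h w
  have F: "F h \<in> W \<rightarrow> gcar S n" for h
    using W(2) n.one_closed by (simp add: F_def)
  have ext: "extend n h = finprod (gcomp S n) (F h) W" if "{w. h w \<noteq> 0} \<subseteq> W" for h
    unfolding F_def by (rule extend_superset[OF fin that W(1)])
  \<comment> \<open>If both coefficients are 1 they cancel in \<open>bit\<close>, and the two values
    cancel in \<open>S\<close> because \<open>S\<close> has exponent 2.\<close>
  have pointwise: "F (\<lambda>w. f w + g w) w = F f w \<otimes>\<^bsub>gcomp S n\<^esub> F g w" if "w \<in> W" for w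
    using W(2)[OF that] exponent_two[OF W(2)[OF that]]
    by (cases "f w"; cases "g w") (simp_all add: F_def)
  have "{w. f w + g w \<noteq> 0} \<subseteq> W"
    by (rule subsetI, rule ccontr) (simp add: W_def)
  then have "extend n (\<lambda>w. f w + g w) = finprod (gcomp S n) (F (\<lambda>w. f w + g w)) W"
    by (rule ext)
  also have "\<dots> = finprod (gcomp S n) (\<lambda>w. F f w \<otimes>\<^bsub>gcomp S n\<^esub> F g w) W"
    using F pointwise by (intro n.finprod_cong') auto
  also have "\<dots> = finprod (gcomp S n) (F f) W \<otimes>\<^bsub>gcomp S n\<^esub> finprod (gcomp S n) (F g) W"
    by (rule n.finprod_multf[OF F F])
  also have "\<dots> = extend n f \<otimes>\<^bsub>gcomp S n\<^esub> extend n g"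
    using ext[of f] ext[of g] unfolding W_def by simp
  finally show ?thesis .
qed

lemma extend_zero: "extend n (\<lambda>w. 0) = \<one>\<^bsub>gcomp S n\<^esub>"
proof -
  interpret n: comm_group "gcomp S n" by (rule group)
  show ?thesis by (simp add: extend_def)
qed

lemma extend_word: "w \<in> lists X \<Longrightarrow> extend (length w) (word w) = word_product S \<gamma> w"
proof -
  interpret n: comm_group "gcomp S (length w)" by (rule group)
  assume "w \<in> lists X"
  from word_product_closed[OF this] show ?thesis by (simp add: extend_def word_def)
qed

text \<open>Both sides are biadditive, which leaves concatenation of words; negatives need no
  argument, since negation on \<open>bit\<close> is the identity.\<close>

lemma extend_conv:
  assumes f: "f \<in> homogeneous X n" and g: "g \<in> homogeneous X m"
  shows "extend (n + m) (conv f g) = gprod S n m (extend n f) (extend m g)"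
  using f surj_of_int_bit
proof (induction rule: homogeneous_induct)
  case zero
  then show ?case using prod_one_left extend_closed[OF g] by (simp add: conv_zero_left extend_zero)
next
  case (add f f')
  then show ?case using g
    by (simp add: conv_add_left extend_add conv_homogeneous extend_closed prod_add_left)
next
  case (uminus f)
  then show ?case by simp
next
  case (word u)
  have u: "(word u :: 'a list \<Rightarrow> bit) \<in> homogeneous X n"
    using word_homogeneous[of u X] word(1,2) by simp
  from g surj_of_int_bit show ?case
  proof (induction rule: homogeneous_induct)
    case zero
    then show ?case using prod_one_right extend_closed[OF u] by (simp add: conv_zero_right extend_zero)
  next
    case (add f f')
    then show ?case using u
      by (simp add: conv_add_right extend_add conv_homogeneous extend_closed prod_add_right)
  next
    case (uminus f)
    then show ?case by simp
  next
    case (word v)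
    then show ?case
      using extend_word[of u] extend_word[of v] extend_word[of "u @ v"] word_product_append[of v u]
        \<open>u \<in> lists X\<close> \<open>length u = n\<close> by (simp add: conv_word_word)
  qed
qed

end

locale igr_target_coefficient = igr_target S X \<gamma> + coefficient_map c
  for S :: "'b igr" and X :: "'a set" and \<gamma> and c :: "'r::comm_ring_1 \<Rightarrow> bit"
begin

text \<open>The kernel of the map that \<open>\<gamma>\<close> induces on the whole free algebra, described through homogeneous
  parts because \<open>S\<close> is only given degree by degree.\<close>

definition extend_kernel :: "('a list \<Rightarrow> 'r) set" where
  "extend_kernel = {f \<in> carrier (free_algebra X). \<forall>n. extend n (c \<circ> part n f) = \<one>\<^bsub>gcomp S n\<^esub>}"

lemma c_comp_add: "c \<circ> (\<lambda>w. f w + g w) = (\<lambda>w. (c \<circ> f) w + (c \<circ> g) w)"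
  by (auto simp: c_add)

lemma extend_c_add:
  assumes "f \<in> homogeneous X n" "g \<in> homogeneous X n"
  shows "extend n (c \<circ> (\<lambda>w. f w + g w)) = extend n (c \<circ> f) \<otimes>\<^bsub>gcomp S n\<^esub> extend n (c \<circ> g)"
  unfolding c_comp_add using assms by (intro extend_add c_homogeneous)

lemma c_comp_zero: "c \<circ> (\<lambda>w. 0) = (\<lambda>w. 0)"
  by (auto simp: c_zero)

lemma extend_kernel_homogeneous:
  assumes "f \<in> homogeneous X n"
  shows "f \<in> extend_kernel \<longleftrightarrow> extend n (c \<circ> f) = \<one>\<^bsub>gcomp S n\<^esub>"
  using assms part_of_homogeneous[OF assms]
  by (auto simp: extend_kernel_def c_comp_zero extend_zero homogeneous_def)

lemma extend_kernel_add:
  assumes "f \<in> extend_kernel" "g \<in> extend_kernel"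
  shows "(\<lambda>w. f w + g w) \<in> extend_kernel"
proof -
  have "f \<in> carrier (free_algebra X)" "g \<in> carrier (free_algebra X)"
    using assms unfolding extend_kernel_def by blast+
  then show ?thesis
    using assms add_closed[of f X g] one_one
    by (simp add: extend_kernel_def part_add extend_c_add part_homogeneous
        del: free_algebra_simps)
qed

text \<open>By \<open>carrier_induct\<close> the multiplier may be taken homogeneous of degree
  \<open>d\<close>. Each part of the product is then a product with a single part of
  \<open>f\<close>, to which \<open>extend_conv\<close> applies.\<close>

lemma extend_kernel_conv:
  assumes a: "a \<in> carrier (free_algebra X)" and f: "f \<in> extend_kernel"
  shows "conv a f \<in> extend_kernel" "conv f a \<in> extend_kernel"
proof -
  have fc: "f \<in> carrier (free_algebra X)" and f1: "extend n (c \<circ> part n f) = \<one>\<^bsub>gcomp S n\<^esub>" for n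
    using f unfolding extend_kernel_def by blast+
  note pf = c_homogeneous[OF part_homogeneous[OF fc]]
  from a have "conv a f \<in> extend_kernel \<and> conv f a \<in> extend_kernel"
  proof (induction rule: carrier_induct)
    case (homogeneous d a)
    have ac: "a \<in> carrier (free_algebra X)" using homogeneous by (simp add: homogeneous_def)
    note ca = c_homogeneous[OF homogeneous]
    have "extend n (c \<circ> part n (conv a f)) = \<one>\<^bsub>gcomp S n\<^esub> \<and>
        extend n (c \<circ> part n (conv f a)) = \<one>\<^bsub>gcomp S n\<^esub>" for n
    proof (cases "d \<le> n")
      case True
      then show ?thesis
        using extend_conv[OF ca pf, of "n - d"] extend_conv[OF pf ca, of "n - d"] extend_closed[OF ca]
        by (simp add: part_conv_left[OF homogeneous] part_conv_right[OF homogeneous] c_conv f1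
            prod_one_left prod_one_right)
    next
      case False
      then show ?thesis
        by (simp add: part_conv_left[OF homogeneous] part_conv_right[OF homogeneous] c_comp_zero extend_zero)
    qed
    then show ?case unfolding extend_kernel_def using conv_closed[OF ac fc] conv_closed[OF fc ac] by blast
  next
    case (add a b)
    then show ?case by (simp add: conv_add_left conv_add_right extend_kernel_add)
  qed
  then show "conv a f \<in> extend_kernel" "conv f a \<in> extend_kernel" by auto
qed

text \<open>The relations generate ideals in ungraded rings, and minimality of a generated ideal can
  only be tested against another ideal of the whole ring; this one plays that part.\<close>

lemma ideal_extend_kernel: "ideal extend_kernel (free_algebra X)"
proof (rule idealI[OF ring_free_algebra])
  interpret ring "free_algebra X :: ('a list \<Rightarrow> 'r) ring" by (rule ring_free_algebra)
  show "subgroup extend_kernel (add_monoid (free_algebra X))"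
  proof (rule add.subgroupI)
    show "extend_kernel \<subseteq> carrier (free_algebra X)" unfolding extend_kernel_def by blast
    show "extend_kernel \<noteq> {}"
      using extend_kernel_homogeneous[OF zero_homogeneous[of X 0]] by (auto simp: c_comp_zero extend_zero)
    fix f assume f: "f \<in> extend_kernel"
    then have fc: "f \<in> carrier (free_algebra X)" unfolding extend_kernel_def by blast
    have "c \<circ> part n (\<lambda>w. - f w) = c \<circ> part n f" for n
      by (auto simp: part_uminus c_uminus)
    then have "(\<lambda>w. - f w) \<in> extend_kernel"
      using f fc uminus_closed[OF fc] unfolding extend_kernel_def by simp
    moreover have "\<ominus>\<^bsub>free_algebra X\<^esub> f = (\<lambda>w. - f w)"
      by (rule minus_equality) (use fc in auto)
    ultimately show "\<ominus>\<^bsub>free_algebra X\<^esub> f \<in> extend_kernel" by simp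
  qed (simp add: extend_kernel_add)
qed (auto simp: extend_kernel_conv simp del: free_algebra_simps(1))

end

text \<open>The assumption \<open>compatible\<close> is the condition for the linear extension to
  descend to \<open>R\<close>; \<open>universal\<close> derives it from the relations alone.\<close>

locale presented_extension = presentation c X t R \<kappa> + igr_target_coefficient S X \<gamma> c
  for c :: "'r::comm_ring_1 \<Rightarrow> bit" and X :: "'a set" and t and R :: "'b igr" and \<kappa>
    and S :: "'d igr" and \<gamma> +
  assumes gamma_t: "\<gamma> t = gtop S 1"
    and compatible: "\<lbrakk>f \<in> homogeneous X n; g \<in> homogeneous X n; \<kappa> n f = \<kappa> n g\<rbrakk> \<Longrightarrow>
      extend n (c \<circ> f) = extend n (c \<circ> g)"
begin

definition induced :: "nat \<Rightarrow> 'b \<Rightarrow> 'd" where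
  "induced n = (\<lambda>x\<in>gcar R n. extend n (c \<circ> (SOME f. f \<in> homogeneous X n \<and> x = \<kappa> n f)))"

lemma induced_kappa:
  assumes "f \<in> homogeneous X n"
  shows "induced n (\<kappa> n f) = extend n (c \<circ> f)"
proof -
  define g where "g = (SOME g. g \<in> homogeneous X n \<and> \<kappa> n f = \<kappa> n g)"
  have "g \<in> homogeneous X n \<and> \<kappa> n f = \<kappa> n g"
    unfolding g_def by (rule someI[of _ f]) (use assms in simp)
  then show ?thesis
    using compatible[of g n f] assms kappa_closed by (simp add: induced_def g_def)
qed

lemma induced_word: "w \<in> lists X \<Longrightarrow> induced (length w) (\<kappa> (length w) (word w)) = word_product S \<gamma> w"
  by (simp add: induced_kappa word_homogeneous c_word extend_word)

lemma induced_hom: "induced \<in> igr_hom R S"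
  unfolding igr_hom_def
proof (intro CollectI conjI allI ballI IntI)
  fix n
  show "induced n \<in> hom (gcomp R n) (gcomp S n)"
  proof (rule homI)
    fix x assume "x \<in> gcar R n"
    then obtain f where f: "f \<in> homogeneous X n" "x = \<kappa> n f" by (rule gcarE)
    then show "induced n x \<in> gcar S n" by (simp add: induced_kappa extend_closed c_homogeneous)
    fix y assume "y \<in> gcar R n"
    then obtain g where g: "g \<in> homogeneous X n" "y = \<kappa> n g" by (rule gcarE)
    show "induced n (x \<otimes>\<^bsub>gcomp R n\<^esub> y) = induced n x \<otimes>\<^bsub>gcomp S n\<^esub> induced n y"
      using f g by (simp add: induced_kappa add_eq add_homogeneous extend_c_add)
  qed
  show "induced n \<in> extensional (gcar R n)" by (simp add: induced_def)
  show "induced n (gtop R n) = gtop S n"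
    using induced_kappa[OF replicate_homogeneous] extend_word[of "replicate n t"] t_in
    by (simp add: top_eq c_word word_product_replicate[OF gamma_t] in_lists_conv_set)
next
  show "induced 0 (gunit R) = gunit S"
    using induced_word[of "[]"] by (simp add: unit_eq)
next
  fix n m x y assume "x \<in> gcar R n" "y \<in> gcar R m"
  then obtain f g where f: "f \<in> homogeneous X n" "x = \<kappa> n f" and g: "g \<in> homogeneous X m" "y = \<kappa> m g"
    by (elim gcarE)
  then show "induced (n + m) (gprod R n m x y) = gprod S n m (induced n x) (induced m y)"
    by (simp add: prod_eq induced_kappa conv_homogeneous c_conv extend_conv c_homogeneous)
qed

end

section \<open>Homomorphisms are determined by words\<close>

context presentation
begin

text \<open>Words generate each component additively. It is stated for a single degree because the
  description of \<open>kmult_map\<close> is made degree by degree.\<close>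

lemma hom_unique:
  assumes S: "Group.group S" and \<phi>: "\<phi> \<in> hom (gcomp R n) S" "\<phi> \<in> extensional (gcar R n)"
    and \<psi>: "\<psi> \<in> hom (gcomp R n) S" "\<psi> \<in> extensional (gcar R n)"
    and eq: "\<And>w. w \<in> lists X \<Longrightarrow> length w = n \<Longrightarrow> \<phi> (\<kappa> n (word w)) = \<psi> (\<kappa> n (word w))"
  shows "\<phi> = \<psi>"
proof (rule extensionalityI[OF \<phi>(2) \<psi>(2)])
  interpret n: comm_group "gcomp R n" by (rule comm_group_gcomp)
  fix x assume "x \<in> gcar R n"
  then obtain f where f: "f \<in> homogeneous X n" "x = \<kappa> n f" by (rule gcarE)
  from f(1) surj_of_int have "\<phi> (\<kappa> n f) = \<psi> (\<kappa> n f)"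
  proof (induction rule: homogeneous_induct)
    case zero
    then show ?case using hom_one[OF \<phi>(1) n.is_group S] hom_one[OF \<psi>(1) n.is_group S]
      by (simp add: zero_eq)
  next
    case (add f g)
    then show ?case
      using hom_mult[OF \<phi>(1), of "\<kappa> n f" "\<kappa> n g"] hom_mult[OF \<psi>(1), of "\<kappa> n f" "\<kappa> n g"]
      by (simp add: add_eq kappa_closed)
  next
    case (uminus f)
    then show ?case by (simp add: kappa_uminus)
  qed (rule eq)
  then show "\<phi> x = \<psi> x" by (simp add: f)
qed

lemma igr_hom_unique:
  assumes S: "inductive_graded_ring S" and \<phi>: "\<phi> \<in> igr_hom R S" and \<psi>: "\<psi> \<in> igr_hom R S"
    and eq: "\<And>w. w \<in> lists X \<Longrightarrow> \<phi> (length w) (\<kappa> (length w) (word w)) = \<psi> (length w) (\<kappa> (length w) (word w))"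
  shows "\<phi> = \<psi>"
proof
  fix n
  have "comm_group (gcomp S n)"
    using S unfolding inductive_graded_ring_def commutative_graded_ring_def by (elim conjE) (rule spec)
  then have "Group.group (gcomp S n)" by (rule comm_group.axioms(2))
  then show "\<phi> n = \<psi> n"
    by (rule hom_unique) (use \<phi> \<psi> eq in \<open>auto simp: igr_hom_def\<close>)
qed

text \<open>When the target of a universal map is itself presented by words, this turns the
  resulting \<open>word_product\<close> back into the class of a word.\<close>

lemma word_product_kappa:
  "w \<in> lists X \<Longrightarrow> word_product R (\<lambda>x. \<kappa> 1 (word [x])) w = \<kappa> (length w) (word w)"
proof (induction w rule: list.induct)
  case (Cons x w)
  have "gprod R 1 (length w) (\<kappa> 1 (word [x])) (\<kappa> (length w) (word w)) = \<kappa> (1 + length w) (conv (word [x]) (word w))"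
    using word_homogeneous[of "[x]" X] word_homogeneous[of w X] Cons(2) by (intro prod_eq) auto
  then show ?case using Cons by (simp add: conv_word_word)
qed (simp add: unit_eq)

end

section \<open>Quotients of tensor algebras\<close>

text \<open>The common shape of \<open>kdm_relations\<close> and \<open>K_relations\<close>, which
  differ only in the set \<open>P\<close> of pairs and in the module.\<close>

definition quadratic_relations :: "('r::comm_ring_1, 'a) module \<Rightarrow> ('a \<times> 'a) set \<Rightarrow> ('a list \<Rightarrow> 'r) set set" where
  "quadratic_relations V P = {tensor_class V (word [a]) \<otimes>\<^bsub>tensor_algebra V\<^esub> tensor_class V (word [b]) | a b. (a, b) \<in> P}"

locale tensor_quotient = coefficient_map c
  for c :: "'r::comm_ring_1 \<Rightarrow> bit" +
  fixes V :: "('r, 'a) module" and P :: "('a \<times> 'a) set"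
  assumes V_add: "x \<in> carrier V \<Longrightarrow> y \<in> carrier V \<Longrightarrow> x \<oplus>\<^bsub>V\<^esub> y \<in> carrier V"
    and V_smult: "x \<in> carrier V \<Longrightarrow> r \<odot>\<^bsub>V\<^esub> x \<in> carrier V"
    and P_subset: "P \<subseteq> carrier V \<times> carrier V"
begin

abbreviation "X \<equiv> carrier V"
abbreviation A :: "('a list \<Rightarrow> 'r) ring" where "A \<equiv> free_algebra X"
abbreviation "T \<equiv> tensor_algebra V"
abbreviation "Q \<equiv> tq_ring V (quadratic_relations V P)"

text \<open>The composite of both quotient maps, so that elements of the double quotient have
  representatives in the free algebra.\<close>

definition cls :: "('a list \<Rightarrow> 'r) \<Rightarrow> ('a list \<Rightarrow> 'r) set set" where
  "cls f = tq_class V (quadratic_relations V P) (tensor_class V f)"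

sublocale A: ring A by (rule ring_free_algebra)

lemma linearity_closed: "linearity_relations V \<subseteq> carrier A"
proof -
  have support: "f \<in> carrier A" if "finite W" "W \<subseteq> lists X" "\<And>w. w \<notin> W \<Longrightarrow> f w = 0" for f W
  proof -
    have "{w. f w \<noteq> 0} \<subseteq> W" using that(3) by blast
    then show ?thesis using that(1,2) finite_subset by auto
  qed
  have "(\<lambda>w. word [x \<oplus>\<^bsub>V\<^esub> y] w - (word [x] w + word [y] w)) \<in> carrier A" if "x \<in> X" "y \<in> X" for x y
    by (rule support[of "{[x \<oplus>\<^bsub>V\<^esub> y], [x], [y]}"]) (use that V_add in \<open>auto simp: word_def\<close>)
  moreover have "(\<lambda>w. word [r \<odot>\<^bsub>V\<^esub> x] w - r * word [x] w) \<in> carrier A" if "x \<in> X" for r x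
    by (rule support[of "{[r \<odot>\<^bsub>V\<^esub> x], [x]}"]) (use that V_smult in \<open>auto simp: word_def\<close>)
  ultimately show ?thesis unfolding linearity_relations_def by blast
qed

sublocale I: ideal "tensor_ideal V" A
  unfolding tensor_ideal_def by (rule A.genideal_ideal[OF linearity_closed])

lemma tensor_class_eq: "tensor_class V = (+>\<^bsub>A\<^esub>) (tensor_ideal V)"
  by (simp add: tensor_class_def[abs_def])

sublocale T: ring T
  unfolding tensor_algebra_def by (rule I.quotient_is_ring)

lemma tensor_class_hom: "tensor_class V \<in> ring_hom A T"
  unfolding tensor_class_eq tensor_algebra_def by (rule I.rcos_ring_hom)

lemma relations_closed: "quadratic_relations V P \<subseteq> carrier T"
proof -
  have "tensor_class V (word [a]) \<in> carrier T" if "a \<in> X" for a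
    using ring_hom_closed[OF tensor_class_hom] that word_closed[of "[a]" X] by auto
  then show ?thesis using P_subset unfolding quadratic_relations_def by (auto intro!: T.m_closed)
qed

sublocale K: ideal "tq_ideal V (quadratic_relations V P)" T
  unfolding tq_ideal_def by (rule T.genideal_ideal[OF relations_closed])

sublocale Q: ring Q
  unfolding tq_ring_def by (rule K.quotient_is_ring)

lemma tq_class_eq: "tq_class V (quadratic_relations V P) = (+>\<^bsub>T\<^esub>) (tq_ideal V (quadratic_relations V P))"
  by (simp add: tq_class_def[abs_def])

lemma tq_class_hom: "tq_class V (quadratic_relations V P) \<in> ring_hom T Q"
  unfolding tq_class_eq tq_ring_def by (rule K.rcos_ring_hom)

lemma cls_hom: "cls \<in> ring_hom A Q"
  using ring_hom_trans[OF tensor_class_hom tq_class_hom] by (simp add: cls_def[abs_def] comp_def)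

sublocale cls: ring_hom_ring A Q cls
  by (rule ring_hom_ringI2[OF A.ring_axioms Q.ring_axioms cls_hom])

lemma homogeneous_carrier: "f \<in> homogeneous X n \<Longrightarrow> f \<in> carrier A"
  by (simp add: homogeneous_def)

lemma cls_add: "f \<in> carrier A \<Longrightarrow> g \<in> carrier A \<Longrightarrow> cls (\<lambda>w. f w + g w) = cls f \<oplus>\<^bsub>Q\<^esub> cls g"
  using cls.hom_add[of f g] by (simp del: free_algebra_simps(1))

lemma cls_conv: "f \<in> carrier A \<Longrightarrow> g \<in> carrier A \<Longrightarrow> cls (conv f g) = cls f \<otimes>\<^bsub>Q\<^esub> cls g"
  using cls.hom_mult[of f g] by (simp del: free_algebra_simps(1))

lemma cls_zero: "cls (\<lambda>w. 0) = \<zero>\<^bsub>Q\<^esub>"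
  using cls.hom_zero by simp

lemma cls_one: "cls (word []) = \<one>\<^bsub>Q\<^esub>"
  using cls.hom_one by simp

lemma cls_uminus: "f \<in> carrier A \<Longrightarrow> cls (\<lambda>w. - f w) = \<ominus>\<^bsub>Q\<^esub> cls f"
proof (rule Q.minus_equality[symmetric])
  assume f: "f \<in> carrier A"
  show "cls (\<lambda>w. - f w) \<oplus>\<^bsub>Q\<^esub> cls f = \<zero>\<^bsub>Q\<^esub>"
    using cls_add[OF uminus_closed[OF f] f] cls_zero by simp
qed (auto intro!: cls.hom_closed simp del: free_algebra_simps(1) intro: uminus_closed)

text \<open>The two quotients are undone one after the other. \<open>J\<close> contains the tensor
  ideal by minimality; its image in the tensor algebra is an ideal containing the quadratic
  relations, hence contains the second ideal by minimality again.\<close>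

lemma cls_eq_imp_ideal:
  assumes J: "ideal J A" and linear: "linearity_relations V \<subseteq> J"
    and quadratic: "\<And>a b. (a, b) \<in> P \<Longrightarrow> word [a, b] \<in> J"
    and f: "f \<in> carrier A" and g: "g \<in> carrier A" and eq: "cls f = cls g"
  shows "(\<lambda>w. f w - g w) \<in> J"
proof -
  interpret J: ideal J A by (rule J)
  have IJ: "tensor_ideal V \<subseteq> J"
    unfolding tensor_ideal_def by (rule A.genideal_minimal[OF J linear])
  have J': "ideal (tensor_class V ` J) T"
    unfolding tensor_class_eq tensor_algebra_def
    by (rule A.ring_ideal_imp_quot_ideal[OF I.ideal_axioms J])
  have "quadratic_relations V P \<subseteq> tensor_class V ` J"
  proof
    fix s assume "s \<in> quadratic_relations V P"
    then obtain a b where ab: "(a, b) \<in> P"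
      and s: "s = tensor_class V (word [a]) \<otimes>\<^bsub>T\<^esub> tensor_class V (word [b])"
      unfolding quadratic_relations_def by blast
    have w: "word [a] \<in> carrier A" "word [b] \<in> carrier A"
      using ab P_subset by (auto intro!: word_closed simp del: free_algebra_simps)
    have "s = tensor_class V (word [a] \<otimes>\<^bsub>A\<^esub> word [b])"
      unfolding s by (rule ring_hom_mult[OF tensor_class_hom w, symmetric])
    then have "s = tensor_class V (word [a, b])" by (simp add: conv_word_word)
    then show "s \<in> tensor_class V ` J" using quadratic[OF ab] by blast
  qed
  then have KJ: "tq_ideal V (quadratic_relations V P) \<subseteq> tensor_class V ` J"
    unfolding tq_ideal_def by (rule T.genideal_minimal[OF J'])
  define d where "d = f \<ominus>\<^bsub>A\<^esub> g"
  have d: "d \<in> carrier A" unfolding d_def by (rule A.minus_closed[OF f g])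
  have tc: "tensor_class V f \<in> carrier T" "tensor_class V g \<in> carrier T"
    using ring_hom_closed[OF tensor_class_hom] f g by blast+
  interpret tc: ring_hom_ring A T "tensor_class V"
    by (rule ring_hom_ringI2[OF A.ring_axioms T.ring_axioms tensor_class_hom])
  have "tensor_class V d = tensor_class V f \<ominus>\<^bsub>T\<^esub> tensor_class V g"
    unfolding d_def a_minus_def using f g by (simp only: tc.hom_add tc.hom_a_inv A.a_inv_closed)
  also have "\<dots> \<in> tq_ideal V (quadratic_relations V P)"
    using eq tc unfolding cls_def tq_class_eq
    by (simp only: T.quotient_eq_iff_same_a_r_cos[OF K.ideal_axioms])
  finally obtain j where j: "j \<in> J" "tensor_class V d = tensor_class V j" using KJ by blast
  have jc: "j \<in> carrier A" using j(1) J.Icarr by blast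
  \<comment> \<open>\<open>d\<close> and \<open>j\<close> have the same class in the tensor algebra,
    so they differ by an element of the tensor ideal, which lies in \<open>J\<close> as
    well.\<close>
  have "d \<ominus>\<^bsub>A\<^esub> j \<in> tensor_ideal V"
    using j(2) d jc unfolding tensor_class_eq
    by (simp only: A.quotient_eq_iff_same_a_r_cos[OF I.ideal_axioms])
  then have "(d \<ominus>\<^bsub>A\<^esub> j) \<oplus>\<^bsub>A\<^esub> j \<in> J" using IJ j(1) J.a_closed by blast
  moreover have "(d \<ominus>\<^bsub>A\<^esub> j) \<oplus>\<^bsub>A\<^esub> j = d"
    unfolding a_minus_def using d jc by (simp only: A.a_assoc A.a_inv_closed A.l_neg A.r_zero)
  ultimately show ?thesis unfolding d_def a_minus_free_algebra[OF f g] by simp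
qed

text \<open>The relations live in degrees 1 and 2, so the ideal of elements whose constant term is
  killed by \<open>c\<close> contains all of them.\<close>

lemma constant_term:
  assumes f: "f \<in> carrier A" and g: "g \<in> carrier A" and eq: "cls f = cls g"
  shows "c (f []) = c (g [])"
proof -
  define J where "J = {f \<in> carrier A. c (f []) = 0}"
  have "ideal J A"
  proof (rule idealI[OF A.ring_axioms])
    show "subgroup J (add_monoid A)"
    proof (rule A.add.subgroupI)
      show "J \<noteq> {}" using A.zero_closed by (auto simp: J_def c_zero)
      fix f assume f: "f \<in> J"
      then have fc: "f \<in> carrier A" unfolding J_def by blast
      have "\<ominus>\<^bsub>A\<^esub> f = (\<lambda>w. - f w)" by (rule A.minus_equality) (use fc in auto)
      then show "\<ominus>\<^bsub>A\<^esub> f \<in> J" using f uminus_closed[OF fc] unfolding J_def by (simp add: c_uminus)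
    next
      fix f g assume "f \<in> J" "g \<in> J"
      then show "f \<oplus>\<^bsub>A\<^esub> g \<in> J" using A.add.m_closed[of f g] by (simp add: J_def c_add)
    qed (auto simp: J_def)
  next
    fix f g assume "f \<in> J" "g \<in> carrier A"
    then show "g \<otimes>\<^bsub>A\<^esub> f \<in> J" "f \<otimes>\<^bsub>A\<^esub> g \<in> J"
      using conv_closed[of f X g] conv_closed[of g X f] by (simp_all add: J_def conv_Nil c_mult)
  qed
  moreover have "linearity_relations V \<subseteq> J"
  proof
    fix f assume f: "f \<in> linearity_relations V"
    then have "f [] = 0" by (auto simp: linearity_relations_def word_def)
    then show "f \<in> J" using f linearity_closed by (auto simp: J_def c_zero simp del: free_algebra_simps)
  qed
  moreover have "word [a, b] \<in> J" if "(a, b) \<in> P" for a b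
    using that P_subset word_closed[of "[a, b]" X] by (auto simp: J_def c_zero word_def)
  ultimately have "(\<lambda>w. f w - g w) \<in> J" using cls_eq_imp_ideal f g eq by blast
  then have "c (f [] - g []) = 0" unfolding J_def by simp
  then show ?thesis using c_add[of "f [] - g []" "g []"] by simp
qed

abbreviation "grade n \<equiv> tq_comp V (quadratic_relations V P) n"

lemma grade_simps: "mult (grade n) = add Q" "one (grade n) = \<zero>\<^bsub>Q\<^esub>"
  by (simp_all add: tq_comp_def)

lemma carrier_grade: "carrier (grade n) = cls ` homogeneous X n"
  by (simp add: tq_comp_def tensor_degree_def homogeneous_def cls_def[abs_def] image_image)

lemma grade_group: "comm_group (grade n)"
proof (rule comm_groupI)
  fix x assume "x \<in> carrier (grade n)"
  then obtain f where f: "f \<in> homogeneous X n" "x = cls f" by (auto simp: carrier_grade)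
  note fA = homogeneous_carrier[OF f(1)]
  show "\<one>\<^bsub>grade n\<^esub> \<otimes>\<^bsub>grade n\<^esub> x = x"
    using cls.hom_closed[OF fA] f(2) by (simp only: grade_simps Q.l_zero)
  show "\<exists>y\<in>carrier (grade n). y \<otimes>\<^bsub>grade n\<^esub> x = \<one>\<^bsub>grade n\<^esub>"
  proof (rule bexI)
    show "cls (\<lambda>w. - f w) \<in> carrier (grade n)"
      unfolding carrier_grade by (rule imageI[OF uminus_homogeneous[OF f(1)]])
    show "cls (\<lambda>w. - f w) \<otimes>\<^bsub>grade n\<^esub> x = \<one>\<^bsub>grade n\<^esub>"
      unfolding f(2) grade_simps cls_uminus[OF fA] by (rule Q.l_neg[OF cls.hom_closed[OF fA]])
  qed
  fix y assume "y \<in> carrier (grade n)"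
  then obtain g where g: "g \<in> homogeneous X n" "y = cls g" by (auto simp: carrier_grade)
  note gA = homogeneous_carrier[OF g(1)]
  show "x \<otimes>\<^bsub>grade n\<^esub> y \<in> carrier (grade n)"
    unfolding carrier_grade grade_simps f(2) g(2) cls_add[OF fA gA, symmetric]
    by (rule imageI[OF add_homogeneous[OF f(1) g(1)]])
  show "x \<otimes>\<^bsub>grade n\<^esub> y = y \<otimes>\<^bsub>grade n\<^esub> x"
    using cls.hom_closed[OF fA] cls.hom_closed[OF gA] f(2) g(2)
    by (simp only: grade_simps Q.a_comm)
  fix z assume "z \<in> carrier (grade n)"
  then obtain h where h: "h \<in> homogeneous X n" "z = cls h" by (auto simp: carrier_grade)
  show "x \<otimes>\<^bsub>grade n\<^esub> y \<otimes>\<^bsub>grade n\<^esub> z = x \<otimes>\<^bsub>grade n\<^esub> (y \<otimes>\<^bsub>grade n\<^esub> z)"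
    using cls.hom_closed[OF fA] cls.hom_closed[OF gA] cls.hom_closed[OF homogeneous_carrier[OF h(1)]] f(2) g(2) h(2)
    by (simp only: grade_simps Q.a_assoc)
qed (auto simp: grade_simps carrier_grade cls_zero[symmetric] zero_homogeneous)

lemma gen_eq: "tq_gen V (quadratic_relations V P) x = cls (word [x])"
  by (simp add: tq_gen_def cls_def)

lemma word1: "x \<in> X \<Longrightarrow> word [x] \<in> carrier A"
  by (rule word_closed) simp

lemma gen_add:
  assumes "x \<in> X" "y \<in> X"
  shows "cls (word [x \<oplus>\<^bsub>V\<^esub> y]) = cls (word [x]) \<oplus>\<^bsub>Q\<^esub> cls (word [y])"
proof -
  note w = word1[OF V_add[OF assms]] word1[OF assms(1)] word1[OF assms(2)]
  have s: "word [x] \<oplus>\<^bsub>A\<^esub> word [y] \<in> carrier A" by (intro A.add.m_closed w)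
  have "(\<lambda>w. word [x \<oplus>\<^bsub>V\<^esub> y] w - (word [x] w + word [y] w)) \<in> linearity_relations V"
    unfolding linearity_relations_def using assms by blast
  then have "word [x \<oplus>\<^bsub>V\<^esub> y] \<ominus>\<^bsub>A\<^esub> (word [x] \<oplus>\<^bsub>A\<^esub> word [y]) \<in> tensor_ideal V"
    unfolding a_minus_free_algebra[OF w(1) s] tensor_ideal_def
    using A.genideal_self[OF linearity_closed] by auto
  then have "tensor_class V (word [x \<oplus>\<^bsub>V\<^esub> y]) = tensor_class V (word [x] \<oplus>\<^bsub>A\<^esub> word [y])"
    unfolding tensor_class_eq using w(1) s
    by (simp only: A.quotient_eq_iff_same_a_r_cos[OF I.ideal_axioms])
  then have "cls (word [x \<oplus>\<^bsub>V\<^esub> y]) = cls (word [x] \<oplus>\<^bsub>A\<^esub> word [y])" by (simp add: cls_def)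
  also have "\<dots> = cls (word [x]) \<oplus>\<^bsub>Q\<^esub> cls (word [y])" by (rule cls.hom_add[OF w(2,3)])
  finally show ?thesis .
qed

lemma gen_relation:
  assumes "(a, b) \<in> P"
  shows "cls (word [a]) \<otimes>\<^bsub>Q\<^esub> cls (word [b]) = \<zero>\<^bsub>Q\<^esub>"
proof -
  have w: "word [a] \<in> carrier A" "word [b] \<in> carrier A"
    using assms P_subset by (auto intro!: word1 simp del: free_algebra_simps)
  let ?s = "tensor_class V (word [a]) \<otimes>\<^bsub>T\<^esub> tensor_class V (word [b])"
  have t: "tensor_class V (word [a]) \<in> carrier T" "tensor_class V (word [b]) \<in> carrier T"
    using ring_hom_closed[OF tensor_class_hom] w by blast+
  have s: "?s \<in> quadratic_relations V P" unfolding quadratic_relations_def using assms by blast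
  then have "?s \<in> tq_ideal V (quadratic_relations V P)"
    unfolding tq_ideal_def using T.genideal_self[OF relations_closed] by blast
  then have "tq_class V (quadratic_relations V P) ?s = tq_ideal V (quadratic_relations V P)"
    unfolding tq_class_eq by (rule K.a_rcos_const)
  also have "\<dots> = \<zero>\<^bsub>Q\<^esub>" by (simp add: tq_ring_def FactRing_def)
  finally show ?thesis
    unfolding cls_def using ring_hom_mult[OF tq_class_hom t] by simp
qed

lemma cls_replicate: "x \<in> X \<Longrightarrow> cls (word [x]) [^]\<^bsub>Q\<^esub> n = cls (word (replicate n x))"
proof (induction n)
  case 0 then show ?case by (simp add: cls_one)
next
  case (Suc n)
  have "word (replicate n x) \<in> carrier A"
    using Suc(2) by (intro word_closed) (simp add: in_lists_conv_set)
  from cls_conv[OF this word1[OF Suc(2)]] Suc show ?case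
    by (simp add: conv_word_word replicate_append_same)
qed

text \<open>Expand the hyperbolic relation for \<open>x \<oplus> y\<close>; with \<open>m\<close> standing for \<open>-1\<close> it reads \<open>x m + x x = 0\<close>.\<close>

lemma anticommute:
  assumes m: "m \<in> X" and hyperbolic: "\<And>x. x \<in> X \<Longrightarrow> cls (word [x]) \<otimes>\<^bsub>Q\<^esub> cls (word [m \<oplus>\<^bsub>V\<^esub> x]) = \<zero>\<^bsub>Q\<^esub>"
    and x: "x \<in> X" and y: "y \<in> X"
  shows "cls (word [x, y]) = cls (\<lambda>w. - word [y, x] w)"
proof -
  let ?g = "\<lambda>x. cls (word [x])"
  have g: "?g x \<in> carrier Q" if "x \<in> X" for x by (rule cls.hom_closed[OF word1[OF that]])
  note gm = g[OF m] and gx = g[OF x] and gy = g[OF y]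
  have h: "?g x \<otimes>\<^bsub>Q\<^esub> ?g m \<oplus>\<^bsub>Q\<^esub> ?g x \<otimes>\<^bsub>Q\<^esub> ?g x = \<zero>\<^bsub>Q\<^esub>" if "x \<in> X" for x
    using hyperbolic[OF that] gen_add[OF m that] g[OF that] gm by (simp add: Q.r_distr)
  have "?g (x \<oplus>\<^bsub>V\<^esub> y) = ?g x \<oplus>\<^bsub>Q\<^esub> ?g y" by (rule gen_add[OF x y])
  from h[OF V_add[OF x y], unfolded this]
  have "(?g x \<otimes>\<^bsub>Q\<^esub> ?g m \<oplus>\<^bsub>Q\<^esub> ?g x \<otimes>\<^bsub>Q\<^esub> ?g x) \<oplus>\<^bsub>Q\<^esub> (?g y \<otimes>\<^bsub>Q\<^esub> ?g m \<oplus>\<^bsub>Q\<^esub> ?g y \<otimes>\<^bsub>Q\<^esub> ?g y) \<oplus>\<^bsub>Q\<^esub>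
      (?g x \<otimes>\<^bsub>Q\<^esub> ?g y \<oplus>\<^bsub>Q\<^esub> ?g y \<otimes>\<^bsub>Q\<^esub> ?g x) = \<zero>\<^bsub>Q\<^esub>"
    using gm gx gy by (simp add: Q.r_distr Q.l_distr Q.a_ac)
  then have "?g x \<otimes>\<^bsub>Q\<^esub> ?g y \<oplus>\<^bsub>Q\<^esub> ?g y \<otimes>\<^bsub>Q\<^esub> ?g x = \<zero>\<^bsub>Q\<^esub>"
    unfolding h[OF x] h[OF y] using gx gy by simp
  then have "\<ominus>\<^bsub>Q\<^esub> (?g y \<otimes>\<^bsub>Q\<^esub> ?g x) = ?g x \<otimes>\<^bsub>Q\<^esub> ?g y"
    using gx gy by (intro Q.minus_equality) simp_all
  moreover have "?g x \<otimes>\<^bsub>Q\<^esub> ?g y = cls (word [x, y])" "?g y \<otimes>\<^bsub>Q\<^esub> ?g x = cls (word [y, x])"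
    using cls_conv[OF word1[OF x] word1[OF y]] cls_conv[OF word1[OF y] word1[OF x]]
    by (simp_all add: conv_word_word)
  ultimately show ?thesis
    using cls_uminus[OF word_closed[of "[y, x]" X]] x y by simp
qed

end

text \<open>The form that fits both K-theories: \<open>\<kappa>\<close> may identify more than
  \<open>cls\<close> does, but only up to adding a double. By \<open>smult_eq\<close> scalars act
  through \<open>c\<close>, as the module comes from a group of exponent 2.\<close>

locale tensor_presentation = tensor_quotient c V P + presentation c "carrier V" t R \<kappa>
  for c :: "'r::comm_ring_1 \<Rightarrow> bit" and V :: "('r, 'a) module" and P and t
    and R :: "'b igr" and \<kappa> +
  assumes kappa_cls: "\<lbrakk>f \<in> homogeneous (carrier V) n; g \<in> homogeneous (carrier V) n; cls f = cls g\<rbrakk> \<Longrightarrow>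
      \<kappa> n f = \<kappa> n g"
    and kappa_eqD: "\<lbrakk>f \<in> homogeneous (carrier V) n; g \<in> homogeneous (carrier V) n; \<kappa> n f = \<kappa> n g\<rbrakk> \<Longrightarrow>
      \<exists>h\<in>homogeneous (carrier V) n. cls f = cls (\<lambda>w. g w + (h w + h w))"
    and zero_in: "\<zero>\<^bsub>V\<^esub> \<in> carrier V"
    and zero_add: "\<zero>\<^bsub>V\<^esub> \<oplus>\<^bsub>V\<^esub> \<zero>\<^bsub>V\<^esub> = \<zero>\<^bsub>V\<^esub>"
    and smult_eq: "x \<in> carrier V \<Longrightarrow> r \<odot>\<^bsub>V\<^esub> x = (if c r = 0 then \<zero>\<^bsub>V\<^esub> else x)"
begin

lemma word1_homogeneous: "x \<in> X \<Longrightarrow> word [x] \<in> homogeneous X 1"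
  using word_homogeneous[of "[x]" X] by simp

lemma kappa_gen_closed: "x \<in> X \<Longrightarrow> \<kappa> 1 (word [x]) \<in> gcar R 1"
  by (rule kappa_closed[OF word1_homogeneous])

lemma kappa_gen_add:
  assumes "x \<in> X" "y \<in> X"
  shows "\<kappa> 1 (word [x \<oplus>\<^bsub>V\<^esub> y]) = \<kappa> 1 (word [x]) \<otimes>\<^bsub>gcomp R 1\<^esub> \<kappa> 1 (word [y])"
proof -
  note w = word1_homogeneous[OF assms(1)] word1_homogeneous[OF assms(2)]
  have "\<kappa> 1 (word [x \<oplus>\<^bsub>V\<^esub> y]) = \<kappa> 1 (\<lambda>w. word [x] w + word [y] w)"
    using gen_add[OF assms] cls_add[OF word1[OF assms(1)] word1[OF assms(2)]]
    by (intro kappa_cls word1_homogeneous V_add assms add_homogeneous w) simp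
  then show ?thesis using add_eq[OF w] by simp
qed

text \<open>Additivity of \<open>\<gamma>\<close> kills the linear relations,
  \<open>relation\<close> kills the quadratic ones, and doubles vanish because \<open>S\<close> has
  exponent 2. Hence the kernel of the linear extension satisfies the hypotheses of
  \<open>cls_eq_imp_ideal\<close>.\<close>

lemma universal:
  assumes S: "inductive_graded_ring S" and top0: "gtop S 0 = gunit S"
    and closed: "\<And>x. x \<in> X \<Longrightarrow> \<gamma> x \<in> gcar S 1" and top1: "\<gamma> t = gtop S 1"
    and add: "\<And>x y. x \<in> X \<Longrightarrow> y \<in> X \<Longrightarrow> \<gamma> (x \<oplus>\<^bsub>V\<^esub> y) = \<gamma> x \<otimes>\<^bsub>gcomp S 1\<^esub> \<gamma> y"
    and relation: "\<And>a b. (a, b) \<in> P \<Longrightarrow> gprod S 1 1 (\<gamma> a) (\<gamma> b) = \<one>\<^bsub>gcomp S 2\<^esub>"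
  shows "\<exists>\<phi>\<in>igr_hom R S. \<forall>w\<in>lists X. \<phi> (length w) (\<kappa> (length w) (word w)) = word_product S \<gamma> w"
proof -
  interpret target: igr_target_coefficient S X \<gamma> c
    by unfold_locales (use S top0 closed in auto)
  interpret S1: comm_group "gcomp S 1" by (rule target.group)
  have gamma_zero: "\<gamma> \<zero>\<^bsub>V\<^esub> = \<one>\<^bsub>gcomp S 1\<^esub>"
    using add[OF zero_in zero_in] closed[OF zero_in] zero_add S1.l_cancel_one' by metis
  have linear: "linearity_relations V \<subseteq> target.extend_kernel"
  proof -
    have word: "target.extend 1 (word [x]) = \<gamma> x" if "x \<in> X" for x
      using target.extend_word[of "[x]"] target.word_product_singleton[OF that] that by simp
    have hom: "(word [x] :: 'a list \<Rightarrow> bit) \<in> homogeneous X 1" if "x \<in> X" for x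
      using word_homogeneous[of "[x]" X] that by simp
    have "(\<lambda>w. word [x \<oplus>\<^bsub>V\<^esub> y] w - (word [x] w + word [y] w)) \<in> target.extend_kernel"
      if xy: "x \<in> X" "y \<in> X" for x y
    proof -
      let ?f = "\<lambda>w. word [x \<oplus>\<^bsub>V\<^esub> y] w - (word [x] w + word [y] w) :: 'r"
      have f: "?f \<in> homogeneous X 1"
        using add_homogeneous[OF word1_homogeneous[OF V_add[OF xy]]
            uminus_homogeneous[OF add_homogeneous[OF word1_homogeneous[OF xy(1)] word1_homogeneous[OF xy(2)]]]]
        unfolding add_uminus_conv_diff .
      have "c \<circ> ?f = (\<lambda>w. word [x \<oplus>\<^bsub>V\<^esub> y] w + (word [x] w + word [y] w))"
        by (auto simp: word_def c_one c_zero c_add c_minus)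
      then have "target.extend 1 (c \<circ> ?f) = \<gamma> (x \<oplus>\<^bsub>V\<^esub> y) \<otimes>\<^bsub>gcomp S 1\<^esub> (\<gamma> x \<otimes>\<^bsub>gcomp S 1\<^esub> \<gamma> y)"
        using target.extend_add[OF hom[OF V_add[OF xy]] add_homogeneous[OF hom[OF xy(1)] hom[OF xy(2)]]]
          target.extend_add[OF hom[OF xy(1)] hom[OF xy(2)]] by (simp only: word xy V_add)
      also have "\<dots> = \<one>\<^bsub>gcomp S 1\<^esub>"
        unfolding add[OF xy] by (rule target.exponent_two[OF S1.m_closed[OF closed[OF xy(1)] closed[OF xy(2)]]])
      finally show ?thesis using target.extend_kernel_homogeneous[OF f] by simp
    qed
    moreover have "(\<lambda>w. word [r \<odot>\<^bsub>V\<^esub> x] w - r * word [x] w) \<in> target.extend_kernel"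
      if x: "x \<in> X" for r x
    proof -
      let ?f = "\<lambda>w. word [r \<odot>\<^bsub>V\<^esub> x] w - r * word [x] w"
      have "?f \<in> linearity_relations V" unfolding linearity_relations_def using x by blast
      then have "?f \<in> carrier A" using linearity_closed by blast
      then have f: "?f \<in> homogeneous X 1" unfolding homogeneous_def by (auto simp: word_def)
      \<comment> \<open>If \<open>c r = 0\<close> the relation reduces to the one-letter word of the
        module zero, which goes to \<open>\<one>\<close> by \<open>gamma_zero\<close>; otherwise its
        two terms cancel modulo 2.\<close>
      have "target.extend 1 (c \<circ> ?f) = \<one>\<^bsub>gcomp S 1\<^esub>"
      proof (cases "c r = 0")
        case True
        then have "c \<circ> ?f = word [\<zero>\<^bsub>V\<^esub>]"
          using smult_eq[OF x, of r] by (auto simp: word_def c_one c_zero c_mult c_minus)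
        then show ?thesis by (simp only: word[OF zero_in] gamma_zero)
      next
        case False
        then have "c \<circ> ?f = (\<lambda>w. 0)"
          using smult_eq[OF x, of r] by (auto simp: word_def c_one c_zero c_mult c_minus)
        then show ?thesis by (simp add: target.extend_zero)
      qed
      then show ?thesis using target.extend_kernel_homogeneous[OF f] by simp
    qed
    ultimately show ?thesis unfolding linearity_relations_def by blast
  qed
  have quadratic: "word [a, b] \<in> target.extend_kernel" if "(a, b) \<in> P" for a b
  proof -
    have ab: "a \<in> X" "b \<in> X" using that P_subset by auto
    have "(word [a, b] :: 'a list \<Rightarrow> 'r) \<in> homogeneous X 2"
      using word_homogeneous[of "[a, b]" X] ab by (simp add: numeral_2_eq_2)
    moreover have "target.extend 2 (word [a, b]) = \<one>\<^bsub>gcomp S 2\<^esub>"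
      using target.extend_word[of "[a, b]"] target.word_product_pair[OF ab] relation[OF that] ab
      by (simp add: numeral_2_eq_2)
    ultimately show ?thesis using target.extend_kernel_homogeneous by (simp add: c_word)
  qed
  interpret presented_extension c X t R \<kappa> S \<gamma>
  proof unfold_locales
    show "\<gamma> t = gtop S 1" by (rule top1)
    fix f g n
    assume f: "f \<in> homogeneous X n" and g: "g \<in> homogeneous X n" and eq: "\<kappa> n f = \<kappa> n g"
    obtain h where h: "h \<in> homogeneous X n" "cls f = cls (\<lambda>w. g w + (h w + h w))"
      using kappa_eqD[OF f g eq] by blast
    let ?g = "\<lambda>w. g w + (h w + h w)"
    have g': "?g \<in> homogeneous X n" by (intro add_homogeneous g h(1))
    have d: "(\<lambda>w. f w - ?g w) \<in> homogeneous X n"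
      using add_homogeneous[OF f uminus_homogeneous[OF g']] unfolding add_uminus_conv_diff .
    have "(\<lambda>w. f w - ?g w) \<in> target.extend_kernel"
      by (rule cls_eq_imp_ideal[OF target.ideal_extend_kernel linear quadratic
            homogeneous_carrier[OF f] homogeneous_carrier[OF g'] h(2)])
    then have "target.extend n (c \<circ> (\<lambda>w. f w - ?g w)) = \<one>\<^bsub>gcomp S n\<^esub>"
      using target.extend_kernel_homogeneous[OF d] by simp
    \<comment> \<open>The double \<open>h + h\<close> disappears under \<open>c\<close>, and signs
      do too, so the difference becomes a sum of reductions.\<close>
    moreover have "c \<circ> (\<lambda>w. f w - ?g w) = (\<lambda>w. (c \<circ> f) w + (c \<circ> g) w)"
      by (rule ext) (simp only: comp_apply c_minus c_add bit_add_self add_0_right)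
    ultimately have one: "target.extend n (c \<circ> f) \<otimes>\<^bsub>gcomp S n\<^esub> target.extend n (c \<circ> g) = \<one>\<^bsub>gcomp S n\<^esub>"
      using target.extend_add[OF c_homogeneous[OF f] c_homogeneous[OF g]] by simp
    interpret Sn: comm_group "gcomp S n" by (rule target.group)
    note cf = target.extend_closed[OF c_homogeneous[OF f]] and cg = target.extend_closed[OF c_homogeneous[OF g]]
    show "target.extend n (c \<circ> f) = target.extend n (c \<circ> g)"
      using Sn.inv_equality[OF one cg cf] Sn.inv_equality[OF target.exponent_two[OF cg] cg cg] by simp
  qed
  show ?thesis using induced_hom induced_word by blast
qed

end

text \<open>The data from which both presentations are built. The letter \<open>t\<close> stands for
  \<open>-1\<close>, so \<open>t \<oplus> x\<close> is the letter for \<open>-x\<close>;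
  \<open>c_kernel\<close> makes \<open>c\<close> the reduction modulo 2 and not just some map to
  \<open>bit\<close>.\<close>

locale tensor_hyperbolic = tensor_quotient c V P
  for c :: "'r::comm_ring_1 \<Rightarrow> bit" and V :: "('r, 'a) module" and P +
  fixes t :: 'a
  assumes onto: "surj (of_int :: int \<Rightarrow> 'r)"
    and c_kernel: "c r = 0 \<Longrightarrow> \<exists>k. r = k + k"
    and V_zero_in: "\<zero>\<^bsub>V\<^esub> \<in> carrier V"
    and V_zero_add: "\<zero>\<^bsub>V\<^esub> \<oplus>\<^bsub>V\<^esub> \<zero>\<^bsub>V\<^esub> = \<zero>\<^bsub>V\<^esub>"
    and V_smult_eq: "x \<in> carrier V \<Longrightarrow> r \<odot>\<^bsub>V\<^esub> x = (if c r = 0 then \<zero>\<^bsub>V\<^esub> else x)"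
    and V_t_in: "t \<in> carrier V"
    and hyperbolic: "x \<in> carrier V \<Longrightarrow> cls (word [x]) \<otimes>\<^bsub>Q\<^esub> cls (word [t \<oplus>\<^bsub>V\<^esub> x]) = \<zero>\<^bsub>Q\<^esub>"
begin

text \<open>One direction is \<open>constant_term\<close>, with the double vanishing under
  \<open>c\<close>. For the other, the difference of the two constants has the form
  \<open>k + k\<close>, and \<open>h\<close> is the constant \<open>k\<close>.\<close>

lemma degree_zero_cls:
  assumes f: "f \<in> homogeneous X 0" and g: "g \<in> homogeneous X 0"
  shows "(\<exists>h\<in>homogeneous X 0. cls f = cls (\<lambda>w. g w + (h w + h w))) \<longleftrightarrow> c (f []) = c (g [])"
proof
  assume "\<exists>h\<in>homogeneous X 0. cls f = cls (\<lambda>w. g w + (h w + h w))"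
  then obtain h where h: "h \<in> homogeneous X 0" "cls f = cls (\<lambda>w. g w + (h w + h w))" by blast
  have "(\<lambda>w. g w + (h w + h w)) \<in> homogeneous X 0" by (intro add_homogeneous g h)
  from constant_term[OF homogeneous_carrier[OF f] homogeneous_carrier[OF this] h(2)]
  show "c (f []) = c (g [])" by (simp only: c_add bit_add_self add_0_right)
next
  assume "c (f []) = c (g [])"
  then have "c (f [] - g []) = 0" by (simp add: c_minus)
  then obtain k where k: "f [] - g [] = k + k" using c_kernel by blast
  define h where "h = (\<lambda>w :: 'a list. if w = [] then k else 0)"
  have h: "h \<in> homogeneous X 0" by (auto simp: h_def homogeneous_def)
  have "f = (\<lambda>w. g w + (h w + h w))"
  proof
    fix w
    show "f w = g w + (h w + h w)"
    proof (cases w)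
      case Nil
      then show ?thesis using k by (simp add: h_def algebra_simps)
    next
      case (Cons x w')
      then have "f w = 0" "g w = 0" using f g by (auto simp: homogeneous_def)
      then show ?thesis using Cons by (simp add: h_def)
    qed
  qed
  then show "\<exists>h\<in>homogeneous X 0. cls f = cls (\<lambda>w. g w + (h w + h w))" using h by auto
qed

lemma word2_homogeneous: "x \<in> X \<Longrightarrow> y \<in> X \<Longrightarrow> word [x, y] \<in> homogeneous X 2"
  using word_homogeneous[of "[x, y]" X] by (simp add: numeral_2_eq_2)

text \<open>In characteristic two there is nothing left to reduce: \<open>\<kappa>\<close> is
  \<open>cls\<close> in every degree, the double in \<open>kappa_eqD\<close> is taken to be zero,
  and anticommuting generators commute.\<close>

lemma tensor_presentation_char_two:
  assumes two: "\<And>r :: 'r. r + r = 0"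
  shows "tensor_presentation c V P t
    \<lparr>gcomp = tq_comp V (quadratic_relations V P), gtop = (\<lambda>n. cls (word [t]) [^]\<^bsub>Q\<^esub> n), gunit = \<one>\<^bsub>Q\<^esub>,
      gprod = (\<lambda>n m x y. x \<otimes>\<^bsub>Q\<^esub> y)\<rparr>
    (\<lambda>n. cls)"
proof unfold_locales
  fix n and f g :: "'a list \<Rightarrow> 'r"
  assume f: "f \<in> homogeneous X n" and g: "g \<in> homogeneous X n" and eq: "cls f = cls g"
  then show "\<exists>h\<in>homogeneous X n. cls f = cls (\<lambda>w. g w + (h w + h w))"
    using zero_homogeneous[of X n] by (intro bexI[of _ "\<lambda>w. 0"]) simp_all
next
  fix n and f g :: "'a list \<Rightarrow> 'r"
  assume f: "f \<in> homogeneous X n" and g: "g \<in> homogeneous X n"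
  then show "cls f \<otimes>\<^bsub>gcomp \<lparr>gcomp = tq_comp V (quadratic_relations V P),
      gtop = (\<lambda>n. cls (word [t]) [^]\<^bsub>Q\<^esub> n), gunit = \<one>\<^bsub>Q\<^esub>,
      gprod = (\<lambda>n m x y. x \<otimes>\<^bsub>Q\<^esub> y)\<rparr> n\<^esub> cls g = cls (\<lambda>w. f w + g w)"
    using cls_add[OF homogeneous_carrier[OF f] homogeneous_carrier[OF g]] by (simp add: grade_simps)
next
  fix n m and f g :: "'a list \<Rightarrow> 'r"
  assume f: "f \<in> homogeneous X n" and g: "g \<in> homogeneous X m"
  then show "gprod \<lparr>gcomp = tq_comp V (quadratic_relations V P),
      gtop = (\<lambda>n. cls (word [t]) [^]\<^bsub>Q\<^esub> n), gunit = \<one>\<^bsub>Q\<^esub>,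
      gprod = (\<lambda>n m x y. x \<otimes>\<^bsub>Q\<^esub> y)\<rparr> n m (cls f) (cls g) = cls (conv f g)"
    using cls_conv[OF homogeneous_carrier[OF f] homogeneous_carrier[OF g]] by simp
next
  fix f g :: "'a list \<Rightarrow> 'r" assume fg: "f \<in> homogeneous X 0" "g \<in> homogeneous X 0"
  show "cls f = cls g \<longleftrightarrow> c (f []) = c (g [])"
    using degree_zero_cls[OF fg] zero_homogeneous[of X 0, where 'b = 'r] by (auto simp: two)
next
  fix x y assume xy: "x \<in> X" "y \<in> X"
  have "(\<lambda>w. - word [y, x] w) = (word [y, x] :: _ \<Rightarrow> 'r)"
    using minus_unique[OF two] by auto
  then show "cls (word [x, y]) = cls (word [y, x])"
    using anticommute[OF V_t_in hyperbolic xy] by simp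
qed (simp_all add: two onto V_t_in V_zero_in V_zero_add V_smult_eq carrier_grade grade_simps cls_zero cls_one
    cls_replicate)

section \<open>Reduction of a graded quotient modulo 2\<close>

definition doubles :: "nat \<Rightarrow> ('a list \<Rightarrow> 'r) set set set" where
  "doubles n = (\<lambda>x. x \<otimes>\<^bsub>grade n\<^esub> x) ` carrier (grade n)"

text \<open>\<open>doubles\<close> and \<open>residue\<close> are \<open>twice_K\<close> and
  \<open>kmult_class\<close> for a general tensor quotient.\<close>

definition residue :: "nat \<Rightarrow> ('a list \<Rightarrow> 'r) set set \<Rightarrow> ('a list \<Rightarrow> 'r) set set set" where
  "residue n x = doubles n #>\<^bsub>grade n\<^esub> x"

lemma doubles_subgroup: "subgroup (doubles n) (grade n)"
proof -
  interpret G: comm_group "grade n" by (rule grade_group)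
  show ?thesis
  proof (rule G.subgroupI)
    show "doubles n \<subseteq> carrier (grade n)" unfolding doubles_def by (auto intro: G.m_closed)
    show "doubles n \<noteq> {}" unfolding doubles_def using G.one_closed by blast
    fix a assume "a \<in> doubles n"
    then obtain x where x: "x \<in> carrier (grade n)" "a = x \<otimes>\<^bsub>grade n\<^esub> x" unfolding doubles_def by blast
    then show "inv\<^bsub>grade n\<^esub> a \<in> doubles n"
      unfolding doubles_def using G.inv_mult[OF x(1) x(1)] G.inv_closed[OF x(1)] by auto
    fix b assume "b \<in> doubles n"
    then obtain y where y: "y \<in> carrier (grade n)" "b = y \<otimes>\<^bsub>grade n\<^esub> y" unfolding doubles_def by blast
    have "a \<otimes>\<^bsub>grade n\<^esub> b = (x \<otimes>\<^bsub>grade n\<^esub> y) \<otimes>\<^bsub>grade n\<^esub> (x \<otimes>\<^bsub>grade n\<^esub> y)"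
      using x y by (simp only: G.m_ac G.m_closed)
    then show "a \<otimes>\<^bsub>grade n\<^esub> b \<in> doubles n"
      unfolding doubles_def using G.m_closed[OF x(1) y(1)] by blast
  qed
qed

lemma residue_mem:
  assumes "y \<in> residue n x" "x \<in> carrier (grade n)"
  shows "y \<in> carrier (grade n)" "residue n y = residue n x"
proof -
  interpret G: comm_group "grade n" by (rule grade_group)
  show "y \<in> carrier (grade n)"
    using assms G.r_coset_subset_G[OF subgroup.subset[OF doubles_subgroup]] unfolding residue_def by blast
  show "residue n y = residue n x"
    using assms unfolding residue_def by (intro G.repr_independence[OF _ _ doubles_subgroup, symmetric])
qed

lemma residue_self: "x \<in> carrier (grade n) \<Longrightarrow> x \<in> residue n x"
  unfolding residue_def
  using group.rcos_self[OF comm_group.axioms(2)[OF grade_group] _ doubles_subgroup] .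

lemma cls_grade: "f \<in> homogeneous X n \<Longrightarrow> cls f \<in> carrier (grade n)"
  unfolding carrier_grade by blast

lemma cls_add_double:
  assumes "g \<in> homogeneous X n" "h \<in> homogeneous X n"
  shows "cls (\<lambda>w. g w + (h w + h w)) = (cls h \<otimes>\<^bsub>grade n\<^esub> cls h) \<otimes>\<^bsub>grade n\<^esub> cls g"
proof -
  note c = homogeneous_carrier[OF assms(1)] homogeneous_carrier[OF assms(2)]
    homogeneous_carrier[OF add_homogeneous[OF assms(2) assms(2)]]
  show ?thesis unfolding grade_simps cls_add[OF c(1,3)] cls_add[OF c(2,2)]
    using cls.hom_closed[OF c(1)] cls.hom_closed[OF c(2)] by (intro Q.a_comm Q.a_closed)
qed

lemma residue_eq_iff:
  assumes f: "f \<in> homogeneous X n" and g: "g \<in> homogeneous X n"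
  shows "residue n (cls f) = residue n (cls g) \<longleftrightarrow>
    (\<exists>h\<in>homogeneous X n. cls f = cls (\<lambda>w. g w + (h w + h w)))"
proof
  assume "residue n (cls f) = residue n (cls g)"
  then have "cls f \<in> residue n (cls g)" using residue_self[OF cls_grade[OF f]] by simp
  then obtain x where "x \<in> carrier (grade n)" "cls f = (x \<otimes>\<^bsub>grade n\<^esub> x) \<otimes>\<^bsub>grade n\<^esub> cls g"
    unfolding residue_def r_coset_def doubles_def by blast
  then show "\<exists>h\<in>homogeneous X n. cls f = cls (\<lambda>w. g w + (h w + h w))"
    using cls_add_double[OF g] unfolding carrier_grade by auto
next
  assume "\<exists>h\<in>homogeneous X n. cls f = cls (\<lambda>w. g w + (h w + h w))"
  then obtain h where h: "h \<in> homogeneous X n" "cls f = (cls h \<otimes>\<^bsub>grade n\<^esub> cls h) \<otimes>\<^bsub>grade n\<^esub> cls g"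
    using cls_add_double[OF g] by auto
  then have "cls f \<in> residue n (cls g)"
    unfolding residue_def r_coset_def doubles_def using cls_grade[OF h(1)] by blast
  then show "residue n (cls f) = residue n (cls g)" by (rule residue_mem(2)[OF _ cls_grade[OF g]])
qed

text \<open>The union runs over all representatives; it is a single residue because changing factors
  by doubles changes the product by a double.\<close>

lemma residue_conv:
  assumes f: "f \<in> homogeneous X n" and g: "g \<in> homogeneous X m"
  shows "(\<Union>x\<in>residue n (cls f). \<Union>y\<in>residue m (cls g). residue (n + m) (x \<otimes>\<^bsub>Q\<^esub> y)) =
    residue (n + m) (cls (conv f g))"
proof -
  have "residue (n + m) (x \<otimes>\<^bsub>Q\<^esub> y) = residue (n + m) (cls (conv f g))"
    if x: "x \<in> residue n (cls f)" and y: "y \<in> residue m (cls g)" for x y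
  proof -
    obtain f' where f': "f' \<in> homogeneous X n" "x = cls f'"
      using residue_mem(1)[OF x cls_grade[OF f]] unfolding carrier_grade by blast
    obtain g' where g': "g' \<in> homogeneous X m" "y = cls g'"
      using residue_mem(1)[OF y cls_grade[OF g]] unfolding carrier_grade by blast
    obtain h where h: "h \<in> homogeneous X n" "cls f' = cls (\<lambda>w. f w + (h w + h w))"
      using residue_mem(2)[OF x cls_grade[OF f]] residue_eq_iff[OF f'(1) f] f'(2) by blast
    obtain k where k: "k \<in> homogeneous X m" "cls g' = cls (\<lambda>w. g w + (k w + k w))"
      using residue_mem(2)[OF y cls_grade[OF g]] residue_eq_iff[OF g'(1) g] g'(2) by blast
    \<comment> \<open>The cross terms: \<open>(f + 2h)(g + 2k) = fg + 2z\<close>.\<close>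
    define z where "z = (\<lambda>w. conv f k w + (conv h g w + (conv h k w + conv h k w)))"
    have z: "z \<in> homogeneous X (n + m)"
      unfolding z_def by (intro add_homogeneous conv_homogeneous f g h(1) k(1))
    have F: "(\<lambda>w. f w + (h w + h w)) \<in> homogeneous X n" "(\<lambda>w. g w + (k w + k w)) \<in> homogeneous X m"
      by (intro add_homogeneous f g h(1) k(1))+
    have "x \<otimes>\<^bsub>Q\<^esub> y = cls (conv (\<lambda>w. f w + (h w + h w)) (\<lambda>w. g w + (k w + k w)))"
      unfolding f'(2) g'(2) h(2) k(2)
      by (rule cls_conv[OF homogeneous_carrier[OF F(1)] homogeneous_carrier[OF F(2)], symmetric])
    also have "conv (\<lambda>w. f w + (h w + h w)) (\<lambda>w. g w + (k w + k w)) = (\<lambda>w. conv f g w + (z w + z w))"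
      unfolding z_def by (simp only: conv_add_left conv_add_right add_ac)
    finally have xy: "x \<otimes>\<^bsub>Q\<^esub> y = cls (\<lambda>w. conv f g w + (z w + z w))" .
    have fg: "conv f g \<in> homogeneous X (n + m)" by (rule conv_homogeneous[OF f g])
    have "\<exists>h\<in>homogeneous X (n + m). cls (\<lambda>w. conv f g w + (z w + z w)) = cls (\<lambda>w. conv f g w + (h w + h w))"
      by (rule bexI[OF refl z])
    then show ?thesis
      unfolding xy by (rule residue_eq_iff[OF add_homogeneous[OF fg add_homogeneous[OF z z]] fg, THEN iffD2])
  qed
  then show ?thesis
    using residue_self[OF cls_grade[OF f]] residue_self[OF cls_grade[OF g]] by auto
qed

lemma tensor_presentation_mod_two:
  "tensor_presentation c V P t
    \<lparr>gcomp = (\<lambda>n. grade n Mod doubles n), gtop = (\<lambda>n. residue n (cls (word [t]) [^]\<^bsub>Q\<^esub> n)),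
      gunit = residue 0 \<one>\<^bsub>Q\<^esub>, gprod = (\<lambda>n m X Y. \<Union>x\<in>X. \<Union>y\<in>Y. residue (n + m) (x \<otimes>\<^bsub>Q\<^esub> y))\<rparr>
    (\<lambda>n f. residue n (cls f))"
proof unfold_locales
  fix n and f g :: "'a list \<Rightarrow> 'r"
  assume f: "f \<in> homogeneous X n" and g: "g \<in> homogeneous X n"
  show "cls f = cls g \<Longrightarrow> residue n (cls f) = residue n (cls g)" by simp
  show "residue n (cls f) = residue n (cls g) \<Longrightarrow> \<exists>h\<in>homogeneous X n. cls f = cls (\<lambda>w. g w + (h w + h w))"
    using residue_eq_iff[OF f g] by blast
  interpret G: comm_group "grade n" by (rule grade_group)
  have "doubles n \<lhd> grade n" using doubles_subgroup G.normal_iff_subgroup by blast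
  then interpret N: normal "doubles n" "grade n" .
  have "residue n (cls f) <#>\<^bsub>grade n\<^esub> residue n (cls g) = residue n (cls (\<lambda>w. f w + g w))"
    unfolding residue_def N.rcos_sum[OF cls_grade[OF f] cls_grade[OF g]]
    by (simp only: grade_simps cls_add[OF homogeneous_carrier[OF f] homogeneous_carrier[OF g]])
  then show "residue n (cls f) \<otimes>\<^bsub>gcomp \<lparr>gcomp = (\<lambda>n. grade n Mod doubles n), gtop = (\<lambda>n. residue n (cls (word [t]) [^]\<^bsub>Q\<^esub> n)),
      gunit = residue 0 \<one>\<^bsub>Q\<^esub>, gprod = (\<lambda>n m X Y. \<Union>x\<in>X. \<Union>y\<in>Y. residue (n + m) (x \<otimes>\<^bsub>Q\<^esub> y))\<rparr> n\<^esub> residue n (cls g) =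
      residue n (cls (\<lambda>w. f w + g w))" by simp
next
  fix n
  interpret G: comm_group "grade n" by (rule grade_group)
  show "gcar \<lparr>gcomp = (\<lambda>n. grade n Mod doubles n), gtop = (\<lambda>n. residue n (cls (word [t]) [^]\<^bsub>Q\<^esub> n)),
      gunit = residue 0 \<one>\<^bsub>Q\<^esub>, gprod = (\<lambda>n m X Y. \<Union>x\<in>X. \<Union>y\<in>Y. residue (n + m) (x \<otimes>\<^bsub>Q\<^esub> y))\<rparr> n =
      (\<lambda>f. residue n (cls f)) ` homogeneous X n"
    by (simp add: carrier_FactGroup carrier_grade residue_def image_image)
  have "residue n (cls (\<lambda>w. 0)) = doubles n"
    unfolding residue_def cls_zero grade_simps(2)[of n, symmetric]
    by (rule G.coset_mult_one[OF subgroup.subset[OF doubles_subgroup]])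
  then show "\<one>\<^bsub>gcomp \<lparr>gcomp = (\<lambda>n. grade n Mod doubles n), gtop = (\<lambda>n. residue n (cls (word [t]) [^]\<^bsub>Q\<^esub> n)),
      gunit = residue 0 \<one>\<^bsub>Q\<^esub>, gprod = (\<lambda>n m X Y. \<Union>x\<in>X. \<Union>y\<in>Y. residue (n + m) (x \<otimes>\<^bsub>Q\<^esub> y))\<rparr> n\<^esub> =
      residue n (cls (\<lambda>w. 0))" by simp
  fix f :: "'a list \<Rightarrow> 'r" assume f: "f \<in> homogeneous X n"
  have "cls (\<lambda>w. f w + f w) = cls (\<lambda>w. 0 + (f w + f w))" by simp
  then show "residue n (cls (\<lambda>w. f w + f w)) = residue n (cls (\<lambda>w. 0))"
    using residue_eq_iff[OF add_homogeneous[OF f f] zero_homogeneous] f by blast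
next
  fix f g :: "'a list \<Rightarrow> 'r" assume fg: "f \<in> homogeneous X 0" "g \<in> homogeneous X 0"
  show "residue 0 (cls f) = residue 0 (cls g) \<longleftrightarrow> c (f []) = c (g [])"
    using degree_zero_cls[OF fg] residue_eq_iff[OF fg] by simp
next
  fix x y assume xy: "x \<in> X" "y \<in> X"
  \<comment> \<open>Anticommutation gives commutation modulo 2 since
    \<open>-yx = yx + 2(-yx)\<close>; this dictates the choice of \<open>?h\<close>.\<close>
  let ?h = "\<lambda>w. - word [y, x] w :: 'r"
  have "cls (word [x, y]) = cls (\<lambda>w. word [y, x] w + (?h w + ?h w))"
    using anticommute[OF V_t_in hyperbolic xy] by simp
  then have "\<exists>h\<in>homogeneous X 2. cls (word [x, y]) = cls (\<lambda>w. word [y, x] w + (h w + h w))"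
    by (rule bexI[of _ ?h]) (rule uminus_homogeneous[OF word2_homogeneous[OF xy(2,1)]])
  then show "residue 2 (cls (word [x, y])) = residue 2 (cls (word [y, x]))"
    by (rule residue_eq_iff[OF word2_homogeneous[OF xy] word2_homogeneous[OF xy(2,1)], THEN iffD2])
qed (simp_all add: onto V_t_in V_zero_in V_zero_add V_smult_eq cls_one cls_replicate residue_conv)

end

section \<open>Products of two generators\<close>

context tensor_presentation
begin

abbreviation gen_prod :: "'a \<Rightarrow> 'a \<Rightarrow> 'b" where
  "gen_prod x y \<equiv> gprod R 1 1 (\<kappa> 1 (word [x])) (\<kappa> 1 (word [y]))"

lemma gen_prod_eq: "x \<in> X \<Longrightarrow> y \<in> X \<Longrightarrow> gen_prod x y = \<kappa> 2 (word [x, y])"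
  using prod_eq[OF word1_homogeneous word1_homogeneous] by (simp add: conv_word_word numeral_2_eq_2)

lemma gen_prod_commute: "x \<in> X \<Longrightarrow> y \<in> X \<Longrightarrow> gen_prod x y = gen_prod y x"
  using generators_commute by (simp only: gen_prod_eq)

lemma gen_prod_zeroI:
  assumes ab: "a \<in> X" "b \<in> X" and "cls (word [a]) \<otimes>\<^bsub>Q\<^esub> cls (word [b]) = \<zero>\<^bsub>Q\<^esub>"
  shows "gen_prod a b = \<one>\<^bsub>gcomp R 2\<^esub>"
proof -
  have "word [a, b] \<in> homogeneous X 2"
    using word_homogeneous[of "[a, b]" X] ab by (simp add: numeral_2_eq_2)
  then have "\<kappa> 2 (word [a, b]) = \<kappa> 2 (\<lambda>w. 0)"
    using assms(3) cls_conv[OF word1[OF ab(1)] word1[OF ab(2)]] cls_zero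
    by (intro kappa_cls zero_homogeneous) (simp_all add: conv_word_word)
  then show ?thesis using ab by (simp only: gen_prod_eq zero_eq)
qed

lemma kappa_gen_relation:
  assumes "(a, b) \<in> P"
  shows "gen_prod a b = \<one>\<^bsub>gcomp R 2\<^esub>"
  using gen_prod_zeroI[OF _ _ gen_relation[OF assms]] assms P_subset by auto

lemma gen_prod_add:
  assumes "x \<in> X" "y \<in> X" "z \<in> X"
  shows "gen_prod x (y \<oplus>\<^bsub>V\<^esub> z) = gen_prod x y \<otimes>\<^bsub>gcomp R 2\<^esub> gen_prod x z"
proof -
  have "\<forall>n m. \<forall>x\<in>gcar R n. \<forall>y\<in>gcar R m. \<forall>y'\<in>gcar R m.
      gprod R n m x (y \<otimes>\<^bsub>gcomp R m\<^esub> y') = gprod R n m x y \<otimes>\<^bsub>gcomp R (n + m)\<^esub> gprod R n m x y'"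
    by (insert commutative_graded_ring[unfolded commutative_graded_ring_def], elim conjE, assumption)
  then show ?thesis
    unfolding kappa_gen_add[OF assms(2,3)] one_add_one[symmetric]
    using kappa_gen_closed[OF assms(1)] kappa_gen_closed[OF assms(2)] kappa_gen_closed[OF assms(3)] by blast
qed

lemma gen_prod_closed: "x \<in> X \<Longrightarrow> y \<in> X \<Longrightarrow> gen_prod x y \<in> gcar R 2"
  using kappa_closed[of "word [x, y]" 2] word_homogeneous[of "[x, y]" X]
  by (simp only: gen_prod_eq) (simp add: numeral_2_eq_2)

lemma gen_prod_cancel:
  assumes "x \<in> X" "y \<in> X" "z \<in> X" and "gen_prod x y = \<one>\<^bsub>gcomp R 2\<^esub>"
  shows "gen_prod x (y \<oplus>\<^bsub>V\<^esub> z) = gen_prod x z"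
proof -
  interpret R2: comm_group "gcomp R 2" by (rule comm_group_gcomp)
  show ?thesis
    unfolding gen_prod_add[OF assms(1-3)] assms(4) by (rule R2.l_one[OF gen_prod_closed[OF assms(1,3)]])
qed

text \<open>\<open>K_pairs\<close> has no pair whose first entry is one. In that case the module
  zero is involved, and the product vanishes by additivity and cancellation.\<close>

lemma gen_prod_zero:
  assumes "x \<in> X"
  shows "gen_prod x \<zero>\<^bsub>V\<^esub> = \<one>\<^bsub>gcomp R 2\<^esub>" "gen_prod \<zero>\<^bsub>V\<^esub> x = \<one>\<^bsub>gcomp R 2\<^esub>"
proof -
  interpret R2: comm_group "gcomp R 2" by (rule comm_group_gcomp)
  show "gen_prod x \<zero>\<^bsub>V\<^esub> = \<one>\<^bsub>gcomp R 2\<^esub>"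
    using gen_prod_add[OF assms zero_in zero_in] gen_prod_closed[OF assms zero_in]
    unfolding zero_add by (simp only: R2.l_cancel_one')
  then show "gen_prod \<zero>\<^bsub>V\<^esub> x = \<one>\<^bsub>gcomp R 2\<^esub>"
    using gen_prod_commute[OF assms zero_in] by simp
qed

lemma top_zero: "gtop R 0 = gunit R"
  by (simp add: top_eq unit_eq)

end

lemma word_product_map: "word_product S (\<lambda>x. \<delta> (g x)) w = word_product S \<delta> (map g w)"
  by (induction w) auto

section \<open>The category of inductive graded rings\<close>

lemma inductive_graded_ring_closed:
  assumes "inductive_graded_ring R"
  shows "comm_group (gcomp R n)" "gtop R n \<in> gcar R n" "gunit R \<in> gcar R 0"
    "x \<in> gcar R n \<Longrightarrow> y \<in> gcar R m \<Longrightarrow> gprod R n m x y \<in> gcar R (n + m)"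
proof -
  have c: "commutative_graded_ring R" and "\<forall>n. gtop R n \<in> gcar R n"
    by (insert assms[unfolded inductive_graded_ring_def], elim conjE, assumption)+
  then show "gtop R n \<in> gcar R n" by blast
  have "\<forall>n. comm_group (gcomp R n)"
    and "\<forall>n m. \<forall>x\<in>gcar R n. \<forall>y\<in>gcar R m. gprod R n m x y \<in> gcar R (n + m)"
    and "gunit R \<in> gcar R 0"
    by (insert c[unfolded commutative_graded_ring_def], elim conjE, assumption)+
  then show "comm_group (gcomp R n)" "gunit R \<in> gcar R 0"
    "x \<in> gcar R n \<Longrightarrow> y \<in> gcar R m \<Longrightarrow> gprod R n m x y \<in> gcar R (n + m)" by auto
qed

lemma igr_homD:
  assumes "f \<in> igr_hom R S"
  shows "f n \<in> hom (gcomp R n) (gcomp S n)" "f n \<in> extensional (gcar R n)"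
    "x \<in> gcar R n \<Longrightarrow> f n x \<in> gcar S n"
    "x \<in> gcar R n \<Longrightarrow> y \<in> gcar R m \<Longrightarrow> f (n + m) (gprod R n m x y) = gprod S n m (f n x) (f m y)"
    "f 0 (gunit R) = gunit S" "f n (gtop R n) = gtop S n"
  using assms unfolding igr_hom_def hom_def by auto

lemma igr_id_hom:
  assumes R: "inductive_graded_ring R"
  shows "igr_id R \<in> igr_hom R R"
proof -
  note closed = inductive_graded_ring_closed[OF R]
  have "x \<otimes>\<^bsub>gcomp R n\<^esub> y \<in> gcar R n" if "x \<in> gcar R n" "y \<in> gcar R n" for n x y
    using comm_group.axioms(1)[OF closed(1)] that
    by (meson comm_monoid.axioms(1) monoid.m_closed)
  then show ?thesis
    using closed by (auto simp: igr_hom_def igr_id_def hom_def)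
qed

lemma igr_comp_hom:
  assumes R: "inductive_graded_ring R" and f: "f \<in> igr_hom R S" and g: "g \<in> igr_hom S T"
  shows "igr_comp R g f \<in> igr_hom R T"
proof -
  note closed = inductive_graded_ring_closed[OF R]
  have "igr_comp R g f n \<in> hom (gcomp R n) (gcomp T n)" for n
    unfolding igr_comp_def
    using group.hom_compose[OF comm_group.axioms(2)[OF closed(1)] igr_homD(1)[OF f] igr_homD(1)[OF g]] .
  moreover have "igr_comp R g f (n + m) (gprod R n m x y) =
      gprod T n m (igr_comp R g f n x) (igr_comp R g f m y)"
    if "x \<in> gcar R n" "y \<in> gcar R m" for n m x y
    using that closed(4) igr_homD[OF f] igr_homD[OF g] by (simp add: igr_comp_def compose_def)
  moreover have "igr_comp R g f 0 (gunit R) = gunit T" "igr_comp R g f n (gtop R n) = gtop T n" for n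
    using closed(2,3) igr_homD(5,6)[OF f] igr_homD(5,6)[OF g] by (simp_all add: igr_comp_def compose_def)
  ultimately show ?thesis unfolding igr_hom_def by (auto simp: igr_comp_def)
qed

lemma Igr_simps [simp]: "Obj Igr = Collect inductive_graded_ring" "Hom Igr = igr_hom"
  "Idn Igr = igr_id" "Cmp Igr = (\<lambda>R S T g f. igr_comp R g f)"
  by (simp_all add: Igr_def)

lemma category_Igr: "is_category (Igr :: ('a igr, nat \<Rightarrow> 'a \<Rightarrow> 'a) category)"
  unfolding is_category_def Igr_simps
proof (intro conjI ballI)
  fix R S :: "'a igr" and f
  assume f: "f \<in> igr_hom R S"
  show "igr_comp R f (igr_id R) = f"
    using compose_restrict_id(1)[OF igr_homD(2)[OF f]] by (auto simp: igr_comp_def igr_id_def)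
  show "igr_comp R (igr_id S) f = f"
    using compose_restrict_id(2)[OF _ igr_homD(2)[OF f]] igr_homD(3)[OF f]
    by (auto simp: igr_comp_def igr_id_def)
next
  fix R S T U :: "'a igr" and f g h
  assume f: "f \<in> igr_hom R S" and g: "g \<in> igr_hom S T" and "h \<in> igr_hom T U"
  have fn: "f n \<in> gcar R n \<rightarrow> gcar S n" for n using igr_homD(3)[OF f] by blast
  show "igr_comp R h (igr_comp R g f) = igr_comp R (igr_comp S h g) f"
    unfolding igr_comp_def by (rule ext) (rule compose_assoc[OF fn])
qed (auto intro: igr_id_hom igr_comp_hom)

section \<open>The K-theories of a special group\<close>

lemma of_int_bit_eq_0: "(of_int k :: bit) = 0 \<longleftrightarrow> even k"
proof (cases "even k")
  case True
  then obtain m where "k = m + m" by (metis dvd_def mult_2)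
  then have "(of_int k :: bit) = 0" by (simp only: of_int_add bit_add_self)
  then show ?thesis using True by simp
next
  case False
  then obtain m where "k = m + m + 1" by (metis oddE mult_2)
  then have "(of_int k :: bit) = 1" by (simp only: of_int_add bit_add_self of_int_1 add_0)
  then show ?thesis using False by simp
qed

definition kdm_pairs :: "'a special_group \<Rightarrow> ('a \<times> 'a) set" where
  "kdm_pairs G = {(a, a \<otimes>\<^bsub>G\<^esub> b) | a b. a \<in> carrier G \<and> b \<in> carrier G \<and> a \<in> srep G \<one>\<^bsub>G\<^esub> b}"

definition K_pairs :: "'a multiring \<Rightarrow> ('a \<times> 'a) set" where
  "K_pairs F = {(a, b) | a b. a \<in> carrier F \<and> a \<noteq> hzero F \<and> a \<noteq> \<one>\<^bsub>F\<^esub> \<and> b \<in> hadd F \<one>\<^bsub>F\<^esub> (hneg F a)}"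

lemma kdm_relations_eq: "kdm_relations G = quadratic_relations (k1 G) (kdm_pairs G)"
  unfolding kdm_relations_def quadratic_relations_def kdm_pairs_def by blast

lemma K_relations_eq: "K_relations F = quadratic_relations (K1 F) (K_pairs F)"
  unfolding K_relations_def quadratic_relations_def K_pairs_def by blast

lemma additive_module_simps [simp]:
  "carrier (additive_module s B) = carrier B" "add (additive_module s B) = mult B"
  "zero (additive_module s B) = one B" "smult (additive_module s B) = s"
  by (simp_all add: additive_module_def)

lemma nonzero_simps [simp]:
  "carrier (nonzero F) = carrier F - {hzero F}" "mult (nonzero F) = mult F" "one (nonzero F) = one F"
  by (simp_all add: nonzero_def)

section \<open>Both K-theories as rings presented by words\<close>

context special
begin

lemma srep_one_sneg: "srep G \<one> (sneg G) = carrier G"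
  using srep_hyperbolic[of \<one>] by (simp add: sminus_def)

lemma k1_simps: "carrier (k1 G) = carrier G" "add (k1 G) = mult G" "zero (k1 G) = \<one>"
  "smult (k1 G) = (\<lambda>c a. if c = 0 then \<one> else a)"
  by (simp_all add: k1_def)

lemma K1_carrier: "carrier (K1 (M G)) = Some ` carrier G" and K1_add: "add (K1 (M G)) = M_mult G"
  and K1_zero: "zero (K1 (M G)) = Some \<one>"
  by (auto simp: K1_def)

text \<open>In exponent 2 an integer power depends only on the parity of the exponent, so the
  integers act through \<open>of_int\<close> to \<open>bit\<close>.\<close>

lemma K1_smult:
  assumes "x \<in> carrier (K1 (M G))"
  shows "k \<odot>\<^bsub>K1 (M G)\<^esub> x = (if (of_int k :: bit) = 0 then Some \<one> else x)"
proof -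
  let ?N = "nonzero (M G)"
  interpret N: comm_group ?N
    by (rule comm_groupI) (auto simp: m_assoc intro: m_comm)
  have x: "x \<in> carrier ?N" "x \<otimes>\<^bsub>?N\<^esub> x = \<one>\<^bsub>?N\<^esub>" using assms by (auto simp: K1_carrier)
  have x2: "x [^]\<^bsub>?N\<^esub> (m + m) = \<one>\<^bsub>?N\<^esub>" for m :: int
  proof -
    have "x [^]\<^bsub>?N\<^esub> (m + m) = x [^]\<^bsub>?N\<^esub> m \<otimes>\<^bsub>?N\<^esub> x [^]\<^bsub>?N\<^esub> m" by (rule N.int_pow_mult[OF x(1)])
    also have "\<dots> = (x \<otimes>\<^bsub>?N\<^esub> x) [^]\<^bsub>?N\<^esub> m" by (rule N.int_pow_distrib[OF x(1) x(1), symmetric])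
    finally show ?thesis unfolding x(2) by (simp only: N.int_pow_one)
  qed
  have "x [^]\<^bsub>?N\<^esub> k = (if even k then \<one>\<^bsub>?N\<^esub> else x)"
  proof (cases "even k")
    case True
    then obtain m where "k = m + m" by (metis dvd_def mult_2)
    then show ?thesis using True x2 by simp
  next
    case False
    then obtain m where "k = m + m + 1" by (metis oddE mult_2)
    then show ?thesis using False x2 N.int_pow_mult[OF x(1), of "m + m" 1] N.l_one[OF x(1)] N.int_pow_1[OF x(1)]
      by (simp only: if_False)
  qed
  then show ?thesis by (simp add: K1_def of_int_bit_eq_0)
qed

sublocale dm: tensor_quotient id "k1 G" "kdm_pairs G"
  by unfold_locales (auto simp: k1_simps kdm_pairs_def)

sublocale dm: tensor_hyperbolic id "k1 G" "kdm_pairs G" "sneg G"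
proof unfold_locales
  fix x assume x: "x \<in> carrier (k1 G)"
  \<comment> \<open>This is the defining relation with \<open>b = -1\<close>: the form
    \<open>\<langle>1, -1\<rangle>\<close> represents every \<open>x\<close>.\<close>
  then have "(x, x \<otimes> sneg G) \<in> kdm_pairs G"
    unfolding kdm_pairs_def using srep_one_sneg by (auto simp: k1_simps)
  then show "dm.cls (word [x]) \<otimes>\<^bsub>dm.Q\<^esub> dm.cls (word [sneg G \<oplus>\<^bsub>k1 G\<^esub> x]) = \<zero>\<^bsub>dm.Q\<^esub>"
    using dm.gen_relation x m_comm[of x "sneg G"] by (simp add: k1_simps)
qed (auto simp: k1_simps surj_of_int_bit)

lemma kdm_eq:
  "kdm G = \<lparr>gcomp = tq_comp (k1 G) (quadratic_relations (k1 G) (kdm_pairs G)),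
    gtop = (\<lambda>n. dm.cls (word [sneg G]) [^]\<^bsub>dm.Q\<^esub> n), gunit = \<one>\<^bsub>dm.Q\<^esub>,
    gprod = (\<lambda>n m x y. x \<otimes>\<^bsub>dm.Q\<^esub> y)\<rparr>"
  by (simp add: kdm_def kdm_ring_def lam_def kdm_relations_eq dm.gen_eq)

sublocale dmp: tensor_presentation id "k1 G" "kdm_pairs G" "sneg G" "kdm G" "\<lambda>n. dm.cls"
  unfolding kdm_eq by (rule dm.tensor_presentation_char_two) simp

lemma K_pairsE:
  assumes "(x, y) \<in> K_pairs (M G)"
  obtains a b where "x = Some a" "y = Some b" "a \<in> carrier G" "b \<in> carrier G" "a \<noteq> \<one>"
    "b \<in> srep G \<one> (sminus G a)"
proof -
  from assms have x: "x \<in> carrier (M G)" "x \<noteq> None" "x \<noteq> Some \<one>"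
    "y \<in> M_add G (Some \<one>) (map_option (sminus G) x)"
    unfolding K_pairs_def by (simp_all del: M_simps(1))
  then obtain a where "x = Some a" "a \<in> carrier G" by auto
  then have a: "x = Some a" "a \<in> carrier G" "a \<noteq> \<one>" "y \<in> M_add G (Some \<one>) (Some (sminus G a))"
    using x by (simp_all del: M_add.simps)
  \<comment> \<open>Since \<open>a \<noteq> 1\<close>, the sum \<open>1 - a\<close> is not the
    hyperbolic one. It therefore omits zero, and \<open>y\<close> is a non-zero element.\<close>
  have "sminus G a \<noteq> sminus G \<one>"
    using a(2,3) sminus_sminus by (metis one_closed)
  then obtain b where b: "y = Some b" "b \<in> srep G \<one> (sminus G a)" using a(4) by auto
  then show ?thesis using that a srepD(1) sminus_closed one_closed by metis
qed

lemma K_pairsI: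
  "a \<in> carrier G \<Longrightarrow> a \<noteq> \<one> \<Longrightarrow> b \<in> srep G \<one> (sminus G a) \<Longrightarrow> (Some a, Some b) \<in> K_pairs (M G)"
  unfolding K_pairs_def using M_add_Some[of \<one> "sminus G a" b] by (auto simp del: M_add.simps)

sublocale mult: tensor_quotient "of_int :: int \<Rightarrow> bit" "K1 (M G)" "K_pairs (M G)"
proof unfold_locales
  show "K_pairs (M G) \<subseteq> carrier (K1 (M G)) \<times> carrier (K1 (M G))"
    by (auto simp: K1_carrier elim: K_pairsE)
qed (auto simp: K1_carrier K1_add K1_smult)

sublocale mult: tensor_hyperbolic "of_int :: int \<Rightarrow> bit" "K1 (M G)" "K_pairs (M G)" "Some (sneg G)"
proof unfold_locales
  fix x assume "x \<in> carrier (K1 (M G))"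
  then obtain a where a: "x = Some a" "a \<in> carrier G" by (auto simp: K1_carrier)
  have eq: "Some (sneg G) \<oplus>\<^bsub>K1 (M G)\<^esub> x = Some (sminus G a)" by (simp add: K1_add a sminus_def)
  have gen: "mult.cls (word [Some b]) \<in> carrier mult.Q" if "b \<in> carrier G" for b
    using that mult.word1[of "Some b"] by (intro mult.cls.hom_closed) (simp add: K1_carrier)
  show "mult.cls (word [x]) \<otimes>\<^bsub>mult.Q\<^esub> mult.cls (word [Some (sneg G) \<oplus>\<^bsub>K1 (M G)\<^esub> x]) = \<zero>\<^bsub>mult.Q\<^esub>"
  proof (cases "a = \<one>")
    case True
    \<comment> \<open>No relation is available for \<open>a = 1\<close>, but
      \<open>1 = 1 \<cdot> 1\<close> makes the class of this generator equal to its own double,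
      hence zero.\<close>
    have "mult.cls (word [Some \<one>]) = mult.cls (word [Some \<one>]) \<oplus>\<^bsub>mult.Q\<^esub> mult.cls (word [Some \<one>])"
      using mult.gen_add[of "Some \<one>" "Some \<one>"] by (simp add: K1_carrier K1_add)
    then have "mult.cls (word [x]) = \<zero>\<^bsub>mult.Q\<^esub>"
      unfolding a(1) True using gen[OF one_closed] by (metis mult.Q.add.l_cancel_one')
    then show ?thesis unfolding eq using gen[OF sminus_closed[OF a(2)]] by simp
  next
    case False
    then have "(x, Some (sminus G a)) \<in> K_pairs (M G)"
      unfolding a(1) using a(2) by (intro K_pairsI srep_right) auto
    then show ?thesis unfolding eq by (rule mult.gen_relation)
  qed
next
  fix r :: int assume "(of_int r :: bit) = 0"
  then show "\<exists>k. r = k + k" by (auto simp: of_int_bit_eq_0 elim!: evenE)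
qed (auto simp: K1_carrier K1_add K1_zero K1_smult)

lemma kmult_class_eq: "kmult_class (M G) n = mult.residue n"
  by (simp add: fun_eq_iff kmult_class_def mult.residue_def mult.doubles_def twice_K_def K_comp_def K_relations_eq)

lemma kmult_eq:
  "kmult (M G) = \<lparr>gcomp = (\<lambda>n. mult.grade n Mod mult.doubles n),
      gtop = (\<lambda>n. mult.residue n (mult.cls (word [Some (sneg G)]) [^]\<^bsub>mult.Q\<^esub> n)),
      gunit = mult.residue 0 \<one>\<^bsub>mult.Q\<^esub>,
      gprod = (\<lambda>n m X Y. \<Union>x\<in>X. \<Union>y\<in>Y. mult.residue (n + m) (x \<otimes>\<^bsub>mult.Q\<^esub> y))\<rparr>"
  by (simp add: kmult_def kmult_class_eq mult.doubles_def[abs_def] twice_K_def K_comp_def K_relations_eq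
      K_ring_def rho_def mult.gen_eq sminus_def)

text \<open>The \<open>\<kappa>\<close> in the presentation of \<open>kmult (M G)\<close>; on the
  word of a list it is the symbol \<open>rho_prod\<close> of that list, by
  \<open>rho_prod_eq\<close>.\<close>

definition mult_symbol :: "nat \<Rightarrow> ('a option list \<Rightarrow> int) \<Rightarrow> ('a option list \<Rightarrow> int) set set set" where
  "mult_symbol n f = mult.residue n (mult.cls f)"

sublocale multp: tensor_presentation "of_int :: int \<Rightarrow> bit" "K1 (M G)" "K_pairs (M G)" "Some (sneg G)"
  "kmult (M G)" mult_symbol
  unfolding kmult_eq mult_symbol_def[abs_def] by (rule mult.tensor_presentation_mod_two)

lemma rho_prod_eq:
  assumes "as \<in> lists (carrier (K1 (M G)))"
  shows "rho_prod (M G) as = mult_symbol (length as) (word as)"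
proof -
  from assms have "foldr (\<lambda>a x. rho (M G) a \<otimes>\<^bsub>K_ring (M G)\<^esub> x) as \<one>\<^bsub>K_ring (M G)\<^esub> = mult.cls (word as)"
  proof (induction as rule: list.induct)
    case Nil
    then show ?case by (simp add: mult.cls_one K_ring_def K_relations_eq)
  next
    case (Cons a as)
    then have "mult.cls (conv (word [a]) (word as)) = mult.cls (word [a]) \<otimes>\<^bsub>mult.Q\<^esub> mult.cls (word as)"
      by (intro mult.cls_conv mult.word1 word_closed) auto
    then show ?case
      using Cons by (simp add: K_ring_def rho_def K_relations_eq mult.gen_eq conv_word_word)
  qed
  then show ?thesis by (simp add: rho_prod_def kmult_class_eq mult_symbol_def)
qed

end

text \<open>\<open>kmult_map\<close> is a definite description. It is evaluated by exhibiting one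
  graded homomorphism with the right values on symbols, uniqueness being
  \<open>hom_unique\<close>.\<close>

lemma kmult_map_eq:
  assumes G: "special G" and H: "special H" and h: "h \<in> igr_hom (kmult (M G)) (kmult (M H))"
    and rho: "\<And>as. as \<in> lists (carrier (nonzero (M G))) \<Longrightarrow>
      h (length as) (rho_prod (M G) as) = rho_prod (M H) (map \<phi> as)"
  shows "kmult_map (M G) (M H) \<phi> = h"
proof
  fix n
  interpret G: special G by (rule G)
  interpret H: special H by (rule H)
  have nz: "carrier (nonzero (M G)) = carrier (K1 (M G))" by (auto simp: K1_def)
  show "kmult_map (M G) (M H) \<phi> n = h n"
    unfolding kmult_map_def
  proof (rule the_equality)
    show "h n \<in> hom (gcomp (kmult (M G)) n) (gcomp (kmult (M H)) n) \<inter> extensional (gcar (kmult (M G)) n) \<and>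
        (\<forall>as\<in>lists (carrier (nonzero (M G))). length as = n \<longrightarrow> h n (rho_prod (M G) as) = rho_prod (M H) (map \<phi> as))"
      using igr_homD(1,2)[OF h] rho by auto
    fix g
    assume g: "g \<in> hom (gcomp (kmult (M G)) n) (gcomp (kmult (M H)) n) \<inter> extensional (gcar (kmult (M G)) n) \<and>
        (\<forall>as\<in>lists (carrier (nonzero (M G))). length as = n \<longrightarrow> g (rho_prod (M G) as) = rho_prod (M H) (map \<phi> as))"
    show "g = h n"
    proof (rule G.multp.hom_unique)
      show "Group.group (gcomp (kmult (M H)) n)"
        by (rule comm_group.axioms(2)[OF H.multp.comm_group_gcomp])
      fix w assume w: "w \<in> lists (carrier (K1 (M G)))" "length w = n"
      have "G.mult_symbol n (word w) = rho_prod (M G) w"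
        using G.rho_prod_eq[OF w(1)] w(2) by simp
      then show "g (G.mult_symbol n (word w)) = h n (G.mult_symbol n (word w))"
        using g rho[of w] w nz by simp
    qed (use g igr_homD(1,2)[OF h] in auto)
  qed
qed

text \<open>The universal property supplies a homomorphism with the prescribed values on symbols,
  and \<open>kmult_map_eq\<close> identifies it with the described map. The second conclusion
  records these values for later use.\<close>

lemma kmult_map_hom:
  assumes G: "special G" and H: "special H" and f: "f \<in> sg_hom G H"
  shows "kmult_map (M G) (M H) (M_map G f) \<in> igr_hom (kmult (M G)) (kmult (M H))"
    and "as \<in> lists (carrier (nonzero (M G))) \<Longrightarrow>
      kmult_map (M G) (M H) (M_map G f) (length as) (rho_prod (M G) as) = rho_prod (M H) (map (M_map G f) as)"
proof -
  interpret G: special G by (rule G)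
  interpret H: special H by (rule H)
  define \<phi> where "\<phi> = M_map G f"
  have phi: "\<phi> \<in> hyperfield_hom (M G) (M H)"
    unfolding \<phi>_def by (rule M_map_hom) (use G H f in \<open>simp_all add: special_iff\<close>)
  have phi_Some: "\<phi> (Some a) = Some (f a)" if "a \<in> carrier G" for a
    using that by (simp add: \<phi>_def M_map_apply carrier_M)
  have phi_closed: "\<phi> x \<in> carrier (K1 (M H))" if "x \<in> carrier (K1 (M G))" for x
    using that sg_hom_closed[OF f] by (auto simp: G.K1_carrier H.K1_carrier phi_Some)
  have nz: "carrier (nonzero (M G)) = carrier (K1 (M G))" by (auto simp: K1_def)
  let ?\<delta> = "\<lambda>x. H.mult_symbol 1 (word [x])"
  have "\<exists>h\<in>igr_hom (kmult (M G)) (kmult (M H)). \<forall>w\<in>lists (carrier (K1 (M G))).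
      h (length w) (G.mult_symbol (length w) (word w)) = word_product (kmult (M H)) (\<lambda>x. ?\<delta> (\<phi> x)) w"
  proof (rule G.multp.universal)
    show "inductive_graded_ring (kmult (M H))" by (rule H.multp.inductive_graded_ring)
    show "gtop (kmult (M H)) 0 = gunit (kmult (M H))" by (rule H.multp.top_zero)
    show "?\<delta> (\<phi> x) \<in> gcar (kmult (M H)) 1" if "x \<in> carrier (K1 (M G))" for x
      by (rule H.multp.kappa_gen_closed[OF phi_closed[OF that]])
    have "f (sneg G) = sneg H" using f by (simp add: sg_hom_def)
    then show "?\<delta> (\<phi> (Some (sneg G))) = gtop (kmult (M H)) 1"
      by (simp add: phi_Some H.multp.top_eq)
    show "?\<delta> (\<phi> (x \<oplus>\<^bsub>K1 (M G)\<^esub> y)) = ?\<delta> (\<phi> x) \<otimes>\<^bsub>gcomp (kmult (M H)) 1\<^esub> ?\<delta> (\<phi> y)"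
      if xy: "x \<in> carrier (K1 (M G))" "y \<in> carrier (K1 (M G))" for x y
    proof -
      have "\<phi> (x \<oplus>\<^bsub>K1 (M G)\<^esub> y) = \<phi> x \<oplus>\<^bsub>K1 (M H)\<^esub> \<phi> y"
        using hyperfield_homD(5)[OF phi, of x y] xy
        by (auto simp: G.K1_carrier G.K1_add H.K1_add)
      then show ?thesis
        using H.multp.kappa_gen_add[OF phi_closed[OF xy(1)] phi_closed[OF xy(2)]] by simp
    qed
    show "gprod (kmult (M H)) 1 1 (?\<delta> (\<phi> x)) (?\<delta> (\<phi> y)) = \<one>\<^bsub>gcomp (kmult (M H)) 2\<^esub>"
      if xy: "(x, y) \<in> K_pairs (M G)" for x y
    proof -
      obtain a b where ab: "x = Some a" "y = Some b" "a \<in> carrier G" "b \<in> carrier G"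
        "b \<in> srep G \<one>\<^bsub>G\<^esub> (sminus G a)"
        using xy by (rule G.K_pairsE)
      have fy: "\<phi> y \<in> carrier (K1 (M H))" using phi_closed ab by (simp add: G.K1_carrier)
      show ?thesis
      proof (cases "f a = \<one>\<^bsub>H\<^esub>")
        case True
        \<comment> \<open>A morphism may send \<open>a \<noteq> 1\<close> to one, and then the image
          of a relation is no longer among \<open>K_pairs\<close>.\<close>
        then have "\<phi> x = \<zero>\<^bsub>K1 (M H)\<^esub>" by (simp add: ab phi_Some H.K1_zero)
        then show ?thesis using H.multp.gen_prod_zero(2)[OF fy] by simp
      next
        case False
        have x: "x \<in> carrier (M G)" "y \<in> hadd (M G) \<one>\<^bsub>M G\<^esub> (hneg (M G) x)"
          using xy unfolding K_pairs_def by blast+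
        have "\<one>\<^bsub>M G\<^esub> \<in> carrier (M G)" "hneg (M G) x \<in> carrier (M G)" using x(1) by auto
        from hyperfield_homD(2)[OF phi this x(2)]
        have "\<phi> y \<in> hadd (M H) \<one>\<^bsub>M H\<^esub> (hneg (M H) (\<phi> x))"
          unfolding hyperfield_homD(3)[OF phi x(1)] hyperfield_homD(6)[OF phi] .
        moreover have "\<phi> x \<in> carrier (M H)" by (rule hyperfield_homD(1)[OF phi x(1)])
        moreover have "\<phi> x \<noteq> hzero (M H)" "\<phi> x \<noteq> \<one>\<^bsub>M H\<^esub>" using False by (simp_all add: ab phi_Some)
        ultimately have "(\<phi> x, \<phi> y) \<in> K_pairs (M H)" unfolding K_pairs_def by blast
        then show ?thesis by (rule H.multp.kappa_gen_relation)
      qed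
    qed
  qed
  then obtain h where h: "h \<in> igr_hom (kmult (M G)) (kmult (M H))"
    and h_word: "\<And>w. w \<in> lists (carrier (K1 (M G))) \<Longrightarrow>
      h (length w) (G.mult_symbol (length w) (word w)) = word_product (kmult (M H)) (\<lambda>x. ?\<delta> (\<phi> x)) w"
    by blast
  have h_rho: "h (length as) (rho_prod (M G) as) = rho_prod (M H) (map \<phi> as)"
    if as: "as \<in> lists (carrier (nonzero (M G)))" for as
  proof -
    have as': "as \<in> lists (carrier (K1 (M G)))" using as nz by simp
    have map: "map \<phi> as \<in> lists (carrier (K1 (M H)))" using as' phi_closed by (auto simp: in_lists_conv_set)
    show ?thesis
      unfolding G.rho_prod_eq[OF as'] h_word[OF as'] H.rho_prod_eq[OF map]
        word_product_map[where g = \<phi> and \<delta> = "\<lambda>x. H.mult_symbol 1 (word [x])"]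
      by (rule H.multp.word_product_kappa[OF map])
  qed
  have "kmult_map (M G) (M H) (M_map G f) = h"
    unfolding \<phi>_def[symmetric] by (rule kmult_map_eq[OF G H h h_rho])
  then show "kmult_map (M G) (M H) (M_map G f) \<in> igr_hom (kmult (M G)) (kmult (M H))"
    and "as \<in> lists (carrier (nonzero (M G))) \<Longrightarrow>
      kmult_map (M G) (M H) (M_map G f) (length as) (rho_prod (M G) as) = rho_prod (M H) (map (M_map G f) as)"
    using h h_rho unfolding \<phi>_def by auto
qed

lemma kmult_map_id:
  assumes "special G"
  shows "kmult_map (M G) (M G) (M_map G (restrict id (carrier G))) = igr_id (kmult (M G))"
proof -
  interpret G: special G by (rule assms)
  note R = G.multp.inductive_graded_ring
  show ?thesis
  proof (rule kmult_map_eq[OF assms assms igr_id_hom[OF R]])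
    fix as assume as: "as \<in> lists (carrier (nonzero (M G)))"
    then have as': "as \<in> lists (carrier (K1 (M G)))" by (simp add: K1_def)
    have "map (M_map G (restrict id (carrier G))) as = map id as"
      using as by (intro map_cong) (auto simp: M_map_id in_lists_conv_set)
    moreover have "rho_prod (M G) as \<in> gcar (kmult (M G)) (length as)"
      unfolding G.rho_prod_eq[OF as'] by (rule G.multp.kappa_closed[OF word_homogeneous[OF as']])
    ultimately show "igr_id (kmult (M G)) (length as) (rho_prod (M G) as) =
        rho_prod (M G) (map (M_map G (restrict id (carrier G))) as)"
      by (simp add: igr_id_def)
  qed
qed

text \<open>The composite of the two graded homomorphisms has the values on symbols that
  characterise the left-hand side.\<close>

lemma kmult_map_compose:
  assumes G: "special G" and H: "special H" and L: "special L"
    and f: "f \<in> sg_hom G H" and g: "g \<in> sg_hom H L"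
  shows "kmult_map (M G) (M L) (M_map G (compose (carrier G) g f)) =
    igr_comp (kmult (M G)) (kmult_map (M H) (M L) (M_map H g)) (kmult_map (M G) (M H) (M_map G f))"
proof -
  interpret G: special G by (rule G)
  note kf = kmult_map_hom[OF G H f] and kg = kmult_map_hom[OF H L g]
  show ?thesis
  proof (rule kmult_map_eq[OF G L igr_comp_hom[OF G.multp.inductive_graded_ring kf(1) kg(1)]])
    fix as assume as: "as \<in> lists (carrier (nonzero (M G)))"
    then have as': "as \<in> lists (carrier (K1 (M G)))" by (simp add: K1_def)
    have set: "set as \<subseteq> Some ` carrier G" using as by (auto simp: in_lists_conv_set)
    have "M_map G f x \<in> carrier (nonzero (M H))" if "x \<in> set as" for x
      using that set sg_hom_closed[OF f] by (auto simp: M_map_apply carrier_M M_def)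
    then have map: "map (M_map G f) as \<in> lists (carrier (nonzero (M H)))"
      by (auto simp: in_lists_conv_set)
    have "M_map G (compose (carrier G) g f) x = M_map H g (M_map G f x)" if "x \<in> set as" for x
      using that set unfolding M_map_compose[OF f] by (auto simp: compose_def)
    then have maps: "map (M_map G (compose (carrier G) g f)) as = map (M_map H g) (map (M_map G f) as)"
      by simp
    have "rho_prod (M G) as \<in> gcar (kmult (M G)) (length as)"
      unfolding G.rho_prod_eq[OF as'] by (rule G.multp.kappa_closed[OF word_homogeneous[OF as']])
    then show "igr_comp (kmult (M G)) (kmult_map (M H) (M L) (M_map H g)) (kmult_map (M G) (M H) (M_map G f))
        (length as) (rho_prod (M G) as) = rho_prod (M L) (map (M_map G (compose (carrier G) g f)) as)"
      unfolding maps using kf(2)[OF as] kg(2)[OF map] by (simp add: igr_comp_def compose_def del: map_map)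
  qed
qed

lemma functor_kmult:
  "is_functor (SG :: ('a special_group, 'a \<Rightarrow> 'a) category) Igr
    \<lparr>fobj = (\<lambda>G. kmult (M G)), fmor = (\<lambda>G H f. kmult_map (M G) (M H) (M_map G f))\<rparr>"
  unfolding is_functor_def SG_simps Igr_simps mem_Collect_eq special_iff[symmetric]
proof (intro conjI ballI category_SG category_Igr; unfold mem_Collect_eq special_iff[symmetric] cat_functor.simps)
  fix G :: "'a special_group" assume G: "special G"
  interpret G: special G by (rule G)
  show "inductive_graded_ring (kmult (M G))" by (rule G.multp.inductive_graded_ring)
  show "kmult_map (M G) (M G) (M_map G (restrict id (carrier G))) = igr_id (kmult (M G))"
    by (rule kmult_map_id[OF G])
qed (use kmult_map_hom kmult_map_compose in blast)+

section \<open>The isomorphism between the two K-theories\<close>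

context special
begin

lemma kmult_kdm_hom:
  "\<exists>h\<in>igr_hom (kmult (M G)) (kdm G). \<forall>w\<in>lists (carrier (K1 (M G))).
    h (length w) (mult_symbol (length w) (word w)) = word_product (kdm G) (\<lambda>x. dm.cls (word [the x])) w"
proof (rule multp.universal)
  show "inductive_graded_ring (kdm G)" by (rule dmp.inductive_graded_ring)
  show "gtop (kdm G) 0 = gunit (kdm G)" by (rule dmp.top_zero)
  show "dm.cls (word [the x]) \<in> gcar (kdm G) 1" if "x \<in> carrier (K1 (M G))" for x
    by (rule dmp.kappa_gen_closed) (use that in \<open>auto simp: K1_carrier k1_simps\<close>)
  show "dm.cls (word [the (Some (sneg G))]) = gtop (kdm G) 1" by (simp add: dmp.top_eq)
  show "dm.cls (word [the (x \<oplus>\<^bsub>K1 (M G)\<^esub> y)]) =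
      dm.cls (word [the x]) \<otimes>\<^bsub>gcomp (kdm G) 1\<^esub> dm.cls (word [the y])"
    if "x \<in> carrier (K1 (M G))" "y \<in> carrier (K1 (M G))" for x y
    using that dmp.kappa_gen_add[of "the x" "the y"] by (auto simp: K1_carrier K1_add k1_simps)
  show "gprod (kdm G) 1 1 (dm.cls (word [the x])) (dm.cls (word [the y])) = \<one>\<^bsub>gcomp (kdm G) 2\<^esub>"
    if xy: "(x, y) \<in> K_pairs (M G)" for x y
  proof -
    obtain a b where ab: "x = Some a" "y = Some b" "a \<in> carrier G" "b \<in> carrier G"
      "b \<in> srep G \<one> (sminus G a)"
      using xy by (rule K_pairsE)
    have in1: "b \<in> carrier (k1 G)" "a \<in> carrier (k1 G)" "sminus G b \<in> carrier (k1 G)"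
      using ab by (simp_all add: k1_simps)
    have "(b, b \<otimes> sminus G a) \<in> kdm_pairs G" unfolding kdm_pairs_def using ab by auto
    \<comment> \<open>The sign is shifted from \<open>a\<close> to \<open>b\<close> so that the
      vanishing product of \<open>b\<close> and \<open>-b\<close> can be split off.\<close>
    then have "(b, sminus G b \<otimes> a) \<in> kdm_pairs G" using ab by (simp add: sminus_mult mult_sminus)
    then have "dmp.gen_prod b (sminus G b \<oplus>\<^bsub>k1 G\<^esub> a) = \<one>\<^bsub>gcomp (kdm G) 2\<^esub>"
      using dmp.kappa_gen_relation by (simp add: k1_simps)
    moreover have "dmp.gen_prod b (sminus G b) = \<one>\<^bsub>gcomp (kdm G) 2\<^esub>"
      using dmp.gen_prod_zeroI[OF in1(1,3)] dm.hyperbolic[OF in1(1)] by (simp add: k1_simps sminus_def)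
    ultimately have "dmp.gen_prod b a = \<one>\<^bsub>gcomp (kdm G) 2\<^esub>"
      using dmp.gen_prod_cancel[OF in1(1,3,2)] by simp
    then show ?thesis using dmp.gen_prod_commute[OF in1(2,1)] ab by simp
  qed
qed

lemma kdm_kmult_hom:
  "\<exists>h\<in>igr_hom (kdm G) (kmult (M G)). \<forall>w\<in>lists (carrier (k1 G)).
    h (length w) (dm.cls (word w)) = word_product (kmult (M G)) (\<lambda>a. mult_symbol 1 (word [Some a])) w"
proof (rule dmp.universal)
  have Some_in: "Some a \<in> carrier (K1 (M G))" if "a \<in> carrier (k1 G)" for a
    using that by (simp add: K1_carrier k1_simps)
  show "inductive_graded_ring (kmult (M G))" by (rule multp.inductive_graded_ring)
  show "gtop (kmult (M G)) 0 = gunit (kmult (M G))" by (rule multp.top_zero)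
  show "mult_symbol 1 (word [Some a]) \<in> gcar (kmult (M G)) 1" if "a \<in> carrier (k1 G)" for a
    by (rule multp.kappa_gen_closed[OF Some_in[OF that]])
  show "mult_symbol 1 (word [Some (sneg G)]) = gtop (kmult (M G)) 1" by (simp add: multp.top_eq)
  show "mult_symbol 1 (word [Some (a \<oplus>\<^bsub>k1 G\<^esub> b)]) =
      mult_symbol 1 (word [Some a]) \<otimes>\<^bsub>gcomp (kmult (M G)) 1\<^esub> mult_symbol 1 (word [Some b])"
    if "a \<in> carrier (k1 G)" "b \<in> carrier (k1 G)" for a b
    using multp.kappa_gen_add[OF Some_in[OF that(1)] Some_in[OF that(2)]] by (simp add: K1_add k1_simps)
  show "multp.gen_prod (Some a) (Some ab) = \<one>\<^bsub>gcomp (kmult (M G)) 2\<^esub>"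
    if pair: "(a, ab) \<in> kdm_pairs G" for a ab
  proof -
    obtain b where ab: "ab = a \<otimes> b" "a \<in> carrier G" "b \<in> carrier G" "a \<in> srep G \<one> b"
      using pair unfolding kdm_pairs_def by blast
    have inK: "Some a \<in> carrier (K1 (M G))" "Some (sminus G a) \<in> carrier (K1 (M G))"
      "Some (sminus G b) \<in> carrier (K1 (M G))"
      using ab by (simp_all add: K1_carrier)
    have "multp.gen_prod (Some a) (Some (sminus G a)) = \<one>\<^bsub>gcomp (kmult (M G)) 2\<^esub>"
      using multp.gen_prod_zeroI[OF inK(1,2)] mult.hyperbolic[OF inK(1)] by (simp add: K1_add sminus_def)
    then have "multp.gen_prod (Some a) (Some (sminus G a) \<oplus>\<^bsub>K1 (M G)\<^esub> Some (sminus G b)) =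
        multp.gen_prod (Some a) (Some (sminus G b))"
      by (rule multp.gen_prod_cancel[OF inK])
    \<comment> \<open>The two signs cancel: \<open>(-a)(-b) = ab\<close>.\<close>
    moreover have "Some (sminus G a) \<oplus>\<^bsub>K1 (M G)\<^esub> Some (sminus G b) = Some ab"
      using ab by (simp add: K1_add sminus_mult mult_sminus)
    \<comment> \<open>Reading \<open>b\<close> as \<open>-(-b)\<close> turns
      \<open>a \<in> D(1, b)\<close> into a relation for the pair \<open>-b, a\<close>, available
      unless \<open>-b = 1\<close>; in that case the generator itself is zero.\<close>
    moreover have "multp.gen_prod (Some a) (Some (sminus G b)) = \<one>\<^bsub>gcomp (kmult (M G)) 2\<^esub>"
    proof (cases "sminus G b = \<one>")
      case True
      then show ?thesis using multp.gen_prod_zero(1)[OF inK(1)] by (simp add: K1_zero)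
    next
      case False
      then have "(Some (sminus G b), Some a) \<in> K_pairs (M G)"
        using ab by (intro K_pairsI) simp_all
      then show ?thesis
        using multp.kappa_gen_relation multp.gen_prod_commute[OF inK(1,3)] by simp
    qed
    ultimately show ?thesis by simp
  qed
qed

text \<open>The two homomorphisms add and remove \<open>Some\<close> letter by letter, so both
  composites fix the class of every word, and \<open>igr_hom_unique\<close> makes them
  identities.\<close>

lemma kmult_kdm_isomorphic: "igr_isomorphic (kmult (M G)) (kdm G)"
proof -
  note R = multp.inductive_graded_ring and S = dmp.inductive_graded_ring
  obtain f where f: "f \<in> igr_hom (kmult (M G)) (kdm G)"
    and f_word: "\<And>w. w \<in> lists (carrier (K1 (M G))) \<Longrightarrow>
      f (length w) (mult_symbol (length w) (word w)) = word_product (kdm G) (\<lambda>x. dm.cls (word [the x])) w"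
    using kmult_kdm_hom by blast
  obtain g where g: "g \<in> igr_hom (kdm G) (kmult (M G))"
    and g_word: "\<And>w. w \<in> lists (carrier (k1 G)) \<Longrightarrow>
      g (length w) (dm.cls (word w)) = word_product (kmult (M G)) (\<lambda>a. mult_symbol 1 (word [Some a])) w"
    using kdm_kmult_hom by blast
  have f_word': "f (length w) (mult_symbol (length w) (word w)) = dm.cls (word (map the w))"
    and the_w: "map the w \<in> lists (carrier (k1 G))" "map Some (map the w) = w"
    if w: "w \<in> lists (carrier (K1 (M G)))" for w
  proof -
    show the_w: "map the w \<in> lists (carrier (k1 G))"
      using w by (auto simp: in_lists_conv_set K1_carrier k1_simps)
    show "map Some (map the w) = w"
      using w by (auto simp: in_lists_conv_set K1_carrier intro!: map_idI)
    show "f (length w) (mult_symbol (length w) (word w)) = dm.cls (word (map the w))"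
      unfolding f_word[OF w] word_product_map[where g = the and \<delta> = "\<lambda>a. dm.cls (word [a])"]
      using dmp.word_product_kappa[OF the_w] by simp
  qed
  have g_word': "g (length w) (dm.cls (word w)) = mult_symbol (length w) (word (map Some w))"
    and Some_w: "map Some w \<in> lists (carrier (K1 (M G)))"
    if w: "w \<in> lists (carrier (k1 G))" for w
  proof -
    show Some_w: "map Some w \<in> lists (carrier (K1 (M G)))"
      using w by (auto simp: in_lists_conv_set K1_carrier k1_simps)
    show "g (length w) (dm.cls (word w)) = mult_symbol (length w) (word (map Some w))"
      unfolding g_word[OF w] word_product_map[where g = Some and \<delta> = "\<lambda>x. mult_symbol 1 (word [x])"]
      using multp.word_product_kappa[OF Some_w] by simp
  qed
  have "igr_comp (kmult (M G)) g f = igr_id (kmult (M G))"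
  proof (rule multp.igr_hom_unique[OF R igr_comp_hom[OF R f g] igr_id_hom[OF R]])
    fix w assume w: "w \<in> lists (carrier (K1 (M G)))"
    then show "igr_comp (kmult (M G)) g f (length w) (mult_symbol (length w) (word w)) =
        igr_id (kmult (M G)) (length w) (mult_symbol (length w) (word w))"
      using multp.kappa_closed[OF word_homogeneous[OF w]] f_word'[OF w] g_word'[OF the_w(1)[OF w]] the_w(2)[OF w]
      by (simp add: igr_comp_def igr_id_def compose_def del: map_map)
  qed
  moreover have "igr_comp (kdm G) f g = igr_id (kdm G)"
  proof (rule dmp.igr_hom_unique[OF S igr_comp_hom[OF S g f] igr_id_hom[OF S]])
    fix w assume w: "w \<in> lists (carrier (k1 G))"
    then show "igr_comp (kdm G) f g (length w) (dm.cls (word w)) = igr_id (kdm G) (length w) (dm.cls (word w))"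
      using dmp.kappa_closed[OF word_homogeneous[OF w]] g_word'[OF w] f_word'[OF Some_w[OF w]]
      by (simp add: igr_comp_def igr_id_def compose_def comp_def)
  qed
  ultimately show ?thesis unfolding igr_isomorphic_def using R S f g by blast
qed

end

theorem theorem4p8:
  shows "is_equivalence (SG :: ('a special_group, 'a \<Rightarrow> 'a) category) SMF M_functor \<and>
    is_functor (SG :: ('a special_group, 'a \<Rightarrow> 'a) category) Igr
      \<lparr>fobj = (\<lambda>G. kmult (M G)),
       fmor = (\<lambda>G H f. kmult_map (M G) (M H) (M_map G f))\<rparr> \<and>
    (\<forall>(G :: 'a special_group) (H :: 'a special_group) f. special_group G \<longrightarrow> special_group H \<longrightarrow>
      f \<in> sg_hom G H \<longrightarrow>
      (\<forall>as\<in>lists (carrier (nonzero (M G))).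
        kmult_map (M G) (M H) (M_map G f) (length as) (rho_prod (M G) as) =
          rho_prod (M H) (map (M_map G f) as))) \<and>
    (\<forall>G :: 'a special_group. special_group G \<longrightarrow> igr_isomorphic (kmult (M G)) (kdm G))"
  using equivalence_M functor_kmult kmult_map_hom(2) special.kmult_kdm_isomorphic
  unfolding special_iff[symmetric] by blast

end
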